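(* Let $N,d\ge1$ be integers with $N>d/2$, and let $W$ be an $(N,d)$-Brownian sheet with zero set $\mathcal Z$. Almost surely, simultaneously for every orthogonal projection $p:\mathbb{R}^N\to\mathbb{R}^{N'}$ whose rank $N'=\mathrm{rank}(p)$ satisfies $N-\frac d2\le N'<N$, $$\dim_H\big(p(\mathcal Z)\big)=\dim_H(\mathcal Z)\quad(=N-d/2).$$
   Context: An $(N,d)$-Brownian sheet is a continuous process $W=(W_1,\dots,W_d):\mathbb{R}_+^N\to\mathbb{R}^d$. Its coordinates $W_1,\dots,W_d$ are independent centered Gaussian processes with $\mathbb{E}[W_j(s)W_j(t)]=\prod_{k=1}^N\min(s_k,t_k)$. Its zero set is $\mathcal Z:=\{t\in\mathbb{R}_+^N: W(t)=0\}$. An orthogonal projection $p:\mathbb{R}^N\to\mathbb{R}^{N'}$ is the orthogonal projection onto an $N'$-dimensional linear subspace, identified with $\mathbb{R}^{N'}$ via an orthonormal basis. $\dim_H$ denotes Hausdorff dimension.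
   Formalization: R_+^N is taken to be the open orthant (0,∞)^N; on [0,∞)^N the sheet vanishes on the coordinate hyperplanes, so for N≥2, d≥3 the zero set would have dimension N−1 > N−d/2 and the claim would fail. *)

theory Defs
  imports "HOL-Probability.Probability"
begin

definition hausdorff_pre :: "real \<Rightarrow> real \<Rightarrow> 'a::metric_space set \<Rightarrow> ennreal" where
  "hausdorff_pre s \<delta> A =
     (INF U \<in> {U :: nat \<Rightarrow> 'a set. A \<subseteq> (\<Union>i. U i) \<and> (\<forall>i. bounded (U i) \<and> diameter (U i) \<le> \<delta>)}.
        (\<Sum>i. if U i = {} then 0 else ennreal (diameter (U i) powr s)))"

definition hausdorff_measure :: "real \<Rightarrow> 'a::metric_space set \<Rightarrow> ennreal" where
  "hausdorff_measure s A = (SUP \<delta> \<in> {0<..}. hausdorff_pre s \<delta> A)"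

text \<open>Hausdorff dimension: inf of the s > 0 with H^s(A) = 0 (for subsets of R^n this set is
  nonempty and bounded below by 0).\<close>
definition hausdorff_dim :: "'a::metric_space set \<Rightarrow> real" where
  "hausdorff_dim A = Inf {s::real. 0 < s \<and> hausdorff_measure s A = 0}"

definition pos_orthant :: "(real^'n) set" where
  "pos_orthant = {t. \<forall>k. 0 < t $ k}"

definition sheet_cov :: "real^'n \<Rightarrow> real^'n \<Rightarrow> real" where
  "sheet_cov s t = (\<Prod>k\<in>UNIV. min (s $ k) (t $ k))"

definition centered_normal :: "'w measure \<Rightarrow> ('w \<Rightarrow> real) \<Rightarrow> real \<Rightarrow> bool" where
  "centered_normal M X v \<longleftrightarrow>
     X \<in> borel_measurable M \<and>
     (v = 0 \<longrightarrow> (AE \<omega> in M. X \<omega> = 0)) \<and>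
     (0 < v \<longrightarrow> distributed M lborel X (normal_density 0 (sqrt v)))"

text \<open>(N,d)-Brownian sheet on the probability space M, indexed by R_+^N = (0,oo)^N
  (N = CARD('n)) with values in R^d (d = CARD('d)): a.s. continuous sample paths;
  each coordinate is a centered Gaussian process (every finite linear combination
  of its values is centered normal with the variance given by the covariance
  prod_k min(s_k,t_k)); and the coordinate processes are independent.\<close>
definition brownian_sheet :: "'w measure \<Rightarrow> ('w \<Rightarrow> real^'n \<Rightarrow> real^'d) \<Rightarrow> bool" where
  "brownian_sheet M W \<longleftrightarrow>
     prob_space M \<and>
     (\<forall>t\<in>pos_orthant. \<forall>j. (\<lambda>\<omega>. W \<omega> t $ j) \<in> borel_measurable M) \<and>
     (AE \<omega> in M. continuous_on pos_orthant (W \<omega>)) \<and>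
     (\<forall>j. \<forall>(k::nat) (t::nat \<Rightarrow> real^'n) (c::nat \<Rightarrow> real).
        (\<forall>i<k. t i \<in> pos_orthant) \<longrightarrow>
        centered_normal M (\<lambda>\<omega>. \<Sum>i<k. c i * (W \<omega> (t i) $ j))
          (\<Sum>i<k. \<Sum>l<k. c i * c l * sheet_cov (t i) (t l))) \<and>
     prob_space.indep_vars M (\<lambda>_. PiM pos_orthant (\<lambda>_. borel))
        (\<lambda>j \<omega>. restrict (\<lambda>t. W \<omega> t $ j) pos_orthant) UNIV"

definition sheet_zero_set :: "('w \<Rightarrow> real^'n \<Rightarrow> real^'d) \<Rightarrow> 'w \<Rightarrow> (real^'n) set" where
  "sheet_zero_set W \<omega> = {t \<in> pos_orthant. W \<omega> t = 0}"

text \<open>Orthogonal projection of R^N onto a linear subspace (its range), viewed inside R^N;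
  its rank is the dimension of the range.\<close>
definition orth_proj :: "(real^'n \<Rightarrow> real^'n) \<Rightarrow> bool" where
  "orth_proj P \<longleftrightarrow> linear P \<and> P \<circ> P = P \<and> (\<forall>x y. P x \<bullet> y = x \<bullet> P y)"

end

theory Submission
  imports Defs "HOL-Real_Asymp.Real_Asymp"
begin

text \<open>Write N and d for the two dimensions and put \<open>\<alpha> = N - d/2\<close>.

  Lower bound. The weights \<open>exp (- 2\<^sup>n \<bar>W t\<bar>\<^sup>2 / 2)\<close>, normalised by their means, on a grid of mesh \<open>2\<^sup>-\<^sup>n\<close> have pair
  correlations at most \<open>(1 - \<rho>\<^sup>2)\<^sup>-\<^sup>d\<^sup>/\<^sup>2\<close> with \<open>\<rho>\<close> the correlation of the sheet. Hence their discrete s-energy is bounded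
  for \<open>s < \<alpha>\<close>, and spreading the grid over many boxes at very different scales makes the variance of the total mass
  as small as desired, which gives probability one without a zero-one law.

  Projections. By sectorial local nondeterminism, a moment computation shows that a slab of width \<open>2\<^sup>-\<^sup>n\<close> around a
  translate of the kernel of a projection P meets few grid cubes where W is of order \<open>2\<^sup>-\<^sup>n\<^sup>/\<^sup>2\<close>: at most
  \<open>2\<close> to the power \<open>n (max 0 (dim (ker P) - d/2) + \<epsilon>)\<close>. High moments beat the polynomial size of a net of slabs, so the bound
  holds simultaneously for all P, and covers of the projected zero set lift to covers of the zero set (Kaufman).
  The case P = 0 of this argument is the upper bound for the dimension of the zero set itself.\<close>

section \<open>Gaussian integrals of quadratic forms\<close>

text \<open>The obstacle is the simultaneity: the exceptional null set must not depend on P, and P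
  may be chosen after looking at the zero set. Hence no energy of a projected measure is estimated.
  The only lower bound proved by second moments concerns the zero set itself; a projection inherits
  it because a too efficient cover of the image could be lifted. The lift loses max 0 (dim (ker P) -
  d/2), and the rank hypothesis says exactly that this loss is 0. The chaining argument gives
  Hoelder exponents below 1/2 only, so a grid cube of side 2^(-n) containing a zero is known to have
  a value of size 2^(-n (1/2 - \<epsilon>)) at its corner, not 2^(-n/2). All losses of this kind are
  absorbed because exponents may be moved slightly before the dimension is compared. Exponential
  weights replace indicators in the probability bounds because their joint expectation is det (1 +
  R)^(-1/2) for each coordinate of W, with R the scaled covariance matrix. This makes sense for
  nearby and for equal points, which occur in all higher moments.\<close>

lemma nn_integral_gauss_quadratic:
  fixes a L :: real
  assumes "0 < 1 + a"
  shows "(\<integral>\<^sup>+x. ennreal (exp (- (a * x\<^sup>2 + 2 * x * L) / 2)) \<partial>std_normal_distribution)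
    = ennreal (exp (L\<^sup>2 / (2 * (1 + a))) / sqrt (1 + a))"
proof -
  define s where "s = 1 / sqrt (1 + a)"
  define K where "K = exp (L\<^sup>2 / (2 * (1 + a))) / sqrt (1 + a)"
  have s: "0 < s" and s2: "s\<^sup>2 = 1 / (1 + a)"
    using assms by (auto simp: s_def power_divide)
  have K: "0 \<le> K" using assms by (simp add: K_def)
  have ex: "- x\<^sup>2 / 2 + - (a * x\<^sup>2 + 2 * x * L) / 2
      = L\<^sup>2 / (2 * (1 + a)) + - (x - (- L / (1 + a)))\<^sup>2 / (2 * s\<^sup>2)" for x
  proof -
    have "(x + L / D)\<^sup>2 * D = x\<^sup>2 * D + 2 * x * L + L\<^sup>2 / D" if "D \<noteq> 0" for D :: real
      using that by (simp add: power2_eq_square field_simps)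
    then have "(x + L / (1 + a))\<^sup>2 * (1 + a) = x\<^sup>2 * (1 + a) + 2 * x * L + L\<^sup>2 / (1 + a)"
      using assms by (metis less_irrefl)
    moreover have "(x - (- L / (1 + a)))\<^sup>2 / (2 * s\<^sup>2) = (x + L / (1 + a))\<^sup>2 * (1 + a) / 2"
      by (simp add: s2)
    moreover have "L\<^sup>2 / (2 * (1 + a)) = L\<^sup>2 / (1 + a) / 2" by simp
    ultimately show ?thesis by (simp add: algebra_simps add_divide_distrib diff_divide_distrib)
  qed
  have rt: "1 / sqrt (2 * pi) = (1 / sqrt (1 + a)) * (1 / sqrt (2 * pi * s\<^sup>2))"
    using assms by (simp add: s2 real_sqrt_divide real_sqrt_mult)
  have "std_normal_density x * exp (- (a * x\<^sup>2 + 2 * x * L) / 2)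
     = K * normal_density (- L / (1 + a)) s x" for x
  proof -
    have "std_normal_density x * exp (- (a * x\<^sup>2 + 2 * x * L) / 2)
      = (1 / sqrt (2 * pi)) * exp (- x\<^sup>2 / 2 + - (a * x\<^sup>2 + 2 * x * L) / 2)"
      by (simp add: std_normal_density_def mult_exp_exp)
    also have "\<dots> = (1 / sqrt (2 * pi)) * (exp (L\<^sup>2 / (2 * (1 + a))) * exp (- (x - (- L / (1 + a)))\<^sup>2 / (2 * s\<^sup>2)))"
      by (simp only: ex exp_add)
    also have "\<dots> = K * normal_density (- L / (1 + a)) s x"
      unfolding K_def normal_density_def rt by simp
    finally show ?thesis .
  qed
  then have "(\<integral>\<^sup>+x. ennreal (exp (- (a * x\<^sup>2 + 2 * x * L) / 2)) \<partial>std_normal_distribution)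
      = (\<integral>\<^sup>+x. ennreal (K * normal_density (- L / (1 + a)) s x) \<partial>lborel)"
    by (subst nn_integral_density) (auto simp: ennreal_mult[symmetric])
  also have "\<dots> = ennreal K * (\<integral>\<^sup>+x. ennreal (normal_density (- L / (1 + a)) s x) \<partial>lborel)"
    using K s by (simp add: ennreal_mult nn_integral_cmult)
  also have "(\<integral>\<^sup>+x. ennreal (normal_density (- L / (1 + a)) s x) \<partial>lborel) = 1"
    using s by (subst nn_integral_eq_integral) auto
  finally show ?thesis by (simp add: K_def)
qed

lemma product_sigma_finite_gauss: "product_sigma_finite (\<lambda>_::nat. std_normal_distribution)"
  unfolding product_sigma_finite_def
  by (auto intro!: prob_space_imp_sigma_finite prob_space_normal_density)

text \<open>The index set is a parameter so that one matrix can be restricted to the variables that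
  are not yet integrated out.\<close>

definition qform :: "nat set \<Rightarrow> (nat \<Rightarrow> nat \<Rightarrow> real) \<Rightarrow> (nat \<Rightarrow> real) \<Rightarrow> real" where
  "qform I a x = (\<Sum>p\<in>I. \<Sum>q\<in>I. a p q * x p * x q)"

lemma qform_measurable[measurable]:
  assumes "I \<subseteq> J"
  shows "qform I a \<in> borel_measurable (PiM J (\<lambda>_. std_normal_distribution))"
proof -
  have "(\<lambda>x. x p) \<in> borel_measurable (PiM J (\<lambda>_. std_normal_distribution))" if "p \<in> I" for p
  proof -
    have "(\<lambda>x. x p) \<in> measurable (PiM J (\<lambda>_. std_normal_distribution)) std_normal_distribution"
      using assms that by (intro measurable_component_singleton) auto
    also have "\<dots> = borel_measurable (PiM J (\<lambda>_. std_normal_distribution))"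
      by (intro measurable_cong_sets) auto
    finally show ?thesis .
  qed
  then show ?thesis unfolding qform_def[abs_def] by measurable
qed

lemma qform_insert:
  assumes "finite I" "j \<notin> I" and sym: "\<And>p q. a p q = a q p"
  shows "qform (insert j I) a x = a j j * (x j)\<^sup>2 + 2 * x j * (\<Sum>q\<in>I. a j q * x q) + qform I a x"
proof -
  have "(\<Sum>p\<in>I. a p j * x p * x j) = x j * (\<Sum>q\<in>I. a j q * x q)"
    unfolding sum_distrib_left by (intro sum.cong refl) (simp add: sym[of _ j])
  moreover have "(\<Sum>q\<in>I. a j q * x j * x q) = x j * (\<Sum>q\<in>I. a j q * x q)"
    unfolding sum_distrib_left by (intro sum.cong refl) simp
  ultimately show ?thesis
    unfolding qform_def using assms(1,2)
    by (simp add: sum.distrib power2_eq_square)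
qed

text \<open>Subtracting a rank-one matrix subtracts the square of a linear form. It is applied with
  \<open>b = 1 / (1 + a j j)\<close>, where the 1 is contributed by the Gaussian density of the
  eliminated variable.\<close>

lemma qform_schur:
  "qform I (\<lambda>p q. a p q - a j p * a j q * b) x = qform I a x - b * (\<Sum>q\<in>I. a j q * x q)\<^sup>2"
proof -
  have "b * (\<Sum>q\<in>I. a j q * x q)\<^sup>2 = (\<Sum>p\<in>I. \<Sum>q\<in>I. b * (a j p * x p * (a j q * x q)))"
    by (subst power2_eq_square, subst sum_product) (simp add: sum_distrib_left)
  then show ?thesis
    unfolding qform_def sum_subtractf[symmetric]
    by (simp only: sum_subtractf[symmetric]) (intro sum.cong refl, simp add: algebra_simps)
qed

text \<open>The variables are integrated out one at a time; replacing the quadratic form by its Schur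
  complement is minimising over the eliminated variable, so the lower bounds survive.\<close>
lemma nn_integral_gauss_qform_le:
  fixes v :: "nat \<Rightarrow> real"
  assumes "j \<le> k" and sym: "\<And>p q. a p q = a q p"
    and v: "\<And>i. i \<in> {j..<k} \<Longrightarrow> 0 < v i"
    and lb: "\<And>i c. i \<in> {j..<k} \<Longrightarrow> c i = 1 \<Longrightarrow> v i \<le> (\<Sum>p\<in>{j..i}. (c p)\<^sup>2) + qform {j..i} a c"
  shows "(\<integral>\<^sup>+x. ennreal (exp (- qform {j..<k} a x / 2)) \<partial>PiM {j..<k} (\<lambda>_. std_normal_distribution))
    \<le> ennreal (\<Prod>i\<in>{j..<k}. 1 / sqrt (v i))"
  using assms
proof (induction j arbitrary: a rule: inc_induct)
  case base
  have "prob_space (PiM {} (\<lambda>_::nat. std_normal_distribution))"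
    by (intro prob_space_PiM) auto
  then show ?case by (simp add: qform_def prob_space.emeasure_space_1)
next
  case (step j)
  interpret product_sigma_finite "\<lambda>_::nat. std_normal_distribution"
    by (rule product_sigma_finite_gauss)
  let ?I = "{Suc j..<k}"
  have ins: "{j..<k} = insert j ?I" using step.hyps by auto
  define D where "D = 1 + a j j"
  have "qform {j..j} a (\<lambda>_. 1) = a j j" by (simp add: qform_def)
  then have vD: "v j \<le> D" using step.prems(3)[of j "\<lambda>_. 1"] step.hyps by (simp add: D_def)
  have vj: "0 < v j" using step.prems(2)[of j] step.hyps by simp
  then have D: "0 < D" using vD by simp
  define a' where "a' = (\<lambda>p q. a p q - a j p * a j q * (1 / D))"
  have sym': "a' p q = a' q p" for p q
    by (simp add: a'_def step.prems(1)[of p q] mult.commute)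
  have lb': "v i \<le> (\<Sum>p\<in>{Suc j..i}. (c p)\<^sup>2) + qform {Suc j..i} a' c"
    if i: "i \<in> ?I" "c i = 1" for i c
  proof -
    define L where "L = (\<Sum>q\<in>{Suc j..i}. a j q * c q)"
    \<comment> \<open>The value at \<open>j\<close> is the minimiser of
      \<open>D * x\<^sup>2 + 2 * x * L\<close>; the normalisation at \<open>i\<close> survives
      because \<open>i\<close> is larger than \<open>j\<close>.\<close>
    define c' where "c' = c(j := - L / D)"
    have ii: "{j..i} = insert j {Suc j..i}" using i by auto
    have eqL: "(\<Sum>q\<in>{Suc j..i}. a j q * c' q) = L" unfolding L_def c'_def by (intro sum.cong) auto
    have eqc: "(\<Sum>p\<in>{Suc j..i}. (c' p)\<^sup>2) = (\<Sum>p\<in>{Suc j..i}. (c p)\<^sup>2)"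
      unfolding c'_def by (intro sum.cong) auto
    have eqq: "qform {Suc j..i} a c' = qform {Suc j..i} a c"
      unfolding qform_def c'_def by (intro sum.cong) auto
    have "c' i = 1" using i by (auto simp: c'_def)
    then have "v i \<le> (\<Sum>p\<in>{j..i}. (c' p)\<^sup>2) + qform {j..i} a c'"
      using step.prems(3)[of i c'] i by auto
    also have "\<dots> = (L / D)\<^sup>2 + (\<Sum>p\<in>{Suc j..i}. (c p)\<^sup>2)
        + (a j j * (L / D)\<^sup>2 - 2 * (L / D) * L + qform {Suc j..i} a c)"
      unfolding ii 
      using eqL eqc eqq qform_insert[of "{Suc j..i}" j a c', OF _ _ step.prems(1)] by (simp add: c'_def)
    also have "\<dots> = (\<Sum>p\<in>{Suc j..i}. (c p)\<^sup>2) + (D * (L / D)\<^sup>2 - 2 * (L / D) * L + qform {Suc j..i} a c)"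
      by (simp add: D_def algebra_simps)
    also have "\<dots> = (\<Sum>p\<in>{Suc j..i}. (c p)\<^sup>2) + qform {Suc j..i} a' c"
      unfolding a'_def using D by (subst qform_schur) (simp add: L_def[symmetric] power2_eq_square)
    finally show ?thesis .
  qed
  have IH: "(\<integral>\<^sup>+x. ennreal (exp (- qform ?I a' x / 2)) \<partial>PiM ?I (\<lambda>_. std_normal_distribution))
    \<le> ennreal (\<Prod>i\<in>?I. 1 / sqrt (v i))"
    by (rule step.IH) (use sym' lb' step.prems(2) in auto)
  have upd: "qform (insert j ?I) a (x(j := y)) = a j j * y\<^sup>2 + 2 * y * (\<Sum>q\<in>?I. a j q * x q) + qform ?I a x" for x y
  proof -
    have 1: "(\<Sum>q\<in>?I. a j q * (x(j := y)) q) = (\<Sum>q\<in>?I. a j q * x q)"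
      by (intro sum.cong) auto
    have 2: "qform ?I a (x(j := y)) = qform ?I a x"
      unfolding qform_def by (intro sum.cong) auto
    show ?thesis using qform_insert[of ?I j a "x(j := y)", OF _ _ step.prems(1)] 1 2 by simp
  qed
  have meas: "(\<lambda>x. ennreal (exp (- qform {j..<k} a x / 2))) \<in> borel_measurable (PiM (insert j ?I) (\<lambda>_. std_normal_distribution))"
    unfolding ins by measurable
  have "(\<integral>\<^sup>+x. ennreal (exp (- qform {j..<k} a x / 2)) \<partial>PiM {j..<k} (\<lambda>_. std_normal_distribution))
     = (\<integral>\<^sup>+x. (\<integral>\<^sup>+y. ennreal (exp (- qform (insert j ?I) a (x(j := y)) / 2)) \<partial>std_normal_distribution)
           \<partial>PiM ?I (\<lambda>_. std_normal_distribution))"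
    unfolding ins using meas unfolding ins by (subst product_nn_integral_insert) auto
  also have "\<dots> = (\<integral>\<^sup>+x. ennreal (1 / sqrt D) * ennreal (exp (- qform ?I a' x / 2))
           \<partial>PiM ?I (\<lambda>_. std_normal_distribution))"
  proof (rule nn_integral_cong)
    fix x
    define L where "L = (\<Sum>q\<in>?I. a j q * x q)"
    have "(\<integral>\<^sup>+y. ennreal (exp (- qform (insert j ?I) a (x(j := y)) / 2)) \<partial>std_normal_distribution)
       = (\<integral>\<^sup>+y. ennreal (exp (- qform ?I a x / 2)) * ennreal (exp (- (a j j * y\<^sup>2 + 2 * y * L) / 2)) \<partial>std_normal_distribution)"
      by (intro nn_integral_cong)
         (simp add: upd L_def[symmetric] ennreal_mult[symmetric] exp_add[symmetric] add_divide_distrib diff_divide_distrib)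
    also have "\<dots> = ennreal (exp (- qform ?I a x / 2)) * ennreal (exp (L\<^sup>2 / (2 * D)) / sqrt D)"
      using D nn_integral_gauss_quadratic[of "a j j" L] unfolding D_def by (subst nn_integral_cmult) simp_all
    also have "\<dots> = ennreal (1 / sqrt D) * ennreal (exp (- qform ?I a x / 2 + L\<^sup>2 / (2 * D)))"
      using D by (simp add: ennreal_mult[symmetric] mult_exp_exp)
    also have "- qform ?I a x / 2 + L\<^sup>2 / (2 * D) = - qform ?I a' x / 2"
      unfolding a'_def by (subst qform_schur) (simp add: L_def[symmetric] diff_divide_distrib)
    finally show "(\<integral>\<^sup>+y. ennreal (exp (- qform (insert j ?I) a (x(j := y)) / 2)) \<partial>std_normal_distribution)
       = ennreal (1 / sqrt D) * ennreal (exp (- qform ?I a' x / 2))" .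
  qed
  also have "\<dots> = ennreal (1 / sqrt D) * (\<integral>\<^sup>+x. ennreal (exp (- qform ?I a' x / 2)) \<partial>PiM ?I (\<lambda>_. std_normal_distribution))"
    by (subst nn_integral_cmult) auto
  also have "\<dots> \<le> ennreal (1 / sqrt (v j)) * ennreal (\<Prod>i\<in>?I. 1 / sqrt (v i))"
    using IH vD vj D by (intro mult_mono) (auto intro!: ennreal_leI divide_left_mono)
  also have "\<dots> = ennreal (\<Prod>i\<in>{j..<k}. 1 / sqrt (v i))"
  proof -
    have "0 \<le> (\<Prod>i\<in>?I. 1 / sqrt (v i))"
      using step.prems(2) by (intro prod_nonneg) (auto intro!: less_imp_le)
    then show ?thesis
      unfolding ins using vj by (subst ennreal_mult[symmetric]) auto
  qed
  finally show ?case .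
qed

section \<open>The covariance of the sheet and local nondeterminism\<close>

text \<open>The covariance is the volume of the intersection of two boxes with corner 0, so the
  point t corresponds to the indicator of [0,t] in L^2. Positivity and local nondeterminism become
  L^2 statements about box indicators.\<close>

lemma has_bochner_integral_sheet_cov:
  fixes s t :: "real^'n"
  assumes "\<And>k. 0 \<le> s $ k" "\<And>k. 0 \<le> t $ k"
  shows "has_bochner_integral lborel
    (\<lambda>x. indicator (cbox 0 s) x * indicator (cbox 0 t) x) (sheet_cov s t)"
proof -
  define m where "m = (\<chi> k. min (s $ k) (t $ k))"
  have "cbox 0 s \<inter> cbox 0 t = cbox 0 m"
    by (auto simp: m_def mem_box_cart)
  then have eq: "indicator (cbox 0 s) x * indicator (cbox 0 t) x = (indicator (cbox 0 m) x :: real)" for x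
    by (metis indicator_inter_arith)
  have "0 \<in> cbox 0 m" using assms by (simp add: m_def mem_box_cart)
  then have "measure lborel (cbox 0 m) = sheet_cov s t"
    by (subst content_cbox_cart) (auto simp: m_def sheet_cov_def)
  then show ?thesis unfolding eq
    using has_bochner_integral_real_indicator[OF _ emeasure_lborel_cbox_finite, of 0 m] by simp
qed

lemma sheet_cov_psd:
  fixes t :: "'i \<Rightarrow> real^'n"
  assumes "\<And>p k. p \<in> I \<Longrightarrow> 0 \<le> t p $ k"
  shows "0 \<le> (\<Sum>p\<in>I. \<Sum>q\<in>I. sheet_cov (t p) (t q) * c p * c q)"
proof -
  define b where "b = (\<lambda>p x. indicator (cbox 0 (t p)) x :: real)"
  have "has_bochner_integral lborel (\<lambda>x. \<Sum>p\<in>I. \<Sum>q\<in>I. b p x * b q x * c p * c q)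
     (\<Sum>p\<in>I. \<Sum>q\<in>I. sheet_cov (t p) (t q) * c p * c q)"
    unfolding b_def using assms
    by (intro has_bochner_integral_sum has_bochner_integral_mult_left has_bochner_integral_sheet_cov) auto
  moreover have "(\<Sum>p\<in>I. \<Sum>q\<in>I. b p x * b q x * c p * c q) = (\<Sum>p\<in>I. c p * b p x)\<^sup>2" for x
    by (simp add: power2_eq_square sum_product ac_simps)
  ultimately have "(\<Sum>p\<in>I. \<Sum>q\<in>I. sheet_cov (t p) (t q) * c p * c q) = (\<integral>x. (\<Sum>p\<in>I. c p * b p x)\<^sup>2 \<partial>lborel)"
    by (simp add: has_bochner_integral_iff)
  then show ?thesis by simp
qed

lemma sheet_cov_replace:
  fixes s t :: "real^'n"
  shows "sheet_cov s (\<chi> l. if l = j then a else t $ l) = min (s $ j) a * (\<Prod>l\<in>UNIV - {j}. min (s $ l) (t $ l))"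
  unfolding sheet_cov_def by (subst prod.remove[of UNIV j]) (auto intro!: prod.cong)

text \<open>The indicator combination f of the boxes is tested against the second difference g of indicators in
  direction j, to which all boxes except the i-th are orthogonal.\<close>
lemma sheet_cov_local_nondeterminism:
  fixes t :: "'i \<Rightarrow> real^'n"
  assumes fin: "finite I" and i: "i \<in> I" "c i = 1"
    and nonneg: "\<And>p k. p \<in> I \<Longrightarrow> 0 \<le> t p $ k"
    and r: "0 \<le> r" "r \<le> t i $ j" "\<And>p. p \<in> I \<Longrightarrow> p \<noteq> i \<Longrightarrow> r \<le> \<bar>t i $ j - t p $ j\<bar>"
  shows "r * (\<Prod>l\<in>UNIV - {j}. t i $ l) / 2 \<le> (\<Sum>p\<in>I. \<Sum>q\<in>I. sheet_cov (t p) (t q) * c p * c q)"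
proof -
  define Q where "Q = (\<Sum>p\<in>I. \<Sum>q\<in>I. sheet_cov (t p) (t q) * c p * c q)"
  define L where "L = r * (\<Prod>l\<in>UNIV - {j}. t i $ l)"
  define u where "u = (\<lambda>a. \<chi> l. if l = j then a else t i $ l)"
  define b where "b = (\<lambda>(s::real^'n) x. indicator (cbox 0 s) x :: real)"
  define f where "f = (\<lambda>x. \<Sum>p\<in>I. c p * b (t p) x)"
  define g where "g = (\<lambda>x. 2 * b (t i) x - b (u (t i $ j - r)) x - b (u (t i $ j + r)) x)"
  have ti: "t i = u (t i $ j)" by (simp add: u_def vec_eq_iff)
  have unn: "0 \<le> u a $ k" if "0 \<le> a" for a k using that nonneg[OF i(1)] by (simp add: u_def)
  have cov: "sheet_cov s (u a) = min (s $ j) a * (\<Prod>l\<in>UNIV - {j}. min (s $ l) (t i $ l))" for s a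
    unfolding u_def by (rule sheet_cov_replace)
  define D where "D = (\<lambda>s. 2 * sheet_cov s (t i) - sheet_cov s (u (t i $ j - r)) - sheet_cov s (u (t i $ j + r)))"
  have Dint: "has_bochner_integral lborel (\<lambda>x. b s x * g x) (D s)" if "\<And>k. 0 \<le> s $ k" for s
  proof -
    have "has_bochner_integral lborel (\<lambda>x. 2 * (b s x * b (t i) x) - b s x * b (u (t i $ j - r)) x - b s x * b (u (t i $ j + r)) x) (D s)"
      unfolding b_def D_def using that unn r nonneg[OF i(1)]
      by (intro has_bochner_integral_diff has_bochner_integral_mult_right has_bochner_integral_sheet_cov) auto
    then show ?thesis by (simp add: g_def algebra_simps)
  qed
  have Deq: "D s = (2 * min (s $ j) (t i $ j) - min (s $ j) (t i $ j - r) - min (s $ j) (t i $ j + r))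
      * (\<Prod>l\<in>UNIV - {j}. min (s $ l) (t i $ l))" for s
    unfolding D_def by (subst ti) (simp only: cov left_diff_distrib mult.assoc)
  have D0: "D s = 0" if "r \<le> \<bar>t i $ j - s $ j\<bar>" for s
  proof -
    have "2 * min (s $ j) (t i $ j) - min (s $ j) (t i $ j - r) - min (s $ j) (t i $ j + r) = 0"
      using that r(1) by (auto simp: min_def abs_if split: if_splits)
    then show ?thesis by (simp add: Deq)
  qed
  have Di: "D (t i) = L" using r by (simp add: Deq L_def min_def)
  \<comment> \<open>In direction \<open>j\<close> the two outer boxes end at distance exactly
    \<open>r\<close> from \<open>t i\<close>, so \<open>D0\<close> just applies to them. This is why
    the squared norm of \<open>g\<close> is only \<open>2 * L\<close>.\<close>
  have Dl: "D (u (t i $ j - r)) = 0" "D (u (t i $ j + r)) = 0"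
    using r by (auto intro!: D0 simp: u_def)
  have ff: "has_bochner_integral lborel (\<lambda>x. (f x)\<^sup>2) Q"
  proof -
    have "has_bochner_integral lborel (\<lambda>x. \<Sum>p\<in>I. \<Sum>q\<in>I. b (t p) x * b (t q) x * c p * c q) Q"
      unfolding b_def Q_def using nonneg
      by (intro has_bochner_integral_sum has_bochner_integral_mult_left has_bochner_integral_sheet_cov) auto
    moreover have "(\<Sum>p\<in>I. \<Sum>q\<in>I. b (t p) x * b (t q) x * c p * c q) = (f x)\<^sup>2" for x
      by (simp add: f_def power2_eq_square sum_product ac_simps)
    ultimately show ?thesis by simp
  qed
  have fg: "has_bochner_integral lborel (\<lambda>x. f x * g x) L"
  proof -
    have "has_bochner_integral lborel (\<lambda>x. \<Sum>p\<in>I. c p * (b (t p) x * g x)) (\<Sum>p\<in>I. c p * D (t p))"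
      using nonneg by (intro has_bochner_integral_sum has_bochner_integral_mult_right Dint) auto
    moreover have "(\<Sum>p\<in>I. c p * (b (t p) x * g x)) = f x * g x" for x
      by (simp add: f_def sum_distrib_left ac_simps)
    moreover have "(\<Sum>p\<in>I. c p * D (t p)) = (\<Sum>p\<in>I. if p = i then L else 0)"
      using i Di D0 r by (intro sum.cong) auto
    ultimately show ?thesis using fin i by simp
  qed
  have gg: "has_bochner_integral lborel (\<lambda>x. (g x)\<^sup>2) (2 * L)"
  proof -
    have "has_bochner_integral lborel
       (\<lambda>x. 2 * (b (t i) x * g x) - b (u (t i $ j - r)) x * g x - b (u (t i $ j + r)) x * g x)
       (2 * D (t i) - D (u (t i $ j - r)) - D (u (t i $ j + r)))"
      using nonneg[OF i(1)] r unn
      by (intro has_bochner_integral_diff has_bochner_integral_mult_right Dint) auto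
    moreover have "2 * (b (t i) x * g x) - b (u (t i $ j - r)) x * g x - b (u (t i $ j + r)) x * g x = (g x)\<^sup>2" for x
      by (simp add: g_def power2_eq_square algebra_simps)
    ultimately show ?thesis by (simp add: Di Dl)
  qed
  \<comment> \<open>Cauchy-Schwarz written as a square: the scalar product of \<open>f\<close> and
    \<open>g\<close> is \<open>L\<close> and the squared norm of \<open>g\<close> is
    \<open>2 * L\<close>, so the best multiple of \<open>g\<close> to subtract from \<open>f\<close>
    is \<open>g / 2\<close>, and \<open>L / 2\<close> remains as a lower bound for
    \<open>Q\<close>.\<close>
  have "has_bochner_integral lborel (\<lambda>x. (f x)\<^sup>2 - f x * g x + (g x)\<^sup>2 * (1 / 4)) (Q - L + 2 * L * (1 / 4))"
    by (intro has_bochner_integral_add has_bochner_integral_diff has_bochner_integral_mult_left ff fg gg)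
  moreover have "(f x)\<^sup>2 - f x * g x + (g x)\<^sup>2 * (1 / 4) = (f x - g x / 2)\<^sup>2" for x
    by (simp add: power2_eq_square field_simps)
  ultimately have "Q - L + 2 * L * (1 / 4) = (\<integral>x. (f x - g x / 2)\<^sup>2 \<partial>lborel)"
    by (simp add: has_bochner_integral_iff)
  moreover have "0 \<le> (\<integral>x. (f x - g x / 2)\<^sup>2 \<partial>lborel)" by simp
  ultimately show ?thesis unfolding Q_def[symmetric] L_def[symmetric] by linarith
qed

section \<open>Exponential moments of Gaussian vectors through characteristic functions\<close>

lemma (in prob_space) centered_normal_iexp:
  assumes X: "centered_normal M X v" and v: "0 \<le> v"
  shows "(CLINT \<omega>|M. iexp (X \<omega>)) = complex_of_real (exp (- v / 2))"
proof (cases "v = 0")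
  case True
  then have "AE \<omega> in M. X \<omega> = 0" and [measurable]: "X \<in> borel_measurable M"
    using X by (auto simp: centered_normal_def)
  then have "(CLINT \<omega>|M. iexp (X \<omega>)) = (CLINT \<omega>|M. 1)"
    by (intro integral_cong_AE) auto
  then show ?thesis using True by (simp add: prob_space)
next
  case False
  with v have v0: "0 < v" by simp
  then have "distributed M lborel X (normal_density 0 (sqrt v))" and Xm[measurable]: "X \<in> borel_measurable M"
    using X by (auto simp: centered_normal_def)
  then have "distributed M lborel (\<lambda>\<omega>. (X \<omega> - 0) / sqrt v) std_normal_density"
    using v0 by (subst normal_standard_normal_convert[symmetric]) auto
  then have d: "distr M lborel (\<lambda>\<omega>. X \<omega> / sqrt v) = std_normal_distribution"
    by (simp add: distributed_distr_eq_density)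
  have "complex_of_real (exp (- v / 2)) = char std_normal_distribution (sqrt v)"
    using v0 by (simp add: char_std_normal_distribution)
  also have "\<dots> = (CLINT \<omega>|M. iexp (sqrt v * (X \<omega> / sqrt v)))"
    unfolding char_def d[symmetric] by (subst integral_distr) auto
  also have "\<dots> = (CLINT \<omega>|M. iexp (X \<omega>))" using v0 by simp
  finally show ?thesis ..
qed

text \<open>exp (- x^2 / 2) is the characteristic function of a standard normal variable. Writing
  every factor as such an integral and exchanging the two integrations leaves characteristic
  functions of linear combinations of the \<open>X i\<close>, which \<open>centered_normal\<close>
  supplies even in degenerate cases. The covariance matrix is never inverted.\<close>

lemma (in prob_space) expectation_exp_gaussian:
  fixes X :: "nat \<Rightarrow> 'a \<Rightarrow> real" and r :: "nat \<Rightarrow> nat \<Rightarrow> real"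
  assumes X: "\<And>c. centered_normal M (\<lambda>\<omega>. \<Sum>i<k. c i * X i \<omega>) (qform {..<k} r c)"
    and meas: "\<And>i. i < k \<Longrightarrow> X i \<in> borel_measurable M"
    and psd: "\<And>c. 0 \<le> qform {..<k} r c"
  shows "expectation (\<lambda>\<omega>. \<Prod>i<k. exp (- (X i \<omega>)\<^sup>2 / 2))
    = (\<integral>x. exp (- qform {..<k} r x / 2) \<partial>PiM {..<k} (\<lambda>_. std_normal_distribution))"
proof -
  let ?P = "PiM {..<k} (\<lambda>_. std_normal_distribution)"
  interpret S: real_distribution std_normal_distribution by (rule real_dist_normal_dist)
  interpret product_sigma_finite "\<lambda>_::nat. std_normal_distribution"
    by (rule product_sigma_finite_gauss)
  interpret P: prob_space ?P
    by (intro prob_space_PiM) (simp add: prob_space_normal_density)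
  interpret MP: pair_prob_space M ?P ..
  have comp: "(\<lambda>x. x p) \<in> borel_measurable ?P" if "p < k" for p
  proof -
    have "(\<lambda>x. x p) \<in> measurable ?P std_normal_distribution"
      using that by (intro measurable_component_singleton) auto
    also have "\<dots> = borel_measurable ?P" by (intro measurable_cong_sets) auto
    finally show ?thesis .
  qed
  have jm: "(\<lambda>z. \<Sum>i<k. X i (fst z) * snd z i) \<in> borel_measurable (M \<Otimes>\<^sub>M ?P)"
    using meas comp by (intro borel_measurable_sum borel_measurable_times)
      (auto intro: measurable_compose[OF measurable_fst] measurable_compose[OF measurable_snd])
  have int: "integrable (M \<Otimes>\<^sub>M ?P) (\<lambda>(\<omega>, x). iexp (\<Sum>i<k. X i \<omega> * x i))"
    using jm by (intro MP.integrable_const_bound[where B = 1]) (auto simp: split_beta' simp del: of_real_sum of_real_mult)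
  have 1: "complex_of_real (\<Prod>i<k. exp (- (X i \<omega>)\<^sup>2 / 2)) = (CLINT x|?P. iexp (\<Sum>i<k. X i \<omega> * x i))" for \<omega>
  proof -
    have "complex_of_real (\<Prod>i<k. exp (- (X i \<omega>)\<^sup>2 / 2)) = (\<Prod>i<k. CLINT x|std_normal_distribution. iexp (X i \<omega> * x))"
      unfolding of_real_prod
    proof (intro prod.cong refl)
      fix i
      show "complex_of_real (exp (- (X i \<omega>)\<^sup>2 / 2)) = (CLINT x|std_normal_distribution. iexp (X i \<omega> * x))"
        using fun_cong[OF char_std_normal_distribution, of "X i \<omega>"] unfolding char_def by simp
    qed
    also have "\<dots> = (CLINT x|?P. (\<Prod>i<k. iexp (X i \<omega> * x i)))"
      by (intro product_integral_prod[symmetric] S.integrable_const_bound[where B = 1]) auto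
    also have "(\<lambda>x. \<Prod>i<k. iexp (X i \<omega> * x i)) = (\<lambda>x. iexp (\<Sum>i<k. X i \<omega> * x i))"
      by (simp add: exp_sum[symmetric] sum_distrib_left)
    finally show ?thesis .
  qed
  have "complex_of_real (expectation (\<lambda>\<omega>. \<Prod>i<k. exp (- (X i \<omega>)\<^sup>2 / 2)))
     = (CLINT \<omega>|M. CLINT x|?P. iexp (\<Sum>i<k. X i \<omega> * x i))"
    unfolding integral_complex_of_real[symmetric] 1 ..
  also have "\<dots> = (CLINT x|?P. CLINT \<omega>|M. iexp (\<Sum>i<k. X i \<omega> * x i))"
    using MP.Fubini_integral[OF int] by simp
  also have "\<dots> = (CLINT x|?P. complex_of_real (exp (- qform {..<k} r x / 2)))"
    using centered_normal_iexp[OF X psd] by (intro Bochner_Integration.integral_cong) (auto simp: mult.commute)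
  also have "\<dots> = complex_of_real (\<integral>x. exp (- qform {..<k} r x / 2) \<partial>?P)"
    by (rule integral_complex_of_real)
  finally show ?thesis by (simp only: of_real_eq_iff)
qed

text \<open>The expectation is det (1 + r)^(-1/2), and the determinant is a product of successive
  pivots. Pivot i is the conditional variance of \<open>X i\<close> plus independent standard normal
  noise, given the earlier noisy variables; equivalently, it is the minimum of the form in
  \<open>lb\<close> over all c with \<open>c i = 1\<close>. Lower bounds \<open>v\<close> for the
  pivots therefore give the estimate.\<close>

lemma (in prob_space) expectation_exp_gaussian_le:
  fixes X :: "nat \<Rightarrow> 'a \<Rightarrow> real" and r :: "nat \<Rightarrow> nat \<Rightarrow> real"
  assumes X: "\<And>c. centered_normal M (\<lambda>\<omega>. \<Sum>i<k. c i * X i \<omega>) (qform {..<k} r c)"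
    and meas: "\<And>i. i < k \<Longrightarrow> X i \<in> borel_measurable M"
    and psd: "\<And>c. 0 \<le> qform {..<k} r c"
    and sym: "\<And>p q. r p q = r q p"
    and v: "\<And>i. i < k \<Longrightarrow> 0 < v i"
    and lb: "\<And>i c. i < k \<Longrightarrow> c i = 1 \<Longrightarrow> v i \<le> (\<Sum>p\<le>i. (c p)\<^sup>2) + qform {..i} r c"
  shows "expectation (\<lambda>\<omega>. \<Prod>i<k. exp (- (X i \<omega>)\<^sup>2 / 2)) \<le> (\<Prod>i<k. 1 / sqrt (v i))"
proof -
  let ?P = "PiM {..<k} (\<lambda>_. std_normal_distribution)"
  interpret P: prob_space ?P
    by (intro prob_space_PiM) (simp add: prob_space_normal_density)
  have "integrable ?P (\<lambda>x. exp (- qform {..<k} r x / 2))"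
    using psd by (intro P.integrable_const_bound[where B = 1]) auto
  then have "ennreal (\<integral>x. exp (- qform {..<k} r x / 2) \<partial>?P) = (\<integral>\<^sup>+x. exp (- qform {..<k} r x / 2) \<partial>?P)"
    by (intro nn_integral_eq_integral[symmetric]) auto
  also have "\<dots> \<le> ennreal (\<Prod>i<k. 1 / sqrt (v i))"
    using nn_integral_gauss_qform_le[of 0 k r v, OF _ sym] v lb
    by (simp add: atLeast0LessThan atLeast0AtMost)
  finally have "(\<integral>x. exp (- qform {..<k} r x / 2) \<partial>?P) \<le> (\<Prod>i<k. 1 / sqrt (v i))"
    by (subst (asm) ennreal_le_iff) (auto intro!: prod_pos less_imp_le v)
  moreover have "expectation (\<lambda>\<omega>. \<Prod>i<k. exp (- (X i \<omega>)\<^sup>2 / 2)) = (\<integral>x. exp (- qform {..<k} r x / 2) \<partial>?P)"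
    by (rule expectation_exp_gaussian[OF X meas psd])
  ultimately show ?thesis by simp
qed

section \<open>Joint small-value estimates\<close>

locale brownian = prob_space M for M :: "'w measure" +
  fixes W :: "'w \<Rightarrow> real^'n \<Rightarrow> real^'d"
  assumes sheet: "brownian_sheet M W"
begin

text \<open>A smooth stand-in for the indicator that W t has norm at most \<theta>^(-1/2). It
  factors over the independent coordinates of W, and being positive it can be normalised by its
  mean.\<close>

definition bump :: "real \<Rightarrow> real^'n \<Rightarrow> 'w \<Rightarrow> real" where
  "bump \<theta> t \<omega> = exp (- (\<theta> * (norm (W \<omega> t))\<^sup>2) / 2)"

lemma measurable_coord: "t \<in> pos_orthant \<Longrightarrow> (\<lambda>\<omega>. W \<omega> t $ j) \<in> borel_measurable M"
  using sheet by (auto simp: brownian_sheet_def)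

lemma measurable_W: "t \<in> pos_orthant \<Longrightarrow> (\<lambda>\<omega>. W \<omega> t) \<in> borel_measurable M"
  unfolding borel_measurable_euclidean_space[of "\<lambda>\<omega>. W \<omega> t"]
  using measurable_coord by (auto simp: Basis_vec_def cart_eq_inner_axis[symmetric])

lemma measurable_bump: "t \<in> pos_orthant \<Longrightarrow> bump \<theta> t \<in> borel_measurable M"
  unfolding bump_def[abs_def] using measurable_W[of t] by measurable

lemma bump_pos: "0 < bump \<theta> t \<omega>"
  by (simp add: bump_def)

lemma bump_le_1: "0 \<le> \<theta> \<Longrightarrow> bump \<theta> t \<omega> \<le> 1"
  by (simp add: bump_def)

lemma sheet_cov_bounds:
  assumes "t \<in> pos_orthant"
  shows "sheet_cov t t = (\<Prod>k\<in>UNIV. t $ k)" "0 < sheet_cov t t"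
  using assms by (auto simp: sheet_cov_def pos_orthant_def intro!: prod_pos)

lemma qform_cov_nonneg:
  fixes t :: "nat \<Rightarrow> real^'n"
  assumes "\<And>i. i < k \<Longrightarrow> t i \<in> pos_orthant" "0 \<le> \<theta>"
  shows "0 \<le> qform {..<k} (\<lambda>p q. \<theta> * sheet_cov (t p) (t q)) c"
proof -
  have "0 \<le> (\<Sum>p<k. \<Sum>q<k. sheet_cov (t p) (t q) * c p * c q)"
    using assms(1) by (intro sheet_cov_psd) (auto simp: pos_orthant_def less_imp_le)
  moreover have "qform {..<k} (\<lambda>p q. \<theta> * sheet_cov (t p) (t q)) c = \<theta> * (\<Sum>p<k. \<Sum>q<k. sheet_cov (t p) (t q) * c p * c q)"
    by (simp add: qform_def sum_distrib_left mult.assoc)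
  ultimately show ?thesis using assms(2) by simp
qed

lemma centered_normal_scaled:
  fixes t :: "nat \<Rightarrow> real^'n"
  assumes "\<And>i. i < k \<Longrightarrow> t i \<in> pos_orthant" "0 \<le> \<theta>"
  shows "centered_normal M (\<lambda>\<omega>. \<Sum>i<k. c i * (sqrt \<theta> * W \<omega> (t i) $ j))
    (qform {..<k} (\<lambda>p q. \<theta> * sheet_cov (t p) (t q)) c)"
proof -
  have "centered_normal M (\<lambda>\<omega>. \<Sum>i<k. (c i * sqrt \<theta>) * (W \<omega> (t i) $ j))
      (\<Sum>i<k. \<Sum>l<k. (c i * sqrt \<theta>) * (c l * sqrt \<theta>) * sheet_cov (t i) (t l))"
  proof -
    have N: "\<forall>j. \<forall>(k::nat) (t::nat \<Rightarrow> real^'n) (c::nat \<Rightarrow> real).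
        (\<forall>i<k. t i \<in> pos_orthant) \<longrightarrow>
        centered_normal M (\<lambda>\<omega>. \<Sum>i<k. c i * (W \<omega> (t i) $ j))
          (\<Sum>i<k. \<Sum>l<k. c i * c l * sheet_cov (t i) (t l))"
      using sheet by (simp add: brownian_sheet_def)
    show ?thesis
      by (rule N[THEN spec[of _ j], THEN spec[of _ k], THEN spec[of _ t], THEN spec[of _ "\<lambda>i. c i * sqrt \<theta>"], THEN mp])
        (use assms(1) in simp)
  qed
  moreover have "(c i * sqrt \<theta>) * (c l * sqrt \<theta>) * s = \<theta> * s * c i * c l" for i l s
  proof -
    have "(c i * sqrt \<theta>) * (c l * sqrt \<theta>) * s = (sqrt \<theta> * sqrt \<theta>) * s * c i * c l"
      by (simp only: ac_simps)
    then show ?thesis using assms(2) by simp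
  qed
  moreover have "(\<lambda>\<omega>. \<Sum>i<k. (c i * sqrt \<theta>) * (W \<omega> (t i) $ j)) = (\<lambda>\<omega>. \<Sum>i<k. c i * (sqrt \<theta> * W \<omega> (t i) $ j))"
    by (simp only: mult.assoc)
  ultimately show ?thesis by (simp only: qform_def)
qed

lemma bump_prod_factor:
  fixes t :: "nat \<Rightarrow> real^'n"
  assumes "0 \<le> \<theta>"
  shows "(\<Prod>i<k. bump \<theta> (t i) \<omega>) = (\<Prod>j\<in>UNIV. \<Prod>i<k. exp (- (sqrt \<theta> * W \<omega> (t i) $ j)\<^sup>2 / 2))"
proof -
  have "bump \<theta> s \<omega> = (\<Prod>j\<in>UNIV. exp (- (sqrt \<theta> * W \<omega> s $ j)\<^sup>2 / 2))" for s
    unfolding bump_def using assms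
    by (simp add: exp_sum[symmetric] norm_vec_def L2_set_def sum_nonneg power_mult_distrib
        sum_negf sum_distrib_left[symmetric] sum_divide_distrib[symmetric])
  then show ?thesis by (simp add: prod.swap[of _ _ UNIV])
qed

lemma expectation_bump_factor:
  fixes t :: "nat \<Rightarrow> real^'n"
  assumes t: "\<And>i. i < k \<Longrightarrow> t i \<in> pos_orthant" and th: "0 \<le> \<theta>"
  shows "expectation (\<lambda>\<omega>. \<Prod>i<k. bump \<theta> (t i) \<omega>)
    = (\<Prod>j\<in>UNIV. expectation (\<lambda>\<omega>. \<Prod>i<k. exp (- (sqrt \<theta> * W \<omega> (t i) $ j)\<^sup>2 / 2)))"
proof -
  let ?F = "\<lambda>f. \<Prod>i<k. exp (- (sqrt \<theta> * f (t i))\<^sup>2 / 2) :: real"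
  have ind: "indep_vars (\<lambda>_. PiM pos_orthant (\<lambda>_. borel))
        (\<lambda>j \<omega>. restrict (\<lambda>t. W \<omega> t $ j) pos_orthant) UNIV"
    using sheet by (simp add: brownian_sheet_def)
  \<comment> \<open>Independence is stated for whole restricted paths, so the product of
    exponentials has to be read as a functional on the path space that evaluates finitely many
    points of \<open>pos_orthant\<close>.\<close>
  have Fm: "?F \<in> measurable (PiM pos_orthant (\<lambda>_. borel)) borel"
  proof -
    have "(\<lambda>f. f (t i)) \<in> borel_measurable (PiM pos_orthant (\<lambda>_. borel :: real measure))" if "i < k" for i
      using t[OF that] by (rule measurable_component_singleton)
    then show ?thesis by measurable
  qed
  have "indep_vars (\<lambda>_. borel) (\<lambda>j \<omega>. ?F (restrict (\<lambda>t. W \<omega> t $ j) pos_orthant)) UNIV"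
    using indep_vars_compose2[OF ind, of "\<lambda>_. ?F" "\<lambda>_. borel"] Fm by simp
  moreover have "?F (restrict (\<lambda>t. W \<omega> t $ j) pos_orthant) = (\<Prod>i<k. exp (- (sqrt \<theta> * W \<omega> (t i) $ j)\<^sup>2 / 2))" for \<omega> j
    using t by (intro prod.cong) auto
  ultimately have ind': "indep_vars (\<lambda>_. borel) (\<lambda>j \<omega>. \<Prod>i<k. exp (- (sqrt \<theta> * W \<omega> (t i) $ j)\<^sup>2 / 2)) UNIV"
    by simp
  have m: "(\<lambda>\<omega>. \<Prod>i<k. exp (- (sqrt \<theta> * W \<omega> (t i) $ j)\<^sup>2 / 2)) \<in> borel_measurable M" for j
    using t measurable_coord by (intro borel_measurable_prod) (auto intro!: borel_measurable_divide borel_measurable_exp[THEN measurable_compose[rotated]])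
  have "integrable M (\<lambda>\<omega>. \<Prod>i<k. exp (- (sqrt \<theta> * W \<omega> (t i) $ j)\<^sup>2 / 2))" for j
    using m by (intro integrable_const_bound[where B = 1]) (auto simp: abs_prod intro!: prod_le_1)
  then show ?thesis
    unfolding bump_prod_factor[OF th] by (intro indep_vars_lebesgue_integral ind') auto
qed

text \<open>Each coordinate of W contributes the same determinant bound, so the power -1/2 of
  \<open>v i\<close> is raised to the power d.\<close>

lemma expectation_bump_prod_le:
  fixes t :: "nat \<Rightarrow> real^'n"
  assumes t: "\<And>i. i < k \<Longrightarrow> t i \<in> pos_orthant" and th: "0 \<le> \<theta>"
    and v: "\<And>i. i < k \<Longrightarrow> 0 < v i"
    and lb: "\<And>i c. i < k \<Longrightarrow> c i = 1 \<Longrightarrow>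
      v i \<le> (\<Sum>p\<le>i. (c p)\<^sup>2) + \<theta> * (\<Sum>p\<le>i. \<Sum>q\<le>i. sheet_cov (t p) (t q) * c p * c q)"
  shows "expectation (\<lambda>\<omega>. \<Prod>i<k. bump \<theta> (t i) \<omega>) \<le> (\<Prod>i<k. v i powr (- real CARD('d) / 2))"
proof -
  have one: "expectation (\<lambda>\<omega>. \<Prod>i<k. exp (- (sqrt \<theta> * W \<omega> (t i) $ j)\<^sup>2 / 2)) \<le> (\<Prod>i<k. 1 / sqrt (v i))" for j
  proof (rule expectation_exp_gaussian_le[where r = "\<lambda>p q. \<theta> * sheet_cov (t p) (t q)"])
    show "centered_normal M (\<lambda>\<omega>. \<Sum>i<k. c i * (sqrt \<theta> * W \<omega> (t i) $ j))
      (qform {..<k} (\<lambda>p q. \<theta> * sheet_cov (t p) (t q)) c)" for c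
      using t th by (rule centered_normal_scaled)
    show "0 \<le> qform {..<k} (\<lambda>p q. \<theta> * sheet_cov (t p) (t q)) c" for c
      using t th by (rule qform_cov_nonneg)
    show "v i \<le> (\<Sum>p\<le>i. (c p)\<^sup>2) + qform {..i} (\<lambda>p q. \<theta> * sheet_cov (t p) (t q)) c" if "i < k" "c i = 1" for i c
      using lb[of i c] that by (simp add: qform_def sum_distrib_left mult.assoc)
    show "(\<lambda>\<omega>. sqrt \<theta> * W \<omega> (t i) $ j) \<in> borel_measurable M" if "i < k" for i
      using measurable_coord[OF t[OF that]] by measurable
  qed (use v in \<open>auto simp: sheet_cov_def min.commute\<close>)
  have "expectation (\<lambda>\<omega>. \<Prod>i<k. bump \<theta> (t i) \<omega>) \<le> (\<Prod>j\<in>(UNIV::'d set). \<Prod>i<k. 1 / sqrt (v i))"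
    by (subst expectation_bump_factor[of k t \<theta>, OF t th]) (assumption, intro prod_mono conjI one Bochner_Integration.integral_nonneg prod_nonneg, simp)
  also have "\<dots> = (\<Prod>i<k. (1 / sqrt (v i)) ^ CARD('d))"
    by (simp add: prod_power_distrib)
  also have "\<dots> = (\<Prod>i<k. v i powr (- real CARD('d) / 2))"
  proof (intro prod.cong refl)
    fix i assume "i \<in> {..<k}"
    then have vi: "0 < v i" using v by simp
    have "(1 / sqrt (v i)) ^ CARD('d) = (v i powr (- 1 / 2)) powr real CARD('d)"
      using vi by (simp add: powr_realpow powr_half_sqrt[symmetric] powr_minus_divide)
    then show "(1 / sqrt (v i)) ^ CARD('d) = v i powr (- real CARD('d) / 2)"
      by (simp add: powr_powr)
  qed
  finally show ?thesis .
qed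

text \<open>Equality matters here: the pair estimate compares a joint expectation with the product
  of the two means, and the means then stand on the larger side.\<close>

lemma expectation_bump:
  assumes t: "t \<in> pos_orthant" and th: "0 \<le> \<theta>"
  shows "expectation (bump \<theta> t) = (1 + \<theta> * sheet_cov t t) powr (- real CARD('d) / 2)"
proof -
  interpret S: product_sigma_finite "\<lambda>_::nat. std_normal_distribution"
    by (rule product_sigma_finite_gauss)
  define a where "a = \<theta> * sheet_cov t t"
  have a: "0 \<le> a" using sheet_cov_bounds[OF t] th by (simp add: a_def)
  have one: "expectation (\<lambda>\<omega>. exp (- (sqrt \<theta> * W \<omega> t $ j)\<^sup>2 / 2)) = 1 / sqrt (1 + a)" for j
  proof -
    have "expectation (\<lambda>\<omega>. \<Prod>i<1::nat. exp (- (sqrt \<theta> * W \<omega> t $ j)\<^sup>2 / 2))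
       = (\<integral>x. exp (- qform {..<1} (\<lambda>p q. a) x / 2) \<partial>PiM {..<1} (\<lambda>_. std_normal_distribution))"
      unfolding a_def
    proof (rule expectation_exp_gaussian[where X = "\<lambda>_ \<omega>. sqrt \<theta> * W \<omega> t $ j"])
      show "(\<lambda>\<omega>. sqrt \<theta> * W \<omega> t $ j) \<in> borel_measurable M"
        using measurable_coord[OF t, of j] by measurable
    qed (use centered_normal_scaled[of 1 "\<lambda>_. t" \<theta> _ j] qform_cov_nonneg[of 1 "\<lambda>_. t" \<theta>] t th in auto)
    also have "{..<1} = {0::nat}" by auto
    also have "(\<integral>x. exp (- qform {0} (\<lambda>p q. a) x / 2) \<partial>PiM {0} (\<lambda>_. std_normal_distribution))
       = (\<integral>x. exp (- (a * x\<^sup>2) / 2) \<partial>std_normal_distribution)"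
      unfolding qform_def
      by (subst S.product_integral_singleton[symmetric]) (auto simp: power2_eq_square mult.assoc)
    also have "\<dots> = 1 / sqrt (1 + a)"
    proof (rule integral_eq_nn_integral[THEN trans])
      show "enn2real (\<integral>\<^sup>+x. ennreal (exp (- (a * x\<^sup>2) / 2)) \<partial>std_normal_distribution) = 1 / sqrt (1 + a)"
        using nn_integral_gauss_quadratic[of a 0] a by simp
    qed auto
    finally show ?thesis by simp
  qed
  have "expectation (\<lambda>\<omega>. \<Prod>i<1. bump \<theta> ((\<lambda>_. t) (i::nat)) \<omega>) = (\<Prod>j\<in>(UNIV::'d set). 1 / sqrt (1 + a))"
    using t th by (subst expectation_bump_factor) (simp_all add: one[simplified])
  then have "expectation (bump \<theta> t) = (1 / sqrt (1 + a)) ^ CARD('d)" by simp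
  also have "\<dots> = ((1 + a) powr (- 1 / 2)) powr real CARD('d)"
    using a by (simp add: powr_realpow powr_half_sqrt[symmetric] powr_minus_divide)
  finally show ?thesis by (simp add: powr_powr a_def)
qed

text \<open>Here \<open>\<rho>\<close> bounds the squared correlation. After adding unit noise the
  pivots are \<open>A\<close> and \<open>T - B\<^sup>2 / A\<close>. Noise enlarges the variances but
  not the covariance, so \<open>B\<^sup>2 \<le> \<rho> * (A * T)\<close> persists and the second
  pivot is at least \<open>(1 - \<rho>) * T\<close>. The resulting factor does not deteriorate as
  \<open>\<theta>\<close> grows.\<close>

lemma expectation_bump_pair_le:
  assumes s: "s \<in> pos_orthant" and t: "t \<in> pos_orthant" and th: "0 \<le> \<theta>"
    and rho: "(sheet_cov s t)\<^sup>2 \<le> \<rho> * (sheet_cov s s * sheet_cov t t)" "0 \<le> \<rho>" "\<rho> < 1"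
  shows "expectation (\<lambda>\<omega>. bump \<theta> s \<omega> * bump \<theta> t \<omega>)
    \<le> (1 - \<rho>) powr (- real CARD('d) / 2) * (expectation (bump \<theta> s) * expectation (bump \<theta> t))"
proof -
  define A B T where "A = 1 + \<theta> * sheet_cov s s" and "B = \<theta> * sheet_cov s t" and "T = 1 + \<theta> * sheet_cov t t"
  have A: "0 < A" and T: "0 < T"
    using sheet_cov_bounds[OF s] sheet_cov_bounds[OF t] th by (auto simp: A_def T_def add_pos_nonneg)
  define v where "v = (\<lambda>i::nat. if i = 0 then A else (1 - \<rho>) * T)"
  define u where "u = (\<lambda>i::nat. if i = 0 then s else t)"
  have "B\<^sup>2 \<le> \<theta>\<^sup>2 * (\<rho> * (sheet_cov s s * sheet_cov t t))"
    unfolding B_def power_mult_distrib using rho(1) by (intro mult_left_mono) auto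
  also have "\<dots> = \<rho> * ((\<theta> * sheet_cov s s) * (\<theta> * sheet_cov t t))" by (simp add: power2_eq_square ac_simps)
  also have "\<dots> \<le> \<rho> * (A * T)"
    using rho(2) sheet_cov_bounds[OF s] sheet_cov_bounds[OF t] th
    by (intro mult_left_mono mult_mono) (auto simp: A_def T_def)
  finally have BB: "B\<^sup>2 \<le> \<rho> * (A * T)" .
  have "expectation (\<lambda>\<omega>. \<Prod>i<2. bump \<theta> (u i) \<omega>) \<le> (\<Prod>i<2. v i powr (- real CARD('d) / 2))"
  proof (rule expectation_bump_prod_le)
    fix i :: nat and c :: "nat \<Rightarrow> real" assume i: "i < 2" "c i = 1"
    then consider "i = 0" | "i = 1" by linarith
    then show "v i \<le> (\<Sum>p\<le>i. (c p)\<^sup>2) + \<theta> * (\<Sum>p\<le>i. \<Sum>q\<le>i. sheet_cov (u p) (u q) * c p * c q)"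
    proof cases
      case 1
      then show ?thesis using i by (simp add: v_def A_def u_def)
    next
      case 2
      have sym: "sheet_cov t s = sheet_cov s t" by (simp add: sheet_cov_def min.commute)
      have "(1 - \<rho>) * T \<le> T - B\<^sup>2 / A"
        using BB A by (simp add: field_simps)
      also have "\<dots> \<le> T - B\<^sup>2 / A + A * (c 0 + B / A)\<^sup>2" using A by simp
      also have "\<dots> = A * (c 0)\<^sup>2 + 2 * c 0 * B + T"
      proof -
        have "A * (c 0 + B / A)\<^sup>2 = A * (c 0)\<^sup>2 + 2 * c 0 * B + B\<^sup>2 / A"
          using A by (simp add: power2_eq_square field_simps)
        then show ?thesis by simp
      qed
      also have "\<dots> = (\<Sum>p\<le>i. (c p)\<^sup>2) + \<theta> * (\<Sum>p\<le>i. \<Sum>q\<le>i. sheet_cov (u p) (u q) * c p * c q)"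
        using i 2 by (simp add: u_def A_def B_def T_def sym power2_eq_square algebra_simps)
      finally show ?thesis using 2 by (simp add: v_def)
    qed
  qed (use s t th A T rho in \<open>auto simp: u_def v_def\<close>)
  then have "expectation (\<lambda>\<omega>. bump \<theta> s \<omega> * bump \<theta> t \<omega>)
    \<le> A powr (- real CARD('d) / 2) * ((1 - \<rho>) * T) powr (- real CARD('d) / 2)"
    by (simp add: numeral_2_eq_2 u_def v_def)
  then show ?thesis
    using A T rho unfolding expectation_bump[OF s th] expectation_bump[OF t th] A_def[symmetric] T_def[symmetric]
    by (simp add: powr_mult mult.left_commute)
qed

text \<open>Markov's inequality for a product of bumps with \<theta> = \<eta>^(-2): on the event
  every factor is at least exp (-1/2). Pivot i is at least 1 because of the noise, and at least of
  order \<open>\<rho> i / \<eta>\<^sup>2\<close> by local nondeterminism, where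
  \<open>\<rho> i\<close> is a gap in one direction to all earlier points and to the hyperplane on
  which that coordinate is 0. Repeated points are allowed; with \<open>\<rho> i = 0\<close> they
  cost a constant factor.\<close>

lemma prob_small_values_le:
  fixes t :: "nat \<Rightarrow> real^'n"
  assumes a: "0 < a" and t: "\<And>i j. i < k \<Longrightarrow> a \<le> t i $ j" and eta: "0 < \<eta>"
    and rho: "\<And>i. i < k \<Longrightarrow> 0 \<le> \<rho> i \<and> (\<exists>j. \<rho> i \<le> t i $ j \<and> (\<forall>p<i. \<rho> i \<le> \<bar>t i $ j - t p $ j\<bar>))"
  shows "prob {\<omega>\<in>space M. \<forall>i<k. norm (W \<omega> (t i)) \<le> \<eta>}
    \<le> (\<Prod>i<k. exp (1/2) * (max 1 (a ^ (CARD('n) - 1) * \<rho> i / (2 * \<eta>\<^sup>2))) powr (- real CARD('d) / 2))"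
proof -
  define A where "A = {\<omega>\<in>space M. \<forall>i<k. norm (W \<omega> (t i)) \<le> \<eta>}"
  define \<theta> where "\<theta> = 1 / \<eta>\<^sup>2"
  have th: "0 \<le> \<theta>" by (simp add: \<theta>_def)
  have tp: "t i \<in> pos_orthant" if "i < k" for i
    using t[OF that] a by (auto simp: pos_orthant_def intro: less_le_trans)
  define v where "v = (\<lambda>i. max 1 (a ^ (CARD('n) - 1) * \<rho> i / (2 * \<eta>\<^sup>2)))"
  have le: "expectation (\<lambda>\<omega>. \<Prod>i<k. bump \<theta> (t i) \<omega>) \<le> (\<Prod>i<k. v i powr (- real CARD('d) / 2))"
  proof (rule expectation_bump_prod_le)
    fix i :: nat and c :: "nat \<Rightarrow> real" assume i: "i < k" "c i = 1"
    define Q where "Q = (\<Sum>p\<le>i. \<Sum>q\<le>i. sheet_cov (t p) (t q) * c p * c q)"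
    have nn: "0 \<le> t p $ l" if "p \<le> i" for p l
      using t[of p l] a i that by linarith
    have Q0: "0 \<le> Q" unfolding Q_def by (intro sheet_cov_psd) (auto intro: nn)
    have "(\<Sum>p\<in>{i}. (c p)\<^sup>2) \<le> (\<Sum>p\<le>i. (c p)\<^sup>2)" by (intro sum_mono2) auto
    then have c1: "1 \<le> (\<Sum>p\<le>i. (c p)\<^sup>2)" using i by simp
    obtain j where j: "\<rho> i \<le> t i $ j" "\<And>p. p < i \<Longrightarrow> \<rho> i \<le> \<bar>t i $ j - t p $ j\<bar>" and r0: "0 \<le> \<rho> i"
      using rho[OF i(1)] by blast
    have "\<rho> i * (\<Prod>l\<in>UNIV - {j}. t i $ l) / 2 \<le> Q"
      unfolding Q_def by (rule sheet_cov_local_nondeterminism) (use i j r0 nn in auto)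
    moreover have "a ^ (CARD('n) - 1) \<le> (\<Prod>l\<in>UNIV - {j}. t i $ l)"
      using prod_mono[of "UNIV - {j}" "\<lambda>_. a" "\<lambda>l. t i $ l"] t[OF i(1)] a by (simp add: less_imp_le)
    then have "\<rho> i * a ^ (CARD('n) - 1) \<le> \<rho> i * (\<Prod>l\<in>UNIV - {j}. t i $ l)"
      using r0 by (rule mult_left_mono)
    ultimately have "a ^ (CARD('n) - 1) * \<rho> i / 2 \<le> Q" by (simp add: mult.commute)
    then have "\<theta> * (a ^ (CARD('n) - 1) * \<rho> i / 2) \<le> \<theta> * Q" using th by (rule mult_left_mono)
    then have "a ^ (CARD('n) - 1) * \<rho> i / (2 * \<eta>\<^sup>2) \<le> \<theta> * Q" by (simp add: \<theta>_def)
    then show "v i \<le> (\<Sum>p\<le>i. (c p)\<^sup>2) + \<theta> * (\<Sum>p\<le>i. \<Sum>q\<le>i. sheet_cov (t p) (t q) * c p * c q)"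
      unfolding Q_def[symmetric] v_def using c1 Q0 th mult_nonneg_nonneg[OF th Q0] by linarith
  qed (use tp th in \<open>auto simp: v_def\<close>)
  have m: "(\<lambda>\<omega>. \<Prod>i<k. bump \<theta> (t i) \<omega>) \<in> borel_measurable M"
    using measurable_bump tp by (intro borel_measurable_prod) auto
  have int: "integrable M (\<lambda>\<omega>. \<Prod>i<k. bump \<theta> (t i) \<omega>)"
    using m bump_pos bump_le_1[OF th]
    by (intro integrable_const_bound[where B = 1] AE_I2) (auto simp: abs_prod abs_of_pos intro!: prod_le_1 less_imp_le[OF bump_pos] bump_le_1[OF th])
  have Am: "A \<in> events"
  proof -
    define B where "B = (\<lambda>i. {\<omega>\<in>space M. \<eta> < norm (W \<omega> (t i))})"
    have "B i \<in> events" if "i < k" for i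
      unfolding B_def using measurable_W[OF tp[OF that]] by measurable
    then have "space M - (\<Union>i\<in>{..<k}. B i) \<in> events"
      by (intro sets.compl_sets sets.finite_UN) auto
    also have "space M - (\<Union>i\<in>{..<k}. B i) = A" by (auto simp: A_def B_def not_less)
    finally show ?thesis .
  qed
  have ptw: "indicator A \<omega> \<le> exp (1/2) ^ k * (\<Prod>i<k. bump \<theta> (t i) \<omega>)" for \<omega>
  proof (cases "\<omega> \<in> A")
    case True
    have "1 \<le> (\<Prod>i<k. exp (1/2) * bump \<theta> (t i) \<omega>)"
    proof (rule prod_ge_1)
      fix i assume "i \<in> {..<k}"
      then have "(norm (W \<omega> (t i)))\<^sup>2 \<le> \<eta>\<^sup>2" using True by (intro power_mono) (auto simp: A_def)
      then have "\<theta> * (norm (W \<omega> (t i)))\<^sup>2 \<le> 1" using eta by (simp add: \<theta>_def)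
      then show "1 \<le> exp (1/2) * bump \<theta> (t i) \<omega>" by (simp add: bump_def mult_exp_exp)
    qed
    then show ?thesis using True by (simp add: prod.distrib)
  next
    case False
    have "0 \<le> exp (1/2) ^ k * (\<Prod>i<k. bump \<theta> (t i) \<omega>)"
      by (intro mult_nonneg_nonneg prod_nonneg ballI less_imp_le[OF bump_pos]) simp
    then show ?thesis using False by simp
  qed
  have "prob A = expectation (indicator A)" using Am by simp
  also have "\<dots> \<le> expectation (\<lambda>\<omega>. exp (1/2) ^ k * (\<Prod>i<k. bump \<theta> (t i) \<omega>))"
  proof (rule integral_mono)
    show "integrable M (indicator A :: _ \<Rightarrow> real)"
      by (intro integrable_const_bound[where B = 1] AE_I2 borel_measurable_indicator Am) simp
    show "integrable M (\<lambda>\<omega>. exp (1/2) ^ k * (\<Prod>i<k. bump \<theta> (t i) \<omega>))"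
      by (intro integrable_mult_right int)
    show "\<And>\<omega>. \<omega> \<in> space M \<Longrightarrow> indicator A \<omega> \<le> exp (1/2) ^ k * (\<Prod>i<k. bump \<theta> (t i) \<omega>)"
      by (rule ptw)
  qed
  also have "\<dots> = exp (1/2) ^ k * expectation (\<lambda>\<omega>. \<Prod>i<k. bump \<theta> (t i) \<omega>)" using int by simp
  also have "\<dots> \<le> exp (1/2) ^ k * (\<Prod>i<k. v i powr (- real CARD('d) / 2))"
    using le by (intro mult_left_mono) auto
  also have "\<dots> = (\<Prod>i<k. exp (1/2) * v i powr (- real CARD('d) / 2))"
    by (simp add: prod.distrib)
  finally show ?thesis by (simp only: v_def A_def)
qed

end

section \<open>Hausdorff measure\<close>

lemma diameter_le_bound:
  fixes S :: "'a::metric_space set"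
  assumes "\<And>x y. x \<in> S \<Longrightarrow> y \<in> S \<Longrightarrow> dist x y \<le> d" "0 \<le> d"
  shows "bounded S" "diameter S \<le> d"
proof -
  show "bounded S" using assms(1) unfolding bounded_two_points by blast
  show "diameter S \<le> d"
    unfolding diameter_def using assms by (auto intro!: cSUP_least)
qed

lemma hausdorff_pre_le_cover:
  assumes "A \<subseteq> (\<Union>i. U i)" "\<And>i. bounded (U i)" "\<And>i. diameter (U i) \<le> \<delta>"
  shows "hausdorff_pre s \<delta> A \<le> (\<Sum>i::nat. if U i = {} then 0 else ennreal (diameter (U i) powr s))"
  unfolding hausdorff_pre_def using assms by (intro INF_lower) auto

lemma hausdorff_pre_mono: "A \<subseteq> B \<Longrightarrow> hausdorff_pre s \<delta> A \<le> hausdorff_pre s \<delta> B"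
  unfolding hausdorff_pre_def by (intro INF_superset_mono) auto

lemma hausdorff_pre_antimono: "\<delta> \<le> \<delta>' \<Longrightarrow> hausdorff_pre s \<delta>' A \<le> hausdorff_pre s \<delta> A"
  unfolding hausdorff_pre_def by (intro INF_superset_mono) (auto intro: order_trans)

lemma hausdorff_pre_single:
  fixes S :: "'a::metric_space set"
  assumes S: "\<And>x y. x \<in> S \<Longrightarrow> y \<in> S \<Longrightarrow> dist x y \<le> d" and d: "0 \<le> d" "d \<le> \<delta>" and s: "0 \<le> s"
  shows "hausdorff_pre s \<delta> S \<le> ennreal (d powr s)"
proof -
  define U where "U = (\<lambda>i::nat. if i = 0 then S else {})"
  note dS = diameter_le_bound[of S d, OF S d(1)]
  have "hausdorff_pre s \<delta> S \<le> (\<Sum>i. if U i = {} then 0 else ennreal (diameter (U i) powr s))"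
    by (rule hausdorff_pre_le_cover) (use dS d in \<open>auto simp: U_def split: if_splits\<close>)
  also have "\<dots> = (\<Sum>i\<in>{0}. if U i = {} then 0 else ennreal (diameter (U i) powr s))"
    by (intro suminf_finite) (auto simp: U_def)
  also have "\<dots> \<le> ennreal (d powr s)"
    using dS s diameter_ge_0[OF dS(1)] by (auto simp: U_def intro!: ennreal_leI powr_mono2)
  finally show ?thesis .
qed

lemma hausdorff_pre_empty: "0 \<le> \<delta> \<Longrightarrow> hausdorff_pre s \<delta> ({}::'a::metric_space set) = 0"
proof -
  assume "0 \<le> \<delta>"
  then have "hausdorff_pre s \<delta> ({}::'a set) \<le> (\<Sum>i::nat. if ({}::'a set) = {} then 0 else ennreal (diameter ({}::'a set) powr s))"
    by (intro hausdorff_pre_le_cover[where U = "\<lambda>_. {}"]) auto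
  then show ?thesis by simp
qed

lemma suminf_half_ennreal: "0 \<le> e \<Longrightarrow> (\<Sum>i. ennreal (e / 2 ^ Suc i)) = ennreal e"
proof -
  assume e: "0 \<le> e"
  have "(\<lambda>i. e * (1/2) ^ Suc i) sums (e * 1)"
    by (intro sums_mult power_half_series)
  then have "(\<lambda>i. e / 2 ^ Suc i) sums e"
    by (simp add: power_divide)
  then show ?thesis using e by (intro suminf_ennreal_eq) auto
qed

lemma hausdorff_pre_UN_le:
  fixes A :: "nat \<Rightarrow> 'a::metric_space set"
  shows "hausdorff_pre s \<delta> (\<Union>i. A i) \<le> (\<Sum>i. hausdorff_pre s \<delta> (A i))"
proof (rule ennreal_le_epsilon)
  fix e :: real
  assume fin: "(\<Sum>i. hausdorff_pre s \<delta> (A i)) < top" and e: "0 < e"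
  define F where "F = (\<lambda>U::'a set. if U = {} then 0 else ennreal (diameter U powr s))"
  have "\<exists>U. A i \<subseteq> (\<Union>j. U j) \<and> (\<forall>j. bounded (U j) \<and> diameter (U j) \<le> \<delta>)
      \<and> (\<Sum>j. F (U j)) < hausdorff_pre s \<delta> (A i) + ennreal (e / 2 ^ Suc i)" for i
  proof -
    have "hausdorff_pre s \<delta> (A i) < top"
      using fin ennreal_suminf_lessD by blast
    then have "hausdorff_pre s \<delta> (A i) < hausdorff_pre s \<delta> (A i) + ennreal (e / 2 ^ Suc i)"
      using e ennreal_add_left_cancel_less[of "hausdorff_pre s \<delta> (A i)" 0 "ennreal (e / 2 ^ Suc i)"]
      by (simp add: less_top)
    then show ?thesis
      unfolding hausdorff_pre_def INF_less_iff F_def by blast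
  qed
  then obtain U where U: "\<And>i. A i \<subseteq> (\<Union>j. U i j)" "\<And>i j. bounded (U i j)" "\<And>i j. diameter (U i j) \<le> \<delta>"
    "\<And>i. (\<Sum>j. F (U i j)) < hausdorff_pre s \<delta> (A i) + ennreal (e / 2 ^ Suc i)"
    by metis
  define V where "V = (\<lambda>m. U (fst (prod_decode m)) (snd (prod_decode m)))"
  have "hausdorff_pre s \<delta> (\<Union>i. A i) \<le> (\<Sum>m. F (V m))"
    unfolding F_def
  proof (rule hausdorff_pre_le_cover)
    show "(\<Union>i. A i) \<subseteq> (\<Union>m. V m)"
    proof
      fix x assume "x \<in> (\<Union>i. A i)"
      then obtain i j where "x \<in> U i j" using U(1) by blast
      then have "x \<in> V (prod_encode (i, j))" by (simp add: V_def)
      then show "x \<in> (\<Union>m. V m)" by blast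
    qed
  qed (use U in \<open>auto simp: V_def\<close>)
  also have "(\<Sum>m. F (V m)) = (\<Sum>i. \<Sum>j. F (U i j))"
    using suminf_ennreal_2dimen[of "\<lambda>i. \<Sum>j. F (U i j)" "\<lambda>(i, j). F (U i j)"]
    by (simp add: V_def split_beta')
  also have "\<dots> \<le> (\<Sum>i. hausdorff_pre s \<delta> (A i) + ennreal (e / 2 ^ Suc i))"
    using U(4) by (intro suminf_le) (auto intro: less_imp_le)
  also have "\<dots> = (\<Sum>i. hausdorff_pre s \<delta> (A i)) + ennreal e"
    using e by (simp only: suminf_half_ennreal less_imp_le suminf_add[symmetric] summableI)
  finally show "hausdorff_pre s \<delta> (\<Union>i. A i) \<le> (\<Sum>i. hausdorff_pre s \<delta> (A i)) + ennreal e" .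
qed

lemma hausdorff_pre_UN_finite_le:
  fixes A :: "'i \<Rightarrow> 'a::metric_space set"
  assumes "finite T" "0 \<le> \<delta>"
  shows "hausdorff_pre s \<delta> (\<Union>t\<in>T. A t) \<le> (\<Sum>t\<in>T. hausdorff_pre s \<delta> (A t))"
  using assms(1)
proof (induction T)
  case empty
  then show ?case using assms(2) by (simp add: hausdorff_pre_empty)
next
  case (insert t T)
  define B where "B = (\<lambda>i::nat. if i = 0 then A t else if i = 1 then (\<Union>t\<in>T. A t) else {})"
  have "(\<Union>t\<in>insert t T. A t) = (\<Union>i. B i)"
    by (auto simp: B_def split: if_splits)
  then have "hausdorff_pre s \<delta> (\<Union>t\<in>insert t T. A t) \<le> (\<Sum>i. hausdorff_pre s \<delta> (B i))"
    using hausdorff_pre_UN_le[of s \<delta> B] by simp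
  also have "\<dots> = (\<Sum>i\<in>{0,1}. hausdorff_pre s \<delta> (B i))"
    using assms(2) by (intro suminf_finite) (auto simp: B_def hausdorff_pre_empty)
  also have "\<dots> = hausdorff_pre s \<delta> (A t) + hausdorff_pre s \<delta> (\<Union>t\<in>T. A t)" by (simp add: B_def)
  also have "\<dots> \<le> hausdorff_pre s \<delta> (A t) + (\<Sum>t\<in>T. hausdorff_pre s \<delta> (A t))"
    using insert.IH by (intro add_left_mono)
  finally show ?case using insert.hyps by simp
qed

lemma hausdorff_measure_eq_0_iff: "hausdorff_measure s A = 0 \<longleftrightarrow> (\<forall>\<delta>>0. hausdorff_pre s \<delta> A = 0)"
proof -
  have "(SUP \<delta>\<in>{0<..}. hausdorff_pre s \<delta> A) \<le> 0 \<longleftrightarrow> (\<forall>\<delta>\<in>{0<..}. hausdorff_pre s \<delta> A \<le> 0)"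
    by (rule SUP_le_iff)
  then show ?thesis by (simp add: hausdorff_measure_def greaterThan_def)
qed

lemma hausdorff_null_UN:
  fixes A :: "nat \<Rightarrow> 'a::metric_space set"
  assumes "\<And>i. hausdorff_measure s (A i) = 0"
  shows "hausdorff_measure s (\<Union>i. A i) = 0"
  unfolding hausdorff_measure_eq_0_iff
proof (intro allI impI)
  fix \<delta> :: real assume "0 < \<delta>"
  then have "hausdorff_pre s \<delta> (A i) = 0" for i
    using assms by (simp add: hausdorff_measure_eq_0_iff)
  then show "hausdorff_pre s \<delta> (\<Union>i. A i) = 0"
    using hausdorff_pre_UN_le[of s \<delta> A] by simp
qed

lemma hausdorff_null_subset: "A \<subseteq> B \<Longrightarrow> hausdorff_measure s B = 0 \<Longrightarrow> hausdorff_measure s A = 0"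
  unfolding hausdorff_measure_eq_0_iff using hausdorff_pre_mono by (metis le_zero_eq)

lemma hausdorff_null_mono_exponent:
  assumes "hausdorff_measure s A = 0" "s \<le> s'"
  shows "hausdorff_measure s' A = 0"
  unfolding hausdorff_measure_eq_0_iff
proof (intro allI impI)
  fix \<delta> :: real assume d: "0 < \<delta>"
  \<comment> \<open>Diameters are capped at 1, because raising the exponent decreases a power only
    for bases up to 1.\<close>
  have "hausdorff_pre s' (min \<delta> 1) A \<le> hausdorff_pre s (min \<delta> 1) A"
    unfolding hausdorff_pre_def
  proof (rule INF_mono)
    fix U :: "nat \<Rightarrow> 'a set"
    assume U: "U \<in> {U. A \<subseteq> (\<Union>i. U i) \<and> (\<forall>i. bounded (U i) \<and> diameter (U i) \<le> min \<delta> 1)}"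
    have "diameter (U i) powr s' \<le> diameter (U i) powr s" for i
      using U diameter_ge_0[of "U i"] assms(2) by (intro powr_mono') auto
    then have "(\<Sum>i. if U i = {} then 0 else ennreal (diameter (U i) powr s'))
       \<le> (\<Sum>i. if U i = {} then 0 else ennreal (diameter (U i) powr s))"
      by (intro suminf_le) (auto intro: ennreal_leI)
    then show "\<exists>V\<in>{U. A \<subseteq> (\<Union>i. U i) \<and> (\<forall>i. bounded (U i) \<and> diameter (U i) \<le> min \<delta> 1)}.
        (\<Sum>i. if V i = {} then 0 else ennreal (diameter (V i) powr s'))
       \<le> (\<Sum>i. if U i = {} then 0 else ennreal (diameter (U i) powr s))"
      using U by blast
  qed
  also have "\<dots> = 0" using assms(1) d by (simp add: hausdorff_measure_eq_0_iff)
  finally show "hausdorff_pre s' \<delta> A = 0"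
    using hausdorff_pre_antimono[of "min \<delta> 1" \<delta> s' A] by simp
qed

lemma hausdorff_null_image:
  fixes f :: "'a::metric_space \<Rightarrow> 'b::metric_space"
  assumes lip: "\<And>x y. dist (f x) (f y) \<le> dist x y" and null: "hausdorff_measure s A = 0" and s: "0 \<le> s"
  shows "hausdorff_measure s (f ` A) = 0"
  unfolding hausdorff_measure_eq_0_iff
proof (intro allI impI)
  fix \<delta> :: real assume d: "0 < \<delta>"
  have "hausdorff_pre s \<delta> (f ` A) \<le> hausdorff_pre s \<delta> A"
    unfolding hausdorff_pre_def[of s \<delta> A]
  proof (rule INF_greatest)
    fix U :: "nat \<Rightarrow> 'a set"
    assume U: "U \<in> {U. A \<subseteq> (\<Union>i. U i) \<and> (\<forall>i. bounded (U i) \<and> diameter (U i) \<le> \<delta>)}"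
    have dd: "dist x y \<le> diameter (U i)" if "x \<in> f ` U i" "y \<in> f ` U i" for x y i
      using that U by (auto intro!: order_trans[OF lip diameter_bounded_bound])
    have nn: "0 \<le> diameter (U i)" for i using U diameter_ge_0 by auto
    have D: "bounded (f ` U i)" "diameter (f ` U i) \<le> diameter (U i)" for i
      using diameter_le_bound[of "f ` U i" "diameter (U i)"] dd nn by blast+
    have fA: "f ` A \<subseteq> (\<Union>i. f ` U i)" using U by blast
    have "hausdorff_pre s \<delta> (f ` A) \<le> (\<Sum>i. if f ` U i = {} then 0 else ennreal (diameter (f ` U i) powr s))"
      using U D fA by (intro hausdorff_pre_le_cover) (auto intro: order_trans[OF D(2)])
    also have "\<dots> \<le> (\<Sum>i. if U i = {} then 0 else ennreal (diameter (U i) powr s))"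
      using D s diameter_ge_0[OF D(1)] by (intro suminf_le) (auto intro!: ennreal_leI powr_mono2)
    finally show "hausdorff_pre s \<delta> (f ` A) \<le> (\<Sum>i. if U i = {} then 0 else ennreal (diameter (U i) powr s))" .
  qed
  then show "hausdorff_pre s \<delta> (f ` A) = 0"
    using null d by (simp add: hausdorff_measure_eq_0_iff)
qed

text \<open>Cover sets have arbitrary diameters, while hits are counted at dyadic scales. Rounding
  up to a power of 2 at most doubles a positive diameter, whence the factor \<open>2 powr s\<close>.
  The summand \<open>e\<close> takes care of diameter 0, to which no dyadic scale is
  comparable.\<close>

lemma dyadic_scale:
  fixes d s e :: real
  assumes d: "0 \<le> d" "d \<le> 2 powr (- real n1)" and s: "0 < s" and e: "0 < e"
  obtains n where "n1 \<le> n" "d \<le> 2 powr (- real n)" "(2 powr (- real n)) powr s \<le> 2 powr s * d powr s + e"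
proof (cases "d = 0")
  case True
  have "((\<lambda>n. 2 powr (- (real n * s))) \<longlongrightarrow> 0) sequentially"
    using s by real_asymp
  then have "\<forall>\<^sub>F n in sequentially. 2 powr (- (real n * s)) < e"
    using e by (auto dest: order_tendstoD(2))
  then have "\<forall>\<^sub>F n in sequentially. 2 powr (- (real n * s)) < e \<and> n1 \<le> n"
    using eventually_ge_at_top by (rule eventually_conj)
  then obtain n where "2 powr (- (real n * s)) < e" "n1 \<le> n"
    by (auto simp: eventually_sequentially)
  then show ?thesis using that[of n] True by (simp add: powr_powr)
next
  case False
  then have d0: "0 < d" using d by simp
  define n where "n = nat \<lfloor>- log 2 d\<rfloor>"
  have "log 2 d \<le> - real n1"
    using d0 d(2) by (simp add: log_le_iff)
  then have fl: "int n1 \<le> \<lfloor>- log 2 d\<rfloor>" by (simp add: le_floor_iff)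
  then have n: "n1 \<le> n" "real n = of_int \<lfloor>- log 2 d\<rfloor>" by (auto simp: n_def)
  then have b: "real n \<le> - log 2 d" "- log 2 d < real n + 1" by linarith+
  have "d \<le> 2 powr (- real n)" using d0 b(1) by (simp add: log_le_iff[symmetric])
  moreover have "2 powr (- real n) \<le> 2 * d"
  proof -
    have "2 powr (- real n) \<le> 2 powr (1 + log 2 d)" using b(2) by (intro powr_mono) auto
    then show ?thesis using d0 by (simp add: powr_add)
  qed
  then have "(2 powr (- real n)) powr s \<le> (2 * d) powr s" using s by (intro powr_mono2) auto
  then have "(2 powr (- real n)) powr s \<le> 2 powr s * d powr s + e" using d0 e by (simp add: powr_mult)
  ultimately show ?thesis using that n by blast
qed

text \<open>A cover set of the image at scale 2^(-n) pulls back to at most 2^(n u) balls of radius C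
  2^(-n). In dimension s + u they cost 2^(n u) (2 C 2^(-n))^(s + u), a constant times 2^(-n s): the
  additional exponent u pays exactly for the number of balls, so the total cost stays proportional
  to the s-cost of the cover.\<close>

lemma hausdorff_null_preimage:
  fixes f :: "'a::metric_space \<Rightarrow> 'b::metric_space"
  assumes s: "0 < s" and u: "0 \<le> u" and C: "0 < C"
    and cover: "\<And>n y. n0 \<le> n \<Longrightarrow> \<exists>T. finite T \<and> real (card T) \<le> 2 powr (real n * u) \<and>
       A \<inter> {z. dist (f z) y \<le> 2 powr (- real n)} \<subseteq> (\<Union>t\<in>T. cball t (C * 2 powr (- real n)))"
    and null: "hausdorff_measure s (f ` A) = 0"
  shows "hausdorff_measure (s + u) A = 0"
  unfolding hausdorff_measure_eq_0_iff
proof (intro allI impI)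
  fix \<delta> :: real assume d: "0 < \<delta>"
  define K where "K = (2 * C) powr (s + u)"
  have K: "0 < K" using C by (simp add: K_def)
  have "((\<lambda>n. 2 * C * 2 powr (- real n)) \<longlongrightarrow> 0) sequentially"
    by real_asymp
  then have "\<forall>\<^sub>F n in sequentially. 2 * C * 2 powr (- real n) < \<delta>"
    using d by (auto dest: order_tendstoD(2))
  then have "\<forall>\<^sub>F n in sequentially. 2 * C * 2 powr (- real n) < \<delta> \<and> n0 \<le> n"
    using eventually_ge_at_top by (rule eventually_conj)
  then obtain n1 where n1: "2 * C * 2 powr (- real n1) < \<delta>" "n0 \<le> n1"
    by (auto simp: eventually_sequentially)
  have main: "hausdorff_pre (s + u) \<delta> A \<le> ennreal (K * (2 powr s * e + e))" if e: "0 < e" for e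
  proof -
    have "hausdorff_pre s (2 powr (- real n1)) (f ` A) < ennreal e"
      using null e by (simp add: hausdorff_measure_eq_0_iff)
    then obtain U where U: "f ` A \<subseteq> (\<Union>i::nat. U i)" "\<And>i. bounded (U i)" "\<And>i. diameter (U i) \<le> 2 powr (- real n1)"
      and Us: "(\<Sum>i. if U i = {} then 0 else ennreal (diameter (U i) powr s)) < ennreal e"
      unfolding hausdorff_pre_def INF_less_iff by blast
    define B where "B = (\<lambda>i. A \<inter> f -` U i)"
    have Bi: "hausdorff_pre (s + u) \<delta> (B i)
       \<le> ennreal K * (ennreal (2 powr s) * (if U i = {} then 0 else ennreal (diameter (U i) powr s)) + ennreal (e / 2 ^ Suc i))" for i
    proof (cases "U i = {}")
      case True
      then show ?thesis using d by (simp add: B_def hausdorff_pre_empty)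
    next
      case False
      then obtain y where y: "y \<in> U i" by auto
      obtain n where n: "n1 \<le> n" "diameter (U i) \<le> 2 powr (- real n)"
        "(2 powr (- real n)) powr s \<le> 2 powr s * diameter (U i) powr s + e / 2 ^ Suc i"
        using dyadic_scale[of "diameter (U i)" n1 s "e / 2 ^ Suc i"] diameter_ge_0[OF U(2)] U(3) s e by auto
      obtain T where T: "finite T" "real (card T) \<le> 2 powr (real n * u)"
        "A \<inter> {z. dist (f z) y \<le> 2 powr (- real n)} \<subseteq> (\<Union>t\<in>T. cball t (C * 2 powr (- real n)))"
        using cover[of n y] n1(2) n(1) by auto
      define r where "r = 2 * C * 2 powr (- real n)"
      have "2 powr (- real n) \<le> 2 powr (- real n1)" using n(1) by (intro powr_mono) auto
      then have "r \<le> 2 * C * 2 powr (- real n1)" unfolding r_def using C by (intro mult_left_mono) auto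
      then have "r \<le> \<delta>" using n1(1) by linarith
      moreover have "0 \<le> r" using C by (simp add: r_def)
      ultimately have r: "0 \<le> r" "r \<le> \<delta>" by auto
      have ball: "hausdorff_pre (s + u) \<delta> (cball t (C * 2 powr (- real n))) \<le> ennreal (r powr (s + u))" for t :: 'a
      proof (rule hausdorff_pre_single)
        fix x z assume "x \<in> cball t (C * 2 powr (- real n))" "z \<in> cball t (C * 2 powr (- real n))"
        then have "dist t x \<le> C * 2 powr (- real n)" "dist t z \<le> C * 2 powr (- real n)" by auto
        then show "dist x z \<le> r"
          using dist_triangle2[of x z t] by (simp add: r_def dist_commute)
      qed (use r s u in auto)
      have "B i \<subseteq> A \<inter> {z. dist (f z) y \<le> 2 powr (- real n)}"
        using y n(2) diameter_bounded_bound[OF U(2)[of i], of _ y] by (fastforce simp: B_def)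
      then have "B i \<subseteq> (\<Union>t\<in>T. cball t (C * 2 powr (- real n)))" using T(3) by blast
      then have "hausdorff_pre (s + u) \<delta> (B i) \<le> hausdorff_pre (s + u) \<delta> (\<Union>t\<in>T. cball t (C * 2 powr (- real n)))"
        by (rule hausdorff_pre_mono)
      also have "\<dots> \<le> (\<Sum>t\<in>T. hausdorff_pre (s + u) \<delta> (cball t (C * 2 powr (- real n))))"
        using T(1) d by (intro hausdorff_pre_UN_finite_le) auto
      also have "\<dots> \<le> (\<Sum>t\<in>T. ennreal (r powr (s + u)))" by (intro sum_mono ball)
      also have "\<dots> = ennreal (real (card T) * r powr (s + u))"
        by (simp add: ennreal_mult ennreal_of_nat_eq_real_of_nat)
      also have "\<dots> \<le> ennreal (2 powr (real n * u) * r powr (s + u))"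
        using T(2) by (intro ennreal_leI mult_right_mono) auto
      also have "2 powr (real n * u) * r powr (s + u) = K * (2 powr (- real n)) powr s"
        using C by (simp add: r_def K_def powr_mult powr_powr powr_add[symmetric] algebra_simps)
      also have "ennreal \<dots> \<le> ennreal (K * (2 powr s * diameter (U i) powr s + e / 2 ^ Suc i))"
        using n(3) K by (intro ennreal_leI mult_left_mono) auto
      also have "\<dots> = ennreal K * (ennreal (2 powr s) * ennreal (diameter (U i) powr s) + ennreal (e / 2 ^ Suc i))"
        using K e by (simp add: ennreal_mult ennreal_plus)
      finally show ?thesis using False by simp
    qed
    have "A \<subseteq> (\<Union>i. B i)" using U(1) unfolding B_def by blast
    then have "hausdorff_pre (s + u) \<delta> A \<le> hausdorff_pre (s + u) \<delta> (\<Union>i. B i)" by (rule hausdorff_pre_mono)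
    also have "\<dots> \<le> (\<Sum>i. hausdorff_pre (s + u) \<delta> (B i))" by (rule hausdorff_pre_UN_le)
    also have "\<dots> \<le> (\<Sum>i. ennreal K * (ennreal (2 powr s) * (if U i = {} then 0 else ennreal (diameter (U i) powr s)) + ennreal (e / 2 ^ Suc i)))"
      by (intro suminf_le Bi) auto
    also have "\<dots> = ennreal K * (ennreal (2 powr s) * (\<Sum>i. if U i = {} then 0 else ennreal (diameter (U i) powr s)) + ennreal e)"
      using e by (simp only: ennreal_suminf_cmult suminf_half_ennreal less_imp_le suminf_add[symmetric] summableI)
    also have "\<dots> \<le> ennreal K * (ennreal (2 powr s) * ennreal e + ennreal e)"
      using Us by (intro mult_left_mono add_right_mono) auto
    also have "\<dots> = ennreal (K * (2 powr s * e + e))"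
      using K e by (simp add: ennreal_mult ennreal_plus)
    finally show ?thesis .
  qed
  have "hausdorff_pre (s + u) \<delta> A \<le> 0"
  proof (rule ennreal_le_epsilon)
    fix e :: real assume e: "0 < e"
    define e' where "e' = e / (K * (2 powr s + 1))"
    have "0 < e'" using e K by (auto simp: e'_def intro!: divide_pos_pos mult_pos_pos add_pos_pos)
    moreover have "K * (2 powr s * e' + e') = e"
    proof -
      have "0 < 2 powr s + 1" by (intro add_pos_pos) auto
      then have "K * (2 powr s + 1) \<noteq> 0" using K by simp
      moreover have "K * (2 powr s * e' + e') = (K * (2 powr s + 1)) * e'" by (simp add: algebra_simps)
      ultimately show ?thesis by (simp add: e'_def)
    qed
    ultimately show "hausdorff_pre (s + u) \<delta> A \<le> 0 + ennreal e" using main[of e'] by simp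
  qed
  then show "hausdorff_pre (s + u) \<delta> A = 0" by simp
qed

lemma hausdorff_dim_eqI:
  assumes a: "0 < a" and up: "\<And>s. a < s \<Longrightarrow> hausdorff_measure s A = 0"
    and low: "\<And>s. 0 < s \<Longrightarrow> s < a \<Longrightarrow> hausdorff_measure s A \<noteq> 0"
  shows "hausdorff_dim A = a"
  unfolding hausdorff_dim_def
proof (rule antisym)
  let ?S = "{s. 0 < s \<and> hausdorff_measure s A = 0}"
  have bdd: "bdd_below ?S" by (intro bdd_belowI[of _ 0]) auto
  show "Inf ?S \<le> a"
  proof (rule field_le_epsilon)
    fix e :: real assume "0 < e"
    then have "a + e \<in> ?S" using up a by auto
    then show "Inf ?S \<le> a + e" using bdd by (rule cInf_lower)
  qed
  have "a + 1 \<in> ?S" using up a by auto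
  then show "a \<le> Inf ?S"
    using low by (intro cInf_greatest) (auto simp: not_less[symmetric])
qed

section \<open>A discrete energy criterion\<close>

text \<open>The cover is made disjoint by assigning each point to the first set containing it, and
  Cauchy-Schwarz is applied to the masses \<open>X j\<close>. Two points in one cover set are no
  further apart than its diameter, so \<open>(X j)\<^sup>2 / D j\<close> is at most the energy of
  that piece. The shift \<open>h\<close> keeps the energy of atoms finite on the diagonal.\<close>

lemma discrete_frostman:
  fixes p :: "'i \<Rightarrow> 'a::metric_space" and U :: "nat \<Rightarrow> 'a set"
  assumes fin: "finite I" and w: "\<And>i. i \<in> I \<Longrightarrow> 0 \<le> w i" and h: "0 < h" and s: "0 \<le> s"
    and U: "\<And>j. j < q \<Longrightarrow> bounded (U j)"
    and m: "0 \<le> m" "m \<le> (\<Sum>i\<in>{i\<in>I. p i \<in> (\<Union>j<q. U j)}. w i)"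
    and K: "(\<Sum>i\<in>I. \<Sum>l\<in>I. w i * w l * (dist (p i) (p l) + h) powr (- s)) \<le> K"
  shows "m\<^sup>2 \<le> K * (\<Sum>j<q. (diameter (U j) + h) powr s)"
proof -
  define V where "V = (\<lambda>j. {i\<in>I. p i \<in> U j \<and> (\<forall>j'<j. p i \<notin> U j')})"
  define D where "D = (\<lambda>j. (diameter (U j) + h) powr s)"
  define X where "X = (\<lambda>j. \<Sum>i\<in>V j. w i)"
  define e where "e = (\<lambda>i l. w i * w l * (dist (p i) (p l) + h) powr (- s))"
  have VI: "V j \<subseteq> I" and Vfin: "finite (V j)" for j using fin by (auto simp: V_def)
  have Vdisj: "V j \<inter> V j' = {}" if "j \<noteq> j'" for j j'
    using that by (cases j j' rule: linorder_cases) (auto simp: V_def)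
  have e0: "0 \<le> e i l" if "i \<in> I" "l \<in> I" for i l using w that by (simp add: e_def)
  have D0: "0 < D j" if "j < q" for j
    using diameter_ge_0[OF U[OF that]] h by (simp add: D_def add_nonneg_pos)
  have VU: "{i\<in>I. p i \<in> (\<Union>j<q. U j)} = (\<Union>j<q. V j)"
  proof (intro equalityI subsetI)
    fix i assume i: "i \<in> {i\<in>I. p i \<in> (\<Union>j<q. U j)}"
    then obtain j where j: "j < q" "p i \<in> U j" by auto
    define j0 where "j0 = (LEAST j. p i \<in> U j)"
    have "p i \<in> U j0" unfolding j0_def using j(2) by (rule LeastI)
    moreover have "j0 \<le> j" unfolding j0_def using j(2) by (rule Least_le)
    moreover have "\<forall>j'<j0. p i \<notin> U j'" unfolding j0_def using not_less_Least by blast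
    ultimately have "i \<in> V j0" "j0 < q" using i j by (auto simp: V_def)
    then show "i \<in> (\<Union>j<q. V j)" by blast
  qed (auto simp: V_def)
  have sumV: "(\<Sum>j<q. sum g (V j)) = sum g (\<Union>j<q. V j)" for g :: "'i \<Rightarrow> real"
    using Vfin Vdisj by (intro sum.UNION_disjoint[symmetric]) auto
  have "m \<le> (\<Sum>j<q. X j)" using m(2) unfolding VU by (simp add: X_def sumV)
  then have "m\<^sup>2 \<le> (\<Sum>j<q. X j)\<^sup>2" using m(1) by (intro power_mono) auto
  also have "\<dots> = (\<Sum>j<q. (X j / sqrt (D j)) * sqrt (D j))\<^sup>2"
    using D0 by (intro arg_cong[where f = "\<lambda>x. x\<^sup>2"] sum.cong) (auto, force)
  also have "\<dots> \<le> (\<Sum>j<q. (X j / sqrt (D j))\<^sup>2) * (\<Sum>j<q. (sqrt (D j))\<^sup>2)"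
    by (rule Cauchy_Schwarz_ineq_sum)
  also have "\<dots> = (\<Sum>j<q. (X j)\<^sup>2 / D j) * (\<Sum>j<q. D j)"
    using D0 by (simp add: power_divide less_imp_le)
  also have "\<dots> \<le> K * (\<Sum>j<q. D j)"
  proof (rule mult_right_mono)
    have "(X j)\<^sup>2 / D j \<le> (\<Sum>i\<in>V j. \<Sum>l\<in>I. e i l)" if j: "j < q" for j
    proof -
      have "(X j)\<^sup>2 / D j = (\<Sum>i\<in>V j. \<Sum>l\<in>V j. w i * w l / D j)"
        by (simp add: X_def power2_eq_square sum_product sum_divide_distrib)
      also have "\<dots> \<le> (\<Sum>i\<in>V j. \<Sum>l\<in>V j. e i l)"
      proof (intro sum_mono)
        fix i l assume il: "i \<in> V j" "l \<in> V j"
        then have "dist (p i) (p l) \<le> diameter (U j)"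
          using U[OF j] by (intro diameter_bounded_bound) (auto simp: V_def)
        then have "(dist (p i) (p l) + h) powr s \<le> D j"
          using h s by (auto simp: D_def intro!: powr_mono2 add_nonneg_nonneg)
        moreover have "0 < dist (p i) (p l) + h" using h by (simp add: add_nonneg_pos)
        then have "0 < (dist (p i) (p l) + h) powr s" by simp
        ultimately have "1 / D j \<le> 1 / (dist (p i) (p l) + h) powr s"
          using D0[OF j] by (intro divide_left_mono mult_pos_pos) auto
        then have "1 / D j \<le> (dist (p i) (p l) + h) powr (- s)"
          by (simp add: powr_minus_divide)
        moreover have "0 \<le> w i * w l" using il w by (auto simp: V_def)
        ultimately have "w i * w l * (1 / D j) \<le> e i l" unfolding e_def by (rule mult_left_mono)
        then show "w i * w l / D j \<le> e i l" by simp
      qed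
      also have "\<dots> \<le> (\<Sum>i\<in>V j. \<Sum>l\<in>I. e i l)"
        using VI fin e0 by (intro sum_mono sum_mono2) auto
      finally show ?thesis .
    qed
    then have "(\<Sum>j<q. (X j)\<^sup>2 / D j) \<le> (\<Sum>j<q. \<Sum>i\<in>V j. \<Sum>l\<in>I. e i l)"
      by (intro sum_mono) auto
    also have "\<dots> = (\<Sum>i\<in>(\<Union>j<q. V j). \<Sum>l\<in>I. e i l)" by (rule sumV)
    also have "\<dots> \<le> (\<Sum>i\<in>I. \<Sum>l\<in>I. e i l)"
      using VI fin e0 by (intro sum_mono2) (auto intro!: sum_nonneg)
    also have "\<dots> \<le> K" using K by (simp add: e_def)
    finally show "(\<Sum>j<q. (X j)\<^sup>2 / D j) \<le> K" .
    show "0 \<le> (\<Sum>j<q. D j)" using D0 by (intro sum_nonneg) (auto intro: less_imp_le)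
  qed
  finally show ?thesis by (simp add: D_def)
qed

text \<open>No limit measure is formed. Given a cheap cover of the zero set, the function is bounded
  away from 0 on the part of K outside finitely many enlarged cover sets, so by \<open>off\<close>
  most of the mass lies inside them, and the discrete criterion is applied at one scale chosen after
  the cover. Mass and energy bounds at infinitely many n are enough, since the other conditions hold
  eventually.\<close>

lemma hausdorff_measure_zero_set_nonzero:
  fixes f :: "'a::heine_borel \<Rightarrow> 'b::real_normed_vector" and p :: "nat \<Rightarrow> 'i \<Rightarrow> 'a"
  assumes comp: "compact K" "K \<subseteq> S" and cont: "continuous_on S f" and s: "0 < s" and E: "0 < E"
    and I: "\<And>n. finite (I n)" "\<And>n i. i \<in> I n \<Longrightarrow> p n i \<in> K" "\<And>n i. i \<in> I n \<Longrightarrow> 0 \<le> w n i"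
    and mass: "\<exists>\<^sub>F n in sequentially. 1 / 2 \<le> (\<Sum>i\<in>I n. w n i) \<and>
      (\<Sum>i\<in>I n. \<Sum>l\<in>I n. w n i * w n l * (dist (p n i) (p n l) + 1 / 2 ^ n) powr (- s)) \<le> E"
    and off: "\<And>\<eta>. 0 < \<eta> \<Longrightarrow> \<forall>\<^sub>F n in sequentially. (\<Sum>i\<in>{i\<in>I n. \<eta> \<le> norm (f (p n i))}. w n i) \<le> 1 / 4"
  shows "hausdorff_measure s {t \<in> S. f t = 0} \<noteq> 0"
proof
  let ?Z = "{t \<in> S. f t = 0}"
  assume "hausdorff_measure s ?Z = 0"
  then have pre0: "hausdorff_pre s 1 ?Z = 0" by (simp add: hausdorff_measure_eq_0_iff)
  \<comment> \<open>The covered mass will be at least 1/4 and the enlarged cover costs less than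
    \<open>2 * e\<close>, so the criterion would give 1/16 < 2 e E = 1/32.\<close>
  define e where "e = 1 / (64 * E)"
  have e: "0 < e" using E by (simp add: e_def)
  have "hausdorff_pre s 1 ?Z < ennreal e" using pre0 e by simp
  then obtain U where U: "?Z \<subseteq> (\<Union>i::nat. U i)" "\<And>i. bounded (U i)"
    and Us: "(\<Sum>i. if U i = {} then 0 else ennreal (diameter (U i) powr s)) < ennreal e"
    unfolding hausdorff_pre_def INF_less_iff by blast
  have d0: "0 \<le> diameter (U i)" for i using U(2) by (rule diameter_ge_0)
  have "\<exists>r>0. (diameter (U i) + 2 * r) powr s < diameter (U i) powr s + e / 2 ^ Suc i" for i
  proof -
    have "((\<lambda>r. (diameter (U i) + 2 * r) powr s) \<longlongrightarrow> (diameter (U i) + 2 * 0) powr s) (at_right 0)"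
      using s d0[of i]
      by (intro tendsto_powr' tendsto_intros) (auto simp: eventually_at_filter intro!: always_eventually)
    then have "\<forall>\<^sub>F r in at_right 0. (diameter (U i) + 2 * r) powr s < diameter (U i) powr s + e / 2 ^ Suc i"
      using e by (auto dest!: order_tendstoD(2))
    then obtain b where "0 < b" "\<And>r. 0 < r \<Longrightarrow> r < b \<Longrightarrow> (diameter (U i) + 2 * r) powr s < diameter (U i) powr s + e / 2 ^ Suc i"
      unfolding eventually_at_right_field by auto
    from this(1) this(2)[of "b / 2"] show ?thesis by (intro exI[of _ "b / 2"]) auto
  qed
  then obtain r where r: "\<And>i. 0 < r i" "\<And>i. (diameter (U i) + 2 * r i) powr s < diameter (U i) powr s + e / 2 ^ Suc i"
    by metis
  \<comment> \<open>Open neighbourhoods make a finite subcover available; the radii are chosen so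
    that all enlargements together cost at most \<open>e\<close>.\<close>
  define V where "V = (\<lambda>i. \<Union>y\<in>U i. ball y (r i))"
  have Vopen: "open (V i)" for i by (auto simp: V_def)
  have UV: "U i \<subseteq> V i" for i using r(1) by (auto simp: V_def)
  have Vd: "dist x z \<le> diameter (U i) + 2 * r i" if xz: "x \<in> V i" "z \<in> V i" for x z i
  proof -
    obtain y y' where y: "y \<in> U i" "dist y x < r i" "y' \<in> U i" "dist y' z < r i"
      using xz by (auto simp: V_def)
    have "dist y y' \<le> diameter (U i)" using y U(2) by (intro diameter_bounded_bound) auto
    then show ?thesis
      using y dist_triangle[of x z y] dist_triangle[of y z y'] by (simp add: dist_commute)
  qed
  have Vb: "bounded (V i)" "diameter (V i) \<le> diameter (U i) + 2 * r i" for i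
    using diameter_le_bound[of "V i" "diameter (U i) + 2 * r i"] Vd r(1)[of i] d0[of i] by auto
  have compZ: "compact (K \<inter> f -` {0})"
  proof -
    have "closed (K \<inter> f -` {0})"
      using continuous_on_subset[OF cont comp(2)] comp(1)
      by (intro continuous_closed_preimage compact_imp_closed) auto
    then show ?thesis using comp(1) by (simp add: compact_eq_bounded_closed bounded_Int)
  qed
  have cov: "K \<inter> f -` {0} \<subseteq> (\<Union>i\<in>UNIV. V i)" using U(1) UV comp(2) by blast
  obtain F where F: "F \<subseteq> UNIV" "finite F" "K \<inter> f -` {0} \<subseteq> (\<Union>i\<in>F. V i)"
    by (rule compactE_image[OF compZ Vopen cov])
  obtain q where q: "\<And>i. i \<in> F \<Longrightarrow> i < q" using F(2) unfolding finite_nat_set_iff_bounded by auto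
  have FV: "(\<Union>i\<in>F. V i) \<subseteq> (\<Union>i<q. V i)" using q by auto
  \<comment> \<open>The minimum of the norm on a compact set free of zeros; if that set is empty,
    any positive value serves.\<close>
  have "\<exists>\<eta>>0. \<forall>t\<in>K - (\<Union>i<q. V i). \<eta> \<le> norm (f t)"
  proof (cases "K - (\<Union>i<q. V i) = {}")
    case True then show ?thesis by (intro exI[of _ 1]) auto
  next
    case False
    have cK: "compact (K - (\<Union>i<q. V i))" using comp(1) Vopen by (intro compact_diff) auto
    have "continuous_on (K - (\<Union>i<q. V i)) (\<lambda>t. norm (f t))"
      using cont comp(2) by (intro continuous_on_norm) (auto intro: continuous_on_subset)
    from continuous_attains_inf[OF cK False this]
    obtain t where t: "t \<in> K - (\<Union>i<q. V i)" "\<And>x. x \<in> K - (\<Union>i<q. V i) \<Longrightarrow> norm (f t) \<le> norm (f x)"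
      by (metis (no_types, lifting))
    then have "f t \<noteq> 0" using F(3) FV by blast
    then show ?thesis using t(2) by (intro exI[of _ "norm (f t)"]) auto
  qed
  then obtain \<eta> where \<eta>: "0 < \<eta>" "\<And>t. t \<in> K \<Longrightarrow> t \<notin> (\<Union>i<q. V i) \<Longrightarrow> \<eta> \<le> norm (f t)" by blast
  have lim: "((\<lambda>n. \<Sum>j<q. (diameter (V j) + 1 / 2 ^ n) powr s) \<longlongrightarrow> (\<Sum>j<q. (diameter (V j) + 0) powr s)) sequentially"
  proof (intro tendsto_sum tendsto_powr' tendsto_add tendsto_const)
    show "(\<lambda>n. 1 / 2 ^ n :: real) \<longlonglongrightarrow> 0" by real_asymp
  qed (use s diameter_ge_0[OF Vb(1)] in auto)
  have "(\<Sum>j<q. (diameter (V j) + 0) powr s) \<le> (\<Sum>j<q. diameter (U j) powr s + e / 2 ^ Suc j)"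
  proof (rule sum_mono)
    fix j
    have "(diameter (V j) + 0) powr s \<le> (diameter (U j) + 2 * r j) powr s"
      using s Vb(2)[of j] diameter_ge_0[OF Vb(1)[of j]] by (intro powr_mono2) auto
    then show "(diameter (V j) + 0) powr s \<le> diameter (U j) powr s + e / 2 ^ Suc j"
      using r(2)[of j] by linarith
  qed
  also have "\<dots> < 2 * e"
  proof -
    have "ennreal (\<Sum>j<q. diameter (U j) powr s) = (\<Sum>j<q. if U j = {} then 0 else ennreal (diameter (U j) powr s))"
    proof -
      have "ennreal (\<Sum>j<q. diameter (U j) powr s) = (\<Sum>j<q. ennreal (diameter (U j) powr s))"
        by (intro sum_ennreal[symmetric]) simp
      also have "\<dots> = (\<Sum>j<q. if U j = {} then 0 else ennreal (diameter (U j) powr s))"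
        using s by (intro sum.cong) auto
      finally show ?thesis .
    qed
    also have "\<dots> \<le> (\<Sum>j. if U j = {} then 0 else ennreal (diameter (U j) powr s))"
      by (intro sum_le_suminf) auto
    also have "\<dots> < ennreal e" by (rule Us)
    finally have "(\<Sum>j<q. diameter (U j) powr s) < e" using e by (simp add: ennreal_less_iff sum_nonneg)
    moreover have "(\<Sum>j<q. e / 2 ^ Suc j) \<le> e"
    proof -
      have "(\<lambda>i. e * (1/2) ^ Suc i) sums (e * 1)" by (intro sums_mult power_half_series)
      then have sm: "(\<lambda>i. e / 2 ^ Suc i) sums e" by (simp add: power_divide)
      then have "(\<Sum>j<q. e / 2 ^ Suc j) \<le> (\<Sum>j. e / 2 ^ Suc j)"
        using e by (intro sum_le_suminf) (auto simp: sums_iff)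
      then show ?thesis using sm by (simp add: sums_iff)
    qed
    ultimately show ?thesis by (simp add: sum.distrib)
  qed
  finally have ev: "\<forall>\<^sub>F n in sequentially. (\<Sum>j<q. (diameter (V j) + 1 / 2 ^ n) powr s) < 2 * e"
    using lim by (auto dest: order_tendstoD(2))
  obtain n where n: "1 / 2 \<le> (\<Sum>i\<in>I n. w n i)"
      "(\<Sum>i\<in>I n. \<Sum>l\<in>I n. w n i * w n l * (dist (p n i) (p n l) + 1 / 2 ^ n) powr (- s)) \<le> E"
      "(\<Sum>j<q. (diameter (V j) + 1 / 2 ^ n) powr s) < 2 * e"
      "(\<Sum>i\<in>{i\<in>I n. \<eta> \<le> norm (f (p n i))}. w n i) \<le> 1 / 4"
    using frequently_ex[OF frequently_eventually_conj[OF mass eventually_conj[OF ev off[OF \<eta>(1)]]]] by blast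
  have "I n \<subseteq> {i\<in>I n. p n i \<in> (\<Union>j<q. V j)} \<union> {i\<in>I n. \<eta> \<le> norm (f (p n i))}"
    using I(2) \<eta>(2) by blast
  then have "(\<Sum>i\<in>I n. w n i) \<le> (\<Sum>i\<in>{i\<in>I n. p n i \<in> (\<Union>j<q. V j)} \<union> {i\<in>I n. \<eta> \<le> norm (f (p n i))}. w n i)"
    using I by (intro sum_mono2) auto
  also have "\<dots> \<le> (\<Sum>i\<in>{i\<in>I n. p n i \<in> (\<Union>j<q. V j)}. w n i) + (\<Sum>i\<in>{i\<in>I n. \<eta> \<le> norm (f (p n i))}. w n i)"
    using I by (subst sum_Un) (auto intro!: sum_nonneg)
  finally have "1 / 4 \<le> (\<Sum>i\<in>{i\<in>I n. p n i \<in> (\<Union>j<q. V j)}. w n i)" using n by linarith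
  then have "(1/4)\<^sup>2 \<le> E * (\<Sum>j<q. (diameter (V j) + 1 / 2 ^ n) powr s)"
    using n(2) I Vb(1) s by (intro discrete_frostman[of "I n" "w n" _ s q V _ "p n"]) auto
  also have "\<dots> < E * (2 * e)" using n(3) E by (intro mult_strict_left_mono)
  also have "\<dots> = 1 / 32" using E by (simp add: e_def)
  finally show False by (simp add: power2_eq_square)
qed

section \<open>Energy estimates on dyadic grids\<close>

text \<open>Comparison with an integral: by the mean value theorem each term is at most the
  increment of x^(1 - \<beta>) / (1 - \<beta>) over the unit interval to its left.\<close>

lemma sum_powr_le:
  fixes \<beta> :: real
  assumes "0 \<le> \<beta>" "\<beta> < 1"
  shows "(\<Sum>j<m. real (j + 1) powr (- \<beta>)) \<le> real m powr (1 - \<beta>) / (1 - \<beta>)"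
proof (induction m)
  case (Suc m)
  define \<gamma> where "\<gamma> = 1 - \<beta>"
  have g: "0 < \<gamma>" "\<gamma> \<le> 1" using assms by (auto simp: \<gamma>_def)
  have "\<gamma> * real (m + 1) powr (\<gamma> - 1) \<le> real (m + 1) powr \<gamma> - real m powr \<gamma>"
  proof (cases "m = 0")
    case True then show ?thesis using g by simp
  next
    case False
    have "\<exists>z>real m. z < real m + 1 \<and> (real m + 1) powr \<gamma> - real m powr \<gamma> = (real m + 1 - real m) * (\<gamma> * z powr (\<gamma> - 1))"
      using False by (intro MVT2) (auto intro!: derivative_eq_intros)
    then obtain z where z: "real m < z" "z < real m + 1"
      "(real m + 1) powr \<gamma> - real m powr \<gamma> = \<gamma> * z powr (\<gamma> - 1)" by auto
    have "(real m + 1) powr (\<gamma> - 1) \<le> z powr (\<gamma> - 1)"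
      using z g by (intro powr_mono2') auto
    then have "\<gamma> * (real m + 1) powr (\<gamma> - 1) \<le> \<gamma> * z powr (\<gamma> - 1)" using g by (intro mult_left_mono) auto
    then show ?thesis using z(3) by (simp add: add.commute)
  qed
  then have "real (m + 1) powr (- \<beta>) \<le> (real (m + 1) powr \<gamma> - real m powr \<gamma>) / \<gamma>"
    using g by (simp add: field_simps) (simp add: \<gamma>_def)
  then show ?case using Suc.IH by (simp add: \<gamma>_def[symmetric] diff_divide_distrib)
qed simp

lemma sum_absdiff_le:
  fixes g :: "nat \<Rightarrow> real"
  assumes g: "\<And>j. 0 \<le> g j" and x: "x < m"
  shows "(\<Sum>y<m. g (nat \<bar>int x - int y\<bar>)) \<le> 2 * (\<Sum>j<m. g j)"
proof -
  have "(\<Sum>y<m. g (nat \<bar>int x - int y\<bar>)) = (\<Sum>y\<in>{..x}. g (nat \<bar>int x - int y\<bar>)) + (\<Sum>y\<in>{x<..<m}. g (nat \<bar>int x - int y\<bar>))"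
    using x by (subst sum.union_disjoint[symmetric]) (auto intro!: sum.cong)
  also have "(\<Sum>y\<in>{..x}. g (nat \<bar>int x - int y\<bar>)) = (\<Sum>y\<in>{..x}. g (x - y))"
    by (intro sum.cong) (auto intro!: arg_cong[where f = g])
  also have "\<dots> = sum g ((\<lambda>y. x - y) ` {..x})"
    by (subst sum.reindex) (auto simp: inj_on_def)
  also have "\<dots> \<le> (\<Sum>j<m. g j)" using g x by (intro sum_mono2) auto
  also have "(\<Sum>y\<in>{x<..<m}. g (nat \<bar>int x - int y\<bar>)) = (\<Sum>y\<in>{x<..<m}. g (y - x))"
    by (intro sum.cong) (auto intro!: arg_cong[where f = g])
  also have "\<dots> = sum g ((\<lambda>y. y - x) ` {x<..<m})"
    by (subst sum.reindex) (auto simp: inj_on_def)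
  also have "\<dots> \<le> (\<Sum>j<m. g j)" using g x by (intro sum_mono2) auto
  finally show ?thesis by simp
qed

text \<open>One coordinate factor of a product Riesz kernel on a grid of mesh 2^(-n). Adding 1 to
  the index difference keeps it finite on the diagonal, and the division by 4 is the slack that lets
  the product over all coordinates dominate the true kernel.\<close>

definition grid_kernel :: "real \<Rightarrow> nat \<Rightarrow> nat \<Rightarrow> nat \<Rightarrow> real" where
  "grid_kernel \<beta> n x y = (real (nat \<bar>int x - int y\<bar> + 1) / 2 ^ n / 4) powr (- \<beta>)"

lemma sum_grid_kernel_le:
  assumes "0 \<le> \<beta>" "\<beta> < 1" "x < 2 ^ n"
  shows "(\<Sum>y<2 ^ n. grid_kernel \<beta> n x y) \<le> 2 * 4 powr \<beta> / (1 - \<beta>) * 2 ^ n"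
proof -
  have "(\<Sum>y<2 ^ n. grid_kernel \<beta> n x y) \<le> 2 * (\<Sum>j<2 ^ n. (real (j + 1) / 2 ^ n / 4) powr (- \<beta>))"
    unfolding grid_kernel_def
    using assms by (intro sum_absdiff_le[where g = "\<lambda>j. (real (j + 1) / 2 ^ n / 4) powr (- \<beta>)"]) auto
  also have "(\<Sum>j<2 ^ n. (real (j + 1) / 2 ^ n / 4) powr (- \<beta>)) = (\<Sum>j<2 ^ n. (4 * 2 ^ n) powr \<beta> * real (j + 1) powr (- \<beta>))"
  proof (intro sum.cong refl)
    fix j :: nat
    have "(real (j + 1) / 2 ^ n / 4) powr (- \<beta>) = (real (j + 1) / (4 * 2 ^ n)) powr (- \<beta>)" by (simp add: mult.commute)
    also have "\<dots> = real (j + 1) powr (- \<beta>) / (4 * 2 ^ n) powr (- \<beta>)" by (rule powr_divide)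
    finally show "(real (j + 1) / 2 ^ n / 4) powr (- \<beta>) = (4 * 2 ^ n) powr \<beta> * real (j + 1) powr (- \<beta>)"
      by (simp only: powr_minus[of "4 * 2 ^ n" \<beta>] divide_inverse inverse_inverse_eq mult.commute)
  qed
  also have "\<dots> = (4 * 2 ^ n) powr \<beta> * (\<Sum>j<2 ^ n. real (j + 1) powr (- \<beta>))"
    by (simp add: sum_distrib_left)
  also have "\<dots> \<le> (4 * 2 ^ n) powr \<beta> * (real (2 ^ n) powr (1 - \<beta>) / (1 - \<beta>))"
    using assms by (intro mult_left_mono sum_powr_le) auto
  also have "2 * \<dots> = 2 * 4 powr \<beta> / (1 - \<beta>) * ((2 ^ n) powr \<beta> * (2 ^ n) powr (1 - \<beta>))"
    by (simp add: powr_mult)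
  also have "(2 ^ n) powr \<beta> * (2 ^ n) powr (1 - \<beta>) = (2 ^ n :: real)"
    by (simp add: powr_add[symmetric])
  finally show ?thesis by simp
qed

definition grid_index :: "nat \<Rightarrow> ('n::finite \<Rightarrow> nat) set" where
  "grid_index n = PiE UNIV (\<lambda>_. {..<2 ^ n})"

text \<open>An index is a pair of a block number and a position inside the block; block m is a grid
  in the cube [L^m, 2 L^m)^N. Correlations of the sheet depend only on ratios of coordinates, which
  is why the blocks are placed multiplicatively.\<close>

definition scaled_grid :: "real \<Rightarrow> nat \<Rightarrow> nat \<times> ('n::finite \<Rightarrow> nat) \<Rightarrow> real^'n" where
  "scaled_grid L n i = (\<chi> k. L ^ fst i * (1 + real (snd i k) / 2 ^ n))"

lemma finite_grid_index: "finite (grid_index n)"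
  unfolding grid_index_def by (intro finite_PiE) auto

lemma card_grid_index: "card (grid_index n :: ('n::finite \<Rightarrow> nat) set) = (2 ^ n) ^ CARD('n)"
  unfolding grid_index_def by (simp add: card_PiE)

lemma grid_index_less: "a \<in> grid_index n \<Longrightarrow> a k < 2 ^ n"
  by (auto simp: grid_index_def PiE_def Pi_def)

text \<open>Because the kernel is a product, the sum splits into N one-dimensional sums, each of the
  order of its number of terms as soon as \<beta> < 1.\<close>

lemma sum_grid_index_kernel_le:
  assumes "0 \<le> \<beta>" "\<beta> < 1" "a \<in> grid_index n"
  shows "(\<Sum>b\<in>grid_index n. \<Prod>k\<in>(UNIV::'n::finite set). grid_kernel \<beta> n (a k) (b k))
    \<le> (2 * 4 powr \<beta> / (1 - \<beta>) * 2 ^ n) ^ CARD('n)"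
proof -
  have "(\<Sum>b\<in>grid_index n. \<Prod>k\<in>(UNIV::'n set). grid_kernel \<beta> n (a k) (b k))
      = (\<Prod>k\<in>(UNIV::'n set). \<Sum>y<2 ^ n. grid_kernel \<beta> n (a k) y)"
    unfolding grid_index_def by (subst prod_sum_PiE) auto
  also have "\<dots> \<le> (\<Prod>k\<in>(UNIV::'n set). 2 * 4 powr \<beta> / (1 - \<beta>) * 2 ^ n)"
    using assms sum_grid_kernel_le[OF assms(1,2) grid_index_less[OF assms(3)]]
    by (intro prod_mono) (auto intro!: sum_nonneg simp: grid_kernel_def)
  finally show ?thesis by simp
qed

text \<open>The squared correlation is the product over all coordinates of the smaller value divided
  by the larger. All factors are at most 1, so the ratio in a single coordinate suffices.\<close>

lemma sheet_cov_square_le: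
  fixes s t :: "real^'n"
  assumes s: "s \<in> pos_orthant" and t: "t \<in> pos_orthant" and q: "s $ k \<le> q * t $ k \<or> t $ k \<le> q * s $ k"
  shows "(sheet_cov s t)\<^sup>2 \<le> q * (sheet_cov s s * sheet_cov t t)"
proof -
  have pos: "0 < s $ l" "0 < t $ l" for l using s t by (auto simp: pos_orthant_def)
  have k: "(min (s $ k) (t $ k))\<^sup>2 \<le> q * (s $ k * t $ k)"
    using q
  proof
    assume "s $ k \<le> q * t $ k"
    then have "s $ k * s $ k \<le> q * t $ k * s $ k" using pos by (intro mult_right_mono) (auto intro: less_imp_le)
    moreover have "(min (s $ k) (t $ k))\<^sup>2 \<le> s $ k * s $ k"
      using pos[of k] unfolding power2_eq_square by (intro mult_mono) auto
    ultimately show ?thesis by (simp add: ac_simps)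
  next
    assume "t $ k \<le> q * s $ k"
    then have "t $ k * t $ k \<le> q * s $ k * t $ k" using pos by (intro mult_right_mono) (auto intro: less_imp_le)
    moreover have "(min (s $ k) (t $ k))\<^sup>2 \<le> t $ k * t $ k"
      using pos[of k] unfolding power2_eq_square by (intro mult_mono) auto
    ultimately show ?thesis by (simp add: ac_simps)
  qed
  have rest: "(\<Prod>l\<in>UNIV - {k}. (min (s $ l) (t $ l))\<^sup>2) \<le> (\<Prod>l\<in>UNIV - {k}. s $ l * t $ l)"
    using pos unfolding power2_eq_square by (intro prod_mono conjI mult_mono) (auto simp: less_imp_le)
  have "(sheet_cov s t)\<^sup>2 = (min (s $ k) (t $ k))\<^sup>2 * (\<Prod>l\<in>UNIV - {k}. (min (s $ l) (t $ l))\<^sup>2)"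
    unfolding sheet_cov_def prod_power_distrib by (subst prod.remove[of UNIV k]) auto
  also have "\<dots> \<le> (q * (s $ k * t $ k)) * (\<Prod>l\<in>UNIV - {k}. s $ l * t $ l)"
    using k rest pos by (intro mult_mono) (auto intro!: prod_nonneg order_trans[OF _ k])
  also have "\<dots> = q * (\<Prod>l\<in>UNIV. s $ l * t $ l)"
    by (subst prod.remove[of UNIV k "\<lambda>l. s $ l * t $ l"]) (auto simp: mult.assoc)
  also have "(\<Prod>l\<in>UNIV. s $ l * t $ l) = sheet_cov s s * sheet_cov t t"
    by (simp add: sheet_cov_def prod.distrib)
  finally show ?thesis .
qed

lemma scaled_grid_bounds:
  assumes "1 \<le> L" "i \<in> {..<b} \<times> grid_index n"
  shows "L ^ fst i \<le> scaled_grid L n i $ k" "scaled_grid L n i $ k < 2 * L ^ fst i" "scaled_grid L n i \<in> pos_orthant"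
    "1 \<le> scaled_grid L n i $ k" "scaled_grid L n i $ k \<le> 2 * L ^ b"
proof -
  have L: "0 < L ^ fst i" "1 \<le> L ^ fst i" using assms(1) by auto
  have u: "0 \<le> real (snd i l) / 2 ^ n" "real (snd i l) / 2 ^ n < 1" for l
    using assms(2) grid_index_less[of "snd i" n l] by (auto simp: mem_Times_iff divide_less_eq)
  have 1: "L ^ fst i \<le> scaled_grid L n i $ l" for l
    using mult_left_mono[of 1 "1 + real (snd i l) / 2 ^ n" "L ^ fst i"] L u[of l] by (simp add: scaled_grid_def)
  have 2: "scaled_grid L n i $ l < 2 * L ^ fst i" for l
    using mult_strict_left_mono[of "1 + real (snd i l) / 2 ^ n" 2 "L ^ fst i"] L u[of l] by (simp add: scaled_grid_def mult.commute)
  have "L ^ fst i \<le> L ^ b" using assms by (intro power_increasing) (auto simp: mem_Times_iff)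
  then show "scaled_grid L n i $ k \<le> 2 * L ^ b" using 2[of k] by linarith
  have "0 < scaled_grid L n i $ l" for l using 1[of l] L by linarith
  then show "scaled_grid L n i \<in> pos_orthant" by (simp add: pos_orthant_def)
  show "1 \<le> scaled_grid L n i $ k" using 1[of k] L by linarith
  show "L ^ fst i \<le> scaled_grid L n i $ k" "scaled_grid L n i $ k < 2 * L ^ fst i"
    using 1 2 by auto
qed

section \<open>Moments of the random weights on the scaled grids\<close>

context brownian
begin

text \<open>The parameter 2^n matches the mesh, since over a distance 2^(-n) the sheet moves by
  about 2^(-n/2). The denominator is the number of grid points times the mean of the bump, so the
  weights add up to 1 in expectation.\<close>

definition grid_weight :: "real \<Rightarrow> nat \<Rightarrow> nat \<Rightarrow> nat \<times> ('n \<Rightarrow> nat) \<Rightarrow> 'w \<Rightarrow> real" where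
  "grid_weight L b n i \<omega> = bump (2 ^ n) (scaled_grid L n i) \<omega> /
     (real b * (2 ^ n) ^ CARD('n) * expectation (bump (2 ^ n) (scaled_grid L n i)))"

lemma bump_integrable: "t \<in> pos_orthant \<Longrightarrow> 0 \<le> \<theta> \<Longrightarrow> integrable M (bump \<theta> t)"
  using measurable_bump[of t \<theta>] bump_pos bump_le_1
  by (intro integrable_const_bound[where B = 1] AE_I2) (auto simp: abs_of_pos)

lemma bump_pair_integrable:
  "s \<in> pos_orthant \<Longrightarrow> t \<in> pos_orthant \<Longrightarrow> 0 \<le> \<theta> \<Longrightarrow> integrable M (\<lambda>\<omega>. bump \<theta> s \<omega> * bump \<theta> t \<omega>)"
  using measurable_bump[of t \<theta>] measurable_bump[of s \<theta>] bump_pos bump_le_1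
  by (intro integrable_const_bound[where B = 1] AE_I2)
     (auto simp: abs_mult abs_of_pos intro!: mult_le_one less_imp_le[OF bump_pos])

lemma expectation_bump_pos:
  assumes "t \<in> pos_orthant" "0 \<le> \<theta>"
  shows "0 < expectation (bump \<theta> t)"
proof -
  have "0 \<le> \<theta> * sheet_cov t t"
    using sheet_cov_bounds[OF assms(1)] assms(2) by simp
  then show ?thesis using assms by (simp add: expectation_bump)
qed

lemma grid_weight_nonneg: "1 \<le> L \<Longrightarrow> i \<in> {..<b} \<times> grid_index n \<Longrightarrow> 0 \<le> grid_weight L b n i \<omega>"
  unfolding grid_weight_def
  using expectation_bump_pos[OF scaled_grid_bounds(3), of L i b n "2 ^ n"] bump_pos[of "2 ^ n" "scaled_grid L n i" \<omega>]
  by (auto intro!: divide_nonneg_nonneg mult_nonneg_nonneg less_imp_le)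

text \<open>The mean of a bump is of the order of the probability that W has size 2^(-n/2), which is
  2^(-n d/2). The position of the point influences only the constant, since all coordinates are at
  most 2 L^b.\<close>

lemma inverse_expectation_bump_le:
  fixes n b :: nat and i :: "nat \<times> ('n \<Rightarrow> nat)"
  assumes L: "1 \<le> L" and i: "i \<in> {..<b} \<times> grid_index n"
  shows "1 / expectation (bump (2 ^ n) (scaled_grid L n i))
    \<le> (2 * (2 * L ^ b) ^ CARD('n)) powr (real CARD('d) / 2) * 2 powr (real n * (real CARD('d) / 2))"
proof -
  let ?p = "scaled_grid L n i"
  let ?X = "(2 * L ^ b) ^ CARD('n)"
  note B = scaled_grid_bounds[OF L i]
  have c: "sheet_cov ?p ?p = (\<Prod>k\<in>UNIV. ?p $ k)" "0 < sheet_cov ?p ?p" using sheet_cov_bounds[OF B(3)] by auto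
  have "(\<Prod>k\<in>UNIV. ?p $ k) \<le> (\<Prod>k\<in>(UNIV::'n set). 2 * L ^ b)"
    using B by (intro prod_mono conjI) (auto intro: order_trans[OF zero_le_one])
  then have cX: "sheet_cov ?p ?p \<le> ?X" using c by simp
  have "1 \<le> L ^ b" using L by simp
  then have X1: "1 \<le> ?X" by (intro one_le_power) simp
  have "1 / expectation (bump (2 ^ n) ?p) = (1 + 2 ^ n * sheet_cov ?p ?p) powr (real CARD('d) / 2)"
    using c by (simp add: expectation_bump[OF B(3)] powr_minus_divide)
  also have "\<dots> \<le> (2 * 2 ^ n * ?X) powr (real CARD('d) / 2)"
  proof (rule powr_mono2)
    have "1 * 1 \<le> 2 ^ n * ?X" using X1 by (intro mult_mono) auto
    moreover have "2 ^ n * sheet_cov ?p ?p \<le> 2 ^ n * ?X" using cX by simp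
    ultimately show "1 + 2 ^ n * sheet_cov ?p ?p \<le> 2 * 2 ^ n * ?X" by linarith
  qed (use c in auto)
  also have "2 * 2 ^ n * ?X = (2 * ?X) * 2 powr real n" by (simp add: powr_realpow)
  also have "\<dots> powr (real CARD('d) / 2) = (2 * ?X) powr (real CARD('d) / 2) * 2 powr (real n * (real CARD('d) / 2))"
    by (simp add: powr_mult powr_powr)
  finally show ?thesis .
qed

lemma expectation_grid_weight:
  assumes "1 \<le> L" "i \<in> {..<b} \<times> grid_index n" "1 \<le> b"
  shows "expectation (grid_weight L b n i) = 1 / (real b * (2 ^ n) ^ CARD('n))"
  unfolding grid_weight_def[abs_def]
  using expectation_bump_pos[OF scaled_grid_bounds(3)[OF assms(1,2)], of "2 ^ n"] by simp

lemma grid_weight_pair_integrable: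
  assumes "1 \<le> L" "i \<in> {..<b} \<times> grid_index n" "l \<in> {..<b} \<times> grid_index n"
  shows "integrable M (\<lambda>\<omega>. grid_weight L b n i \<omega> * grid_weight L b n l \<omega>)"
  using bump_pair_integrable[OF scaled_grid_bounds(3)[OF assms(1,2)] scaled_grid_bounds(3)[OF assms(1,3)], of "2 ^ n"]
  unfolding grid_weight_def by simp

lemma expectation_grid_weight_pair:
  fixes i l :: "nat \<times> ('n \<Rightarrow> nat)"
  assumes L: "1 \<le> L" and i: "i \<in> {..<b} \<times> grid_index n" and l: "l \<in> {..<b} \<times> grid_index n"
    and b: "1 \<le> b"
    and q: "scaled_grid L n i $ k \<le> q * scaled_grid L n l $ k \<or> scaled_grid L n l $ k \<le> q * scaled_grid L n i $ k"
      "0 \<le> q" "q < 1"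
  shows "expectation (\<lambda>\<omega>. grid_weight L b n i \<omega> * grid_weight L b n l \<omega>)
    \<le> (1 - q) powr (- real CARD('d) / 2) / (real b * (2 ^ n) ^ CARD('n))\<^sup>2"
proof -
  let ?p = "scaled_grid L n i" and ?p' = "scaled_grid L n l" and ?c = "real b * (2 ^ n) ^ CARD('n)"
  note B = scaled_grid_bounds(3)[OF L i] scaled_grid_bounds(3)[OF L l]
  let ?e = "expectation (bump (2 ^ n) ?p)" and ?e' = "expectation (bump (2 ^ n) ?p')"
  have e: "0 < ?e" "0 < ?e'" using B by (auto intro!: expectation_bump_pos)
  have c: "0 < ?c" using b by simp
  have "expectation (\<lambda>\<omega>. grid_weight L b n i \<omega> * grid_weight L b n l \<omega>)
     = expectation (\<lambda>\<omega>. bump (2 ^ n) ?p \<omega> * bump (2 ^ n) ?p' \<omega>) / (?c\<^sup>2 * (?e * ?e'))"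
    unfolding grid_weight_def by (simp add: power2_eq_square ac_simps)
  also have "\<dots> \<le> ((1 - q) powr (- real CARD('d) / 2) * (?e * ?e')) / (?c\<^sup>2 * (?e * ?e'))"
    using sheet_cov_square_le[OF B q(1)] q e c
    by (intro divide_right_mono expectation_bump_pair_le B) auto
  also have "\<dots> = (1 - q) powr (- real CARD('d) / 2) / ?c\<^sup>2" using e by simp
  finally show ?thesis .
qed

lemma expectation_grid_weight_square:
  fixes i :: "nat \<times> ('n \<Rightarrow> nat)"
  assumes L: "1 \<le> L" and i: "i \<in> {..<b} \<times> grid_index n" and b: "1 \<le> b"
  shows "expectation (\<lambda>\<omega>. grid_weight L b n i \<omega> * grid_weight L b n i \<omega>)
    \<le> (2 * (2 * L ^ b) ^ CARD('n)) powr (real CARD('d) / 2) * 2 powr (real n * (real CARD('d) / 2)) / (real b * (2 ^ n) ^ CARD('n))\<^sup>2"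
proof -
  let ?p = "scaled_grid L n i" and ?c = "real b * (2 ^ n) ^ CARD('n)"
  note B = scaled_grid_bounds(3)[OF L i]
  let ?e = "expectation (bump (2 ^ n) ?p)"
  have e: "0 < ?e" using B by (auto intro!: expectation_bump_pos)
  have c: "0 < ?c" using b by simp
  have "expectation (\<lambda>\<omega>. grid_weight L b n i \<omega> * grid_weight L b n i \<omega>)
     = expectation (\<lambda>\<omega>. bump (2 ^ n) ?p \<omega> * bump (2 ^ n) ?p \<omega>) / (?c\<^sup>2 * (?e * ?e))"
    unfolding grid_weight_def by (simp add: power2_eq_square ac_simps)
  also have "\<dots> \<le> ?e / (?c\<^sup>2 * (?e * ?e))"
  proof (intro divide_right_mono integral_mono bump_pair_integrable bump_integrable B)
    show "bump (2 ^ n) ?p \<omega> * bump (2 ^ n) ?p \<omega> \<le> bump (2 ^ n) ?p \<omega>" for \<omega>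
      using mult_left_le[OF bump_le_1[of "2 ^ n" ?p \<omega>] less_imp_le[OF bump_pos]] by simp
  qed (use e in auto)
  also have "\<dots> = (1 / ?e) / ?c\<^sup>2" using e by simp
  also have "\<dots> \<le> (2 * (2 * L ^ b) ^ CARD('n)) powr (real CARD('d) / 2) * 2 powr (real n * (real CARD('d) / 2)) / ?c\<^sup>2"
    using inverse_expectation_bump_le[OF L i] by (intro divide_right_mono) auto
  finally show ?thesis .
qed

text \<open>Distinct blocks are nearly uncorrelated because their scales differ by a factor L; inside a block
  the product kernel dominates both the correlation factor and the Riesz kernel.\<close>
lemma grid_pair_energy_le:
  fixes i l :: "nat \<times> ('n \<Rightarrow> nat)" and s :: real
  defines "\<beta> \<equiv> (s + real CARD('d) / 2) / real CARD('n)"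
  assumes L: "4 \<le> L" and i: "i \<in> {..<b} \<times> grid_index n" and l: "l \<in> {..<b} \<times> grid_index n"
    and b: "1 \<le> b" and s: "0 \<le> s"
  shows "expectation (\<lambda>\<omega>. grid_weight L b n i \<omega> * grid_weight L b n l \<omega>) *
      (dist (scaled_grid L n i) (scaled_grid L n l) + 1 / 2 ^ n) powr (- s)
    \<le> ((1 - 2 / L) powr (- real CARD('d) / 2)
       + (if fst i = fst l then \<Prod>k\<in>UNIV. grid_kernel \<beta> n (snd i k) (snd l k) else 0)
       + (if i = l then (2 * (2 * L ^ b) ^ CARD('n)) powr (real CARD('d) / 2) * 2 powr (real n * (real CARD('d) / 2 + s)) else 0))
      / (real b * (2 ^ n) ^ CARD('n))\<^sup>2"
    (is "?E * ?k \<le> (?R + ?S + ?D) / ?c\<^sup>2")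
proof -
  let ?p = "scaled_grid L n i" and ?p' = "scaled_grid L n l"
  have L1: "1 \<le> L" using L by simp
  note Bi = scaled_grid_bounds[OF L1 i] and Bl = scaled_grid_bounds[OF L1 l]
  have c: "0 < ?c\<^sup>2" using b by simp
  have R0: "0 \<le> ?R" by simp
  have S0: "0 \<le> ?S" by (auto simp: grid_kernel_def intro!: prod_nonneg)
  have D0: "0 \<le> ?D" by simp
  have k0: "0 \<le> ?k" by simp
  consider "i = l" | "fst i = fst l" "i \<noteq> l" | "fst i \<noteq> fst l" by blast
  then show ?thesis
  proof cases
    case 1
    have k: "?k = 2 powr (real n * s)"
      using 1 by (simp add: powr_realpow[symmetric] powr_powr powr_minus_divide[symmetric] powr_divide)
    have "?E * ?k \<le> (2 * (2 * L ^ b) ^ CARD('n)) powr (real CARD('d) / 2) * 2 powr (real n * (real CARD('d) / 2)) / ?c\<^sup>2 * ?k"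
      using 1 expectation_grid_weight_square[OF L1 i b] k0 by (intro mult_right_mono) auto
    also have "\<dots> = ?D / ?c\<^sup>2" unfolding k using 1 by (simp add: powr_add algebra_simps)
    also have "\<dots> \<le> (?R + ?S + ?D) / ?c\<^sup>2" using R0 S0 c by (intro divide_right_mono) auto
    finally show ?thesis .
  next
    case 2
    define x where "x = (\<lambda>k. nat \<bar>int (snd i k) - int (snd l k)\<bar>)"
    have xr: "real (x k) = \<bar>real (snd i k) - real (snd l k)\<bar>" for k by (simp add: x_def)
    have "snd i \<noteq> snd l" using 2 by (metis prod.collapse)
    then obtain k1 where k1: "snd i k1 \<noteq> snd l k1" by auto
    have "Max (range x) \<in> range x" by (intro Max_in) auto
    \<comment> \<open>The coordinate with the largest index difference serves twice: its ratio
      controls the correlation and its gap controls the distance.\<close>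
    then obtain k0 where "x k0 = Max (range x)" by (metis rangeE)
    then have k0m: "x k \<le> x k0" for k by simp
    have "1 \<le> x k1" using k1 by (simp add: x_def)
    then have xk0: "1 \<le> x k0" using k0m[of k1] by simp
    define y where "y = real (x k0) / 2 ^ n / 2"
    have y0: "0 < y" using xk0 by (simp add: y_def)
    have "snd i k0 < 2 ^ n" "snd l k0 < 2 ^ n"
      using grid_index_less[of "snd i" n k0] grid_index_less[of "snd l" n k0] i l by (auto simp: mem_Times_iff)
    then have "real (snd i k0) < 2 ^ n" "real (snd l k0) < 2 ^ n"
      by (metis of_nat_less_iff of_nat_numeral of_nat_power)+
    then have "real (x k0) < 2 ^ n" unfolding xr by linarith
    then have "real (x k0) / 2 ^ n < 1" by (subst divide_less_eq_1_pos) auto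
    moreover have "z / 2 \<le> 1" if "z < 1" for z :: real using that by simp
    ultimately have y1: "y \<le> 1" unfolding y_def by blast
    define A where "A = L ^ fst i"
    have A: "1 \<le> A" using L1 by (simp add: A_def)
    have pk: "?p $ k0 = A * (1 + real (snd i k0) / 2 ^ n)" "?p' $ k0 = A * (1 + real (snd l k0) / 2 ^ n)"
      using 2 by (auto simp: scaled_grid_def A_def)
    have diff: "\<bar>?p $ k0 - ?p' $ k0\<bar> = A * (2 * y)"
    proof -
      have "?p $ k0 - ?p' $ k0 = A * ((real (snd i k0) - real (snd l k0)) / 2 ^ n)"
        by (simp add: pk algebra_simps diff_divide_distrib)
      then show ?thesis using A by (simp add: abs_mult y_def xr)
    qed
    \<comment> \<open>The larger value is at most \<open>2 * A\<close>, so a gap of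
      \<open>A * (2 * y)\<close> is at least the fraction \<open>y\<close> of it.\<close>
    have key: "a \<le> (1 - y) * a'" if "a' - a = A * (2 * y)" "a' \<le> 2 * A" for a a' :: real
    proof -
      have "a' * y \<le> 2 * A * y" using that y0 by (intro mult_right_mono) auto
      then show ?thesis using that(1) by (simp add: algebra_simps)
    qed
    have q: "?p $ k0 \<le> (1 - y) * ?p' $ k0 \<or> ?p' $ k0 \<le> (1 - y) * ?p $ k0"
    proof (cases "?p $ k0 \<le> ?p' $ k0")
      case True
      then show ?thesis using diff Bl(2)[of k0] 2 by (intro disjI1 key) (auto simp: A_def)
    next
      case False
      then show ?thesis using diff Bi(2)[of k0] by (intro disjI2 key) (auto simp: A_def)
    qed
    have "?E \<le> (1 - (1 - y)) powr (- real CARD('d) / 2) / ?c\<^sup>2"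
      using q y0 y1 by (intro expectation_grid_weight_pair[OF L1 i l b]) auto
    then have E: "?E \<le> y powr (- real CARD('d) / 2) / ?c\<^sup>2" by simp
    have "y \<le> A * (2 * y)" using A y0 mult_right_mono[of 1 A "2 * y"] by simp
    also have "\<dots> \<le> norm (?p - ?p')" using diff component_le_norm_cart[of "?p - ?p'" k0] by simp
    finally have "y \<le> dist ?p ?p' + 1 / 2 ^ n" by (simp add: dist_norm add_increasing2)
    then have K: "?k \<le> y powr (- s)" using y0 s by (intro powr_mono2') auto
    have "?E * ?k \<le> y powr (- real CARD('d) / 2) / ?c\<^sup>2 * y powr (- s)"
      using E K k0 by (intro mult_mono) auto
    also have "\<dots> = y powr (- (s + real CARD('d) / 2)) / ?c\<^sup>2"
    proof -
      have "- (s + real CARD('d) / 2) = - real CARD('d) / 2 + - s" by simp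
      then have "y powr (- (s + real CARD('d) / 2)) = y powr (- real CARD('d) / 2) * y powr (- s)"
        by (simp only: powr_add)
      then show ?thesis by simp
    qed
    \<comment> \<open>The exponent d/2 of the correlation factor and the exponent s of the Riesz
      kernel add up and are shared equally by the N coordinates. This is the origin of
      \<open>\<beta>\<close>, which is below 1 exactly when s < N - d/2.\<close>
    also have "y powr (- (s + real CARD('d) / 2)) = (y powr (- \<beta>)) ^ CARD('n)"
    proof -
      have "(y powr (- \<beta>)) ^ CARD('n) = (y powr (- \<beta>)) powr (real CARD('n))"
        using y0 by (simp add: powr_realpow)
      also have "\<dots> = y powr (- \<beta> * real CARD('n))" by (simp add: powr_powr)
      also have "- \<beta> * real CARD('n) = - (s + real CARD('d) / 2)" by (simp add: \<beta>_def)
      finally show ?thesis by simp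
    qed
    also have "\<dots> = (\<Prod>k\<in>(UNIV::'n set). y powr (- \<beta>))" by simp
    also have "\<dots> \<le> (\<Prod>k\<in>(UNIV::'n set). grid_kernel \<beta> n (snd i k) (snd l k))"
    proof (intro prod_mono conjI)
      fix k
      \<comment> \<open>The two halves of the 4 in \<open>grid_kernel\<close>: a factor 2 for the
        added 1, using that \<open>x k0\<close> is positive, and a factor 2 already present in
        \<open>y\<close>.\<close>
      have "real (x k + 1) \<le> 2 * real (x k0)" using k0m[of k] xk0 by linarith
      then have "real (x k + 1) / 2 ^ n / 4 \<le> 2 * real (x k0) / 2 ^ n / 4" by (intro divide_right_mono) auto
      also have "\<dots> = y" by (simp add: y_def)
      finally have "real (x k + 1) / 2 ^ n / 4 \<le> y" .
      moreover have "0 \<le> \<beta>" using s by (simp add: \<beta>_def)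
      ultimately have "y powr (- \<beta>) \<le> (real (x k + 1) / 2 ^ n / 4) powr (- \<beta>)"
        by (intro powr_mono2') simp_all
      then show "y powr (- \<beta>) \<le> grid_kernel \<beta> n (snd i k) (snd l k)"
        by (simp only: grid_kernel_def x_def)
    qed auto
    also have "\<dots> = ?S" using 2 by simp
    also have "?S / ?c\<^sup>2 \<le> (?R + ?S + ?D) / ?c\<^sup>2" using R0 D0 c by (intro divide_right_mono) auto
    finally show ?thesis using c by (simp add: divide_right_mono)
  next
    case 3
    fix k0 :: 'n
    \<comment> \<open>Passing to a higher block multiplies the lower end by at least L, while a
      block spans only a factor 2. With L at least 4 the blocks are also at distance at least 1, so
      the Riesz kernel between them is at most 1.\<close>
    have key: "a \<le> 2 / L * a' \<and> 1 \<le> a' - a" if "m < m'" "a < 2 * L ^ m" "L ^ m' \<le> a'" for a a' :: real and m m' :: nat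
    proof -
      have "L ^ Suc m \<le> L ^ m'" using that(1) L1 by (intro power_increasing) auto
      then have "L * L ^ m \<le> a'" using that(3) by simp
      moreover have "4 * L ^ m \<le> L * L ^ m" using L by (intro mult_right_mono) auto
      moreover have "1 \<le> L ^ m" using L1 by simp
      moreover have "2 * L ^ m = 2 / L * (L * L ^ m)" using L by simp
      moreover have "2 / L * (L * L ^ m) \<le> 2 / L * a'" using \<open>L * L ^ m \<le> a'\<close> L by (intro mult_left_mono) auto
      ultimately show ?thesis using that(2) by linarith
    qed
    have q: "(?p $ k0 \<le> 2 / L * ?p' $ k0 \<or> ?p' $ k0 \<le> 2 / L * ?p $ k0) \<and> 1 \<le> \<bar>?p $ k0 - ?p' $ k0\<bar>"
    proof (cases "fst i < fst l")
      case True
      then show ?thesis using key[OF True Bi(2)[of k0] Bl(1)[of k0]] by auto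
    next
      case False
      then have "fst l < fst i" using 3 by simp
      then show ?thesis using key[OF _ Bl(2)[of k0] Bi(1)[of k0]] by auto
    qed
    have E: "?E \<le> ?R / ?c\<^sup>2"
      using q L by (intro expectation_grid_weight_pair[OF L1 i l b]) auto
    have "1 \<le> norm (?p - ?p')" using q component_le_norm_cart[of "?p - ?p'" k0] by simp
    then have "1 \<le> dist ?p ?p' + 1 / 2 ^ n" by (simp add: dist_norm add_increasing2)
    then have "?k \<le> 1 powr (- s)" using s by (intro powr_mono2') auto
    then have "?E * ?k \<le> ?R / ?c\<^sup>2 * 1" using E k0 by (intro mult_mono) auto
    also have "\<dots> \<le> (?R + ?S + ?D) / ?c\<^sup>2" using S0 D0 c by (simp add: divide_right_mono)
    finally show ?thesis .
  qed
qed

text \<open>The three terms come from pairs in different blocks, pairs of distinct points in one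
  block, and the diagonal. The first tends to 1 as L grows; the second carries 1/b because only this
  fraction of all pairs shares a block; the third decays in n since s < N - d/2. For s = 0 the
  energy is the second moment of the total mass.\<close>

lemma grid_energy_le:
  fixes s :: real and n b :: nat
  defines "\<beta> \<equiv> (s + real CARD('d) / 2) / real CARD('n)"
  defines "I \<equiv> {..<b} \<times> (grid_index n :: ('n \<Rightarrow> nat) set)"
  assumes L: "4 \<le> L" and b: "1 \<le> b" and s: "0 \<le> s" "s < real CARD('n) - real CARD('d) / 2"
  shows "expectation (\<lambda>\<omega>. \<Sum>i\<in>I. \<Sum>l\<in>I. grid_weight L b n i \<omega> * grid_weight L b n l \<omega> *
      (dist (scaled_grid L n i) (scaled_grid L n l) + 1 / 2 ^ n) powr (- s))
    \<le> (1 - 2 / L) powr (- real CARD('d) / 2) + (2 * 4 powr \<beta> / (1 - \<beta>)) ^ CARD('n) / real b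
      + (2 * (2 * L ^ b) ^ CARD('n)) powr (real CARD('d) / 2) * 2 powr (- (real n * (real CARD('n) - real CARD('d) / 2 - s)))"
proof -
  let ?N = "(2 ^ n) ^ CARD('n) :: real"
  let ?R = "(1 - 2 / L) powr (- real CARD('d) / 2)" and ?c = "real b * ?N"
  let ?D = "(2 * (2 * L ^ b) ^ CARD('n)) powr (real CARD('d) / 2) * 2 powr (real n * (real CARD('d) / 2 + s))"
  let ?C = "(2 * 4 powr \<beta> / (1 - \<beta>)) ^ CARD('n)"
  let ?S = "\<lambda>i l. if fst i = fst l then \<Prod>k\<in>UNIV. grid_kernel \<beta> n (snd i k) (snd l k) else 0"
  let ?k = "\<lambda>i l. (dist (scaled_grid L n i) (scaled_grid L n l :: real^'n) + 1 / 2 ^ n) powr (- s)"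
  have L1: "1 \<le> L" using L by simp
  have finI: "finite I" by (simp add: I_def finite_grid_index)
  have cardI: "real (card I) = ?c" by (simp add: I_def card_cartesian_product card_grid_index)
  have c: "0 < ?c" using b by simp
  have \<beta>: "0 \<le> \<beta>" "\<beta> < 1" using s by (auto simp: \<beta>_def)
  have int: "integrable M (\<lambda>\<omega>. grid_weight L b n i \<omega> * grid_weight L b n l \<omega> * ?k i l)" if "i \<in> I" "l \<in> I" for i l
    using grid_weight_pair_integrable[OF L1] that by (auto simp: I_def)
  have "expectation (\<lambda>\<omega>. \<Sum>i\<in>I. \<Sum>l\<in>I. grid_weight L b n i \<omega> * grid_weight L b n l \<omega> * ?k i l)
      = (\<Sum>i\<in>I. \<Sum>l\<in>I. expectation (\<lambda>\<omega>. grid_weight L b n i \<omega> * grid_weight L b n l \<omega>) * ?k i l)"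
    using int by (simp add: Bochner_Integration.integral_sum)
  also have "\<dots> \<le> (\<Sum>i\<in>I. \<Sum>l\<in>I. (?R + ?S i l + (if i = l then ?D else 0)) / ?c\<^sup>2)"
    unfolding \<beta>_def using L b s by (intro sum_mono grid_pair_energy_le) (auto simp: I_def)
  also have "\<dots> \<le> (\<Sum>i\<in>I. (?c * ?R + ?C * ?N + ?D) / ?c\<^sup>2)"
  proof (rule sum_mono)
    fix i assume i: "i \<in> I"
    have "(\<Sum>l\<in>I. ?S i l) = (\<Sum>m<b. \<Sum>a\<in>grid_index n. ?S i (m, a))"
      unfolding I_def by (simp add: sum.cartesian_product split_beta' cong: if_cong)
    also have "\<dots> = (\<Sum>m<b. if m = fst i then \<Sum>a\<in>grid_index n. \<Prod>k\<in>UNIV. grid_kernel \<beta> n (snd i k) (a k) else 0)"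
      by (intro sum.cong) auto
    also have "\<dots> = (\<Sum>a\<in>grid_index n. \<Prod>k\<in>UNIV. grid_kernel \<beta> n (snd i k) (a k))"
      using i by (simp add: I_def mem_Times_iff)
    also have "\<dots> \<le> (2 * 4 powr \<beta> / (1 - \<beta>) * 2 ^ n) ^ CARD('n)"
      using i \<beta> by (intro sum_grid_index_kernel_le) (auto simp: I_def mem_Times_iff)
    also have "\<dots> = ?C * ?N" by (rule power_mult_distrib)
    finally have S: "(\<Sum>l\<in>I. ?S i l) \<le> ?C * ?N" .
    have "(\<Sum>l\<in>I. (?R + ?S i l + (if i = l then ?D else 0)) / ?c\<^sup>2)
       = (?c * ?R + (\<Sum>l\<in>I. ?S i l) + (\<Sum>l\<in>I. if i = l then ?D else 0)) / ?c\<^sup>2"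
      unfolding sum_divide_distrib[symmetric] sum.distrib using cardI by simp
    also have "(\<Sum>l\<in>I. if i = l then ?D else 0) = ?D" using finI i by simp
    also have "(?c * ?R + (\<Sum>l\<in>I. ?S i l) + ?D) / ?c\<^sup>2 \<le> (?c * ?R + ?C * ?N + ?D) / ?c\<^sup>2"
      using S by (intro divide_right_mono) auto
    finally show "(\<Sum>l\<in>I. (?R + ?S i l + (if i = l then ?D else 0)) / ?c\<^sup>2) \<le> (?c * ?R + ?C * ?N + ?D) / ?c\<^sup>2" .
  qed
  also have "\<dots> = ?c * ((?c * ?R + ?C * ?N + ?D) / ?c\<^sup>2)" using cardI by simp
  also have "\<dots> = ?R + ?C / real b + ?D / ?c"
  proof -
    have gen: "(x * y) * (((x * y) * r + c * y + d) / (x * y)\<^sup>2) = r + c / x + d / (x * y)"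
      if "x \<noteq> 0" "y \<noteq> 0" for x y r c d :: real
      using that by (simp add: power2_eq_square field_simps)
    show ?thesis by (rule gen) (use b in auto)
  qed
  also have "?D / ?c \<le> ?D / ?N"
    using b mult_right_mono[of 1 "real b" ?N] by (intro divide_left_mono mult_pos_pos) auto
  also have "?D / ?N = (2 * (2 * L ^ b) ^ CARD('n)) powr (real CARD('d) / 2) * 2 powr (- (real n * (real CARD('n) - real CARD('d) / 2 - s)))"
  proof -
    have N: "?N = 2 powr (real n * real CARD('n))" by (simp add: powr_realpow[symmetric] powr_powr)
    have "2 powr (real n * (real CARD('d) / 2 + s)) / ?N = 2 powr (- (real n * (real CARD('n) - real CARD('d) / 2 - s)))"
      unfolding N powr_diff[symmetric] by (simp add: algebra_simps)
    then show ?thesis by (simp only: times_divide_eq_right[symmetric])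
  qed
  finally show ?thesis by simp
qed

lemma continuous_AE: "AE \<omega> in M. continuous_on pos_orthant (W \<omega>)"
  using sheet by (simp add: brownian_sheet_def)

lemma grid_weight_measurable:
  assumes "1 \<le> L" "i \<in> {..<b} \<times> grid_index n"
  shows "grid_weight L b n i \<in> borel_measurable M"
  unfolding grid_weight_def[abs_def]
  by (intro borel_measurable_divide borel_measurable_const measurable_bump scaled_grid_bounds(3)[OF assms])

text \<open>The total mass has mean 1, so the energy estimate with s = 0 bounds its variance by
  \<open>v\<close>. Chebyshev's inequality at distance 1/2 produces the factor 4.\<close>

lemma grid_mass_concentrates:
  fixes n b :: nat and L :: real
  defines "I \<equiv> {..<b} \<times> (grid_index n :: ('n \<Rightarrow> nat) set)"
  defines "Y \<equiv> \<lambda>\<omega>. \<Sum>i\<in>I. grid_weight L b n i \<omega>"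
  assumes L: "4 \<le> L" and b: "1 \<le> b" and al: "real CARD('d) / 2 < real CARD('n)"
    and v: "(1 - 2 / L) powr (- real CARD('d) / 2) + (2 * 4 powr (real CARD('d) / 2 / real CARD('n)) / (1 - real CARD('d) / 2 / real CARD('n))) ^ CARD('n) / real b
      + (2 * (2 * L ^ b) ^ CARD('n)) powr (real CARD('d) / 2) * 2 powr (- (real n * (real CARD('n) - real CARD('d) / 2))) \<le> 1 + v"
  shows "prob {\<omega>\<in>space M. Y \<omega> < 1 / 2} \<le> 4 * v"
proof -
  have L1: "1 \<le> L" using L by simp
  have finI: "finite I" by (simp add: I_def finite_grid_index)
  have Ym: "Y \<in> borel_measurable M"
    unfolding Y_def using grid_weight_measurable[OF L1] by (intro borel_measurable_sum) (auto simp: I_def)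
  have int: "integrable M (grid_weight L b n i)" if "i \<in> I" for i
    unfolding grid_weight_def[abs_def] using that
    by (intro integrable_divide bump_integrable scaled_grid_bounds(3)[OF L1]) (auto simp: I_def)
  have intp: "integrable M (\<lambda>\<omega>. grid_weight L b n i \<omega> * grid_weight L b n l \<omega>)" if "i \<in> I" "l \<in> I" for i l
    using grid_weight_pair_integrable[OF L1] that by (auto simp: I_def)
  have "expectation Y = (\<Sum>i\<in>I. 1 / (real b * (2 ^ n) ^ CARD('n)))"
    unfolding Y_def using int expectation_grid_weight[OF L1 _ b]
    by (subst Bochner_Integration.integral_sum) (auto simp: I_def intro!: sum.cong)
  also have "\<dots> = 1"
    using b by (simp add: I_def card_cartesian_product card_grid_index)
  finally have EY: "expectation Y = 1" .
  have sq: "(Y \<omega>)\<^sup>2 = (\<Sum>i\<in>I. \<Sum>l\<in>I. grid_weight L b n i \<omega> * grid_weight L b n l \<omega>)" for \<omega>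
    by (simp add: Y_def power2_eq_square sum_product)
  have intY: "integrable M Y" unfolding Y_def using int by (intro Bochner_Integration.integrable_sum)
  have intY2: "integrable M (\<lambda>\<omega>. (Y \<omega>)\<^sup>2)"
    unfolding sq using intp by (intro Bochner_Integration.integrable_sum)
  \<comment> \<open>For s = 0 the kernel is a base raised by \<open>powr\<close> to 0, which equals
    1 only because the base is nonzero.\<close>
  have pos: "dist (scaled_grid L n i) (scaled_grid L n l :: real^'n) + 1 / 2 ^ n \<noteq> 0" for i l
    by (intro less_imp_neq[symmetric] add_nonneg_pos) auto
  have "expectation (\<lambda>\<omega>. (Y \<omega>)\<^sup>2) \<le> 1 + v"
    using grid_energy_le[OF L b order_refl, of n] al v unfolding sq I_def by (simp add: pos)
  then have "variance Y \<le> v" using intY intY2 by (subst variance_eq) (auto simp: EY)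
  have "{\<omega>\<in>space M. Y \<omega> < 1 / 2} \<subseteq> {\<omega>\<in>space M. 1 / 2 \<le> \<bar>Y \<omega> - expectation Y\<bar>}" by (auto simp: EY)
  then have "prob {\<omega>\<in>space M. Y \<omega> < 1 / 2} \<le> prob {\<omega>\<in>space M. 1 / 2 \<le> \<bar>Y \<omega> - expectation Y\<bar>}"
    using Ym by (intro finite_measure_mono) auto
  also have "\<dots> \<le> variance Y / (1 / 2)\<^sup>2"
    using Ym intY2 by (intro Chebyshev_inequality) auto
  also have "\<dots> \<le> 4 * v" using \<open>variance Y \<le> v\<close> by (simp add: power2_eq_square)
  finally show ?thesis .
qed

lemma grid_energy_tail:
  fixes n b :: nat and s L :: real
  defines "I \<equiv> {..<b} \<times> (grid_index n :: ('n \<Rightarrow> nat) set)"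
  defines "J \<equiv> \<lambda>\<omega>. \<Sum>i\<in>I. \<Sum>l\<in>I. grid_weight L b n i \<omega> * grid_weight L b n l \<omega> *
      (dist (scaled_grid L n i) (scaled_grid L n l) + 1 / 2 ^ n) powr (- s)"
  assumes L: "4 \<le> L" and b: "1 \<le> b" and B: "expectation J \<le> B" and E: "0 < E"
  shows "J \<in> borel_measurable M" "prob {\<omega>\<in>space M. E < J \<omega>} \<le> B / E"
proof -
  have L1: "1 \<le> L" using L by simp
  have int: "integrable M J"
    unfolding J_def using grid_weight_pair_integrable[OF L1]
    by (intro Bochner_Integration.integrable_sum) (auto simp: I_def)
  then show m: "J \<in> borel_measurable M" by auto
  have J0: "0 \<le> J \<omega>" for \<omega>
    unfolding J_def using grid_weight_nonneg[OF L1] by (auto intro!: sum_nonneg mult_nonneg_nonneg simp: I_def)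
  have "prob {\<omega>\<in>space M. E < J \<omega>} \<le> prob {\<omega>\<in>space M. E \<le> J \<omega>}"
    using m by (intro finite_measure_mono) auto
  also have "\<dots> \<le> expectation J / E"
    using int J0 E by (intro integral_Markov_inequality_measure[where A = "space M"]) auto
  also have "\<dots> \<le> B / E" using B E by (intro divide_right_mono) auto
  finally show "prob {\<omega>\<in>space M. E < J \<omega>} \<le> B / E" .
qed

text \<open>A statement for each single \<omega>: the normalisation inflates a weight by at most a
  constant times 2^(n d/2), whereas a value of norm at least \<eta> damps it by exp (- 2^n \<eta>^2
  / 2). The doubly exponential factor wins, and the number of points cancels against the
  normalisation.\<close>

lemma grid_mass_off_zero_set:
  fixes b :: nat
  assumes L: "1 \<le> L" and b: "1 \<le> b" and eta: "0 < \<eta>"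
  shows "\<forall>\<^sub>F n in sequentially. (\<Sum>i\<in>{i\<in>{..<b} \<times> grid_index n. \<eta> \<le> norm (W \<omega> (scaled_grid L n i))}. grid_weight L b n i \<omega>) \<le> 1 / 4"
proof -
  define D where "D = (2 * (2 * L ^ b) ^ CARD('n)) powr (real CARD('d) / 2)"
  define g where "g = real CARD('d) / 2"
  define h where "h = \<eta>\<^sup>2"
  have "0 < h" "0 < g" using eta by (auto simp: h_def g_def)
  then have "(\<lambda>n. 2 powr (real n * g) * exp (- (2 ^ n * h) / 2)) \<longlonglongrightarrow> 0"
    by real_asymp
  then have "(\<lambda>n. D * (2 powr (real n * g) * exp (- (2 ^ n * \<eta>\<^sup>2) / 2))) \<longlonglongrightarrow> 0"
    unfolding h_def by (rule tendsto_mult_right_zero)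
  then have "\<forall>\<^sub>F n in sequentially. D * (2 powr (real n * g) * exp (- (2 ^ n * \<eta>\<^sup>2) / 2)) < 1 / 4"
    by (rule order_tendstoD(2)) simp
  then show ?thesis
  proof eventually_elim
    case (elim n)
    let ?I = "{..<b} \<times> (grid_index n :: ('n \<Rightarrow> nat) set)"
    let ?c = "real b * (2 ^ n) ^ CARD('n)"
    have c: "0 < ?c" using b by simp
    let ?B = "D * (2 powr (real n * g) * exp (- (2 ^ n * \<eta>\<^sup>2) / 2)) / ?c"
    have fin: "finite ?I" by (simp add: finite_grid_index)
    have B0: "0 \<le> ?B" using c by (simp add: D_def)
    have "(\<Sum>i\<in>{i\<in>?I. \<eta> \<le> norm (W \<omega> (scaled_grid L n i))}. grid_weight L b n i \<omega>)
       \<le> (\<Sum>i\<in>{i\<in>?I. \<eta> \<le> norm (W \<omega> (scaled_grid L n i))}. ?B)"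
    proof (rule sum_mono)
      fix i assume i: "i \<in> {i\<in>?I. \<eta> \<le> norm (W \<omega> (scaled_grid L n i))}"
      let ?e = "expectation (bump (2 ^ n) (scaled_grid L n i))"
      have e: "0 < ?e" using i by (intro expectation_bump_pos scaled_grid_bounds(3)[OF L]) auto
      have "\<eta>\<^sup>2 \<le> (norm (W \<omega> (scaled_grid L n i)))\<^sup>2" using i eta by (intro power_mono) auto
      then have u: "bump (2 ^ n) (scaled_grid L n i) \<omega> \<le> exp (- (2 ^ n * \<eta>\<^sup>2) / 2)"
        by (simp add: bump_def)
      have ie: "1 / ?e \<le> D * 2 powr (real n * g)"
        unfolding D_def g_def using i by (intro inverse_expectation_bump_le[OF L]) auto
      have "grid_weight L b n i \<omega> = bump (2 ^ n) (scaled_grid L n i) \<omega> * (1 / ?e) / ?c"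
        by (simp add: grid_weight_def)
      also have "\<dots> \<le> exp (- (2 ^ n * \<eta>\<^sup>2) / 2) * (D * 2 powr (real n * g)) / ?c"
        using u ie e c by (intro divide_right_mono mult_mono) auto
      finally show "grid_weight L b n i \<omega> \<le> ?B" by (simp add: ac_simps)
    qed
    also have "\<dots> \<le> (\<Sum>i\<in>?I. ?B)" using fin B0 by (intro sum_mono2) auto
    also have "\<dots> = ?c * ?B" by (simp add: card_cartesian_product card_grid_index)
    also have "\<dots> = D * (2 powr (real n * g) * exp (- (2 ^ n * \<eta>\<^sup>2) / 2))"
    proof -
      have "x * (y / x) = y" if "0 < x" for x y :: real using that by simp
      then show ?thesis using c by blast
    qed
    also have "\<dots> \<le> 1 / 4" using elim by simp
    finally show ?case .
  qed
qed

section \<open>From events of large probability to almost sure statements\<close>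

lemma prob_limsup_ge:
  fixes A :: "nat \<Rightarrow> 'w set"
  assumes A: "\<And>n. A n \<in> events" and p: "\<And>n. n0 \<le> n \<Longrightarrow> p \<le> prob (A n)"
  shows "(\<Inter>m. \<Union>n\<in>{m..}. A n) \<in> events" "p \<le> prob (\<Inter>m. \<Union>n\<in>{m..}. A n)"
proof -
  show "(\<Inter>m. \<Union>n\<in>{m..}. A n) \<in> events"
    by (rule sets.countable_INT) (use A in auto)
  have "(\<lambda>m. prob (\<Union>n\<in>{m..}. A n)) \<longlonglongrightarrow> prob (\<Inter>m. \<Union>n\<in>{m..}. A n)"
  proof (rule finite_Lim_measure_decseq)
    show "range (\<lambda>m. \<Union>n\<in>{m..}. A n) \<subseteq> events" using A by auto
    show "decseq (\<lambda>m. \<Union>n\<in>{m..}. A n)" by (rule decseq_SucI) (auto dest: Suc_leD)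
  qed
  moreover have "p \<le> prob (\<Union>n\<in>{m..}. A n)" for m
  proof -
    have "p \<le> prob (A (max m n0))" by (rule p) simp
    also have "\<dots> \<le> prob (\<Union>n\<in>{m..}. A n)"
      using A by (intro finite_measure_mono UN_upper) auto
    finally show ?thesis .
  qed
  ultimately show "p \<le> prob (\<Inter>m. \<Union>n\<in>{m..}. A n)"
    by (intro LIMSEQ_le_const) auto
qed

text \<open>Measurability of P is not at hand, as P will speak of Hausdorff measures. So P is
  captured from inside by measurable events of probability at least 1 - 1/(k + 1), whose union has
  probability 1.\<close>

lemma AE_from_large_events:
  assumes "\<And>e::real. 0 < e \<Longrightarrow> \<exists>G\<in>events. 1 - e \<le> prob G \<and> (\<forall>\<omega>\<in>G. P \<omega>)"
  shows "AE \<omega> in M. P \<omega>"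
proof -
  have "\<forall>k::nat. \<exists>G. G \<in> events \<and> 1 - 1 / real (Suc k) \<le> prob G \<and> (\<forall>\<omega>\<in>G. P \<omega>)"
    using assms[of "1 / real (Suc k)" for k] by fastforce
  then obtain G where G: "\<And>k. G k \<in> events" "\<And>k. 1 - 1 / real (Suc k) \<le> prob (G k)" "\<And>k \<omega>. \<omega> \<in> G k \<Longrightarrow> P \<omega>"
    by metis
  have H: "(\<Union>k. G k) \<in> events" using G(1) by auto
  have "1 - 1 / real (Suc k) \<le> prob (\<Union>k. G k)" for k
    using G(2)[of k] finite_measure_mono[of "G k" "\<Union>k. G k"] G(1) H by force
  moreover have "(\<lambda>k. 1 - 1 / real (Suc k)) \<longlonglongrightarrow> 1" by real_asymp
  ultimately have "1 \<le> prob (\<Union>k. G k)" by (intro LIMSEQ_le_const2) auto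
  then have "AE \<omega> in M. \<omega> \<in> (\<Union>k. G k)" using H by (subst AE_in_set_eq_1) (auto intro!: antisym)
  then show ?thesis by eventually_elim (use G(3) in auto)
qed

text \<open>The order of the choices is what makes this work: b reduces the fluctuations inside
  blocks by a constant independent of L, then L decouples the blocks, and n becomes large only after
  both are fixed. The energy bound \<open>E\<close> may depend on all of them, since it only has to
  be finite and uniform in n.\<close>

lemma zero_set_hausdorff_measure_nonzero:
  assumes s: "0 < s" "s < real CARD('n) - real CARD('d) / 2"
  shows "AE \<omega> in M. hausdorff_measure s (sheet_zero_set W \<omega>) \<noteq> 0"
proof -
  define al where "al = real CARD('n) - real CARD('d) / 2"
  define C where "C = (\<lambda>s. (2 * 4 powr ((s + real CARD('d) / 2) / real CARD('n)) / (1 - (s + real CARD('d) / 2) / real CARD('n))) ^ CARD('n))"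
  have al: "0 < al" "s < al" using s by (auto simp: al_def)
  have "AE \<omega> in M. continuous_on pos_orthant (W \<omega>) \<longrightarrow> hausdorff_measure s (sheet_zero_set W \<omega>) \<noteq> 0"
  proof (rule AE_from_large_events)
    fix e :: real assume e: "0 < e"
    \<comment> \<open>The mass falls below 1/2 with probability at most 4 (3 v), and the energy
      exceeds \<open>E\<close> with probability at most 12 v; together this is e.\<close>
    define v where "v = e / 24"
    have v: "0 < v" using e by (simp add: v_def)
    obtain b :: nat where b: "1 \<le> b" "C 0 / real b \<le> v"
    proof -
      have "(\<lambda>b. C 0 / real b) \<longlonglongrightarrow> 0" by real_asymp
      then have "\<forall>\<^sub>F b in sequentially. C 0 / real b < v \<and> 1 \<le> b"
        using v by (intro eventually_conj order_tendstoD(2) eventually_ge_at_top)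
      then show ?thesis using that by (auto simp: eventually_sequentially)
    qed
    obtain L :: real where L: "4 \<le> L" "(1 - 2 / L) powr (- real CARD('d) / 2) \<le> 1 + v"
    proof -
      define g where "g = - real CARD('d) / 2"
      have "((\<lambda>L::real. (1 - 2 / L) powr g) \<longlongrightarrow> 1) at_top" by real_asymp
      then have "\<forall>\<^sub>F L in at_top. (1 - 2 / L) powr g < 1 + v \<and> 4 \<le> (L::real)"
        using v by (intro eventually_conj order_tendstoD(2) eventually_ge_at_top) auto
      then obtain L where "(1 - 2 / L) powr g < 1 + v" "4 \<le> L" by (auto simp: eventually_at_top_linorder)
      then show ?thesis using that[of L] by (simp add: g_def)
    qed
    define D where "D = (2 * (2 * L ^ b) ^ CARD('n)) powr (real CARD('d) / 2)"
    have D0: "0 \<le> D" by (simp add: D_def)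
    obtain n0 where n0: "\<And>n. n0 \<le> n \<Longrightarrow> D * 2 powr (- (real n * al)) \<le> v"
    proof -
      have "(\<lambda>n. D * 2 powr (- (real n * al))) \<longlonglongrightarrow> 0" using al by real_asymp
      then have "\<forall>\<^sub>F n in sequentially. D * 2 powr (- (real n * al)) < v"
        using v by (rule order_tendstoD(2))
      then show ?thesis using that by (auto simp: eventually_sequentially intro: less_imp_le)
    qed
    define B where "B = 1 + v + C s / real b + D"
    define E where "E = max 1 (B / (12 * v))"
    have E: "0 < E" "B / E \<le> 12 * v"
    proof -
      show "0 < E" by (simp add: E_def)
      have "B / (12 * v) \<le> E" by (simp add: E_def)
      then show "B / E \<le> 12 * v" using v \<open>0 < E\<close> by (simp add: divide_le_eq mult.commute)
    qed
    define I where "I = (\<lambda>n. {..<b} \<times> (grid_index n :: ('n \<Rightarrow> nat) set))"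
    define Y where "Y = (\<lambda>n \<omega>. \<Sum>i\<in>I n. grid_weight L b n i \<omega>)"
    define J where "J = (\<lambda>n \<omega>. \<Sum>i\<in>I n. \<Sum>l\<in>I n. grid_weight L b n i \<omega> * grid_weight L b n l \<omega> *
      (dist (scaled_grid L n i) (scaled_grid L n l) + 1 / 2 ^ n) powr (- s))"
    define A where "A = (\<lambda>n. {\<omega>\<in>space M. 1 / 2 \<le> Y n \<omega> \<and> J n \<omega> \<le> E})"
    have L1: "1 \<le> L" using L by simp
    have EJ: "expectation (J n) \<le> B" for n
    proof -
      have "expectation (J n) \<le> (1 - 2 / L) powr (- real CARD('d) / 2) + C s / real b + D * 2 powr (- (real n * (al - s)))"
        unfolding J_def I_def C_def D_def al_def using s by (intro grid_energy_le L b) auto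
      moreover have "2 powr (- (real n * (al - s))) \<le> 2 powr 0" using al by (intro powr_mono) auto
      then have "D * 2 powr (- (real n * (al - s))) \<le> D * 1" using D0 by (intro mult_left_mono) auto
      ultimately show ?thesis using L(2) by (simp add: B_def)
    qed
    have Ym: "Y n \<in> borel_measurable M" for n
      unfolding Y_def using grid_weight_measurable[OF L1] by (intro borel_measurable_sum) (auto simp: I_def)
    have Jm: "J n \<in> borel_measurable M" and Jt: "prob {\<omega>\<in>space M. E < J n \<omega>} \<le> B / E" for n
      using grid_energy_tail[OF L(1) b(1) EJ[unfolded J_def I_def] E(1)] by (auto simp: J_def I_def)
    have Am: "A n \<in> events" for n unfolding A_def using Ym[of n] Jm[of n] by measurable
    have pA: "1 - e \<le> prob (A n)" if "n0 \<le> n" for n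
    proof -
      have Yt: "prob {\<omega>\<in>space M. Y n \<omega> < 1 / 2} \<le> 4 * (3 * v)"
        unfolding Y_def I_def
      proof (rule grid_mass_concentrates[OF L(1) b(1)])
        show "real CARD('d) / 2 < real CARD('n)" using al by (simp add: al_def)
        show "(1 - 2 / L) powr (- real CARD('d) / 2) + (2 * 4 powr (real CARD('d) / 2 / real CARD('n)) / (1 - real CARD('d) / 2 / real CARD('n))) ^ CARD('n) / real b
          + (2 * (2 * L ^ b) ^ CARD('n)) powr (real CARD('d) / 2) * 2 powr (- (real n * (real CARD('n) - real CARD('d) / 2))) \<le> 1 + 3 * v"
          using L(2) b(2) n0[OF that] by (simp add: C_def D_def al_def)
      qed
      have "space M - A n \<subseteq> {\<omega>\<in>space M. Y n \<omega> < 1 / 2} \<union> {\<omega>\<in>space M. E < J n \<omega>}"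
        by (auto simp: A_def)
      then have "prob (space M - A n) \<le> prob ({\<omega>\<in>space M. Y n \<omega> < 1 / 2} \<union> {\<omega>\<in>space M. E < J n \<omega>})"
        using Ym[of n] Jm[of n] by (intro finite_measure_mono) auto
      also have "\<dots> \<le> prob {\<omega>\<in>space M. Y n \<omega> < 1 / 2} + prob {\<omega>\<in>space M. E < J n \<omega>}"
        using Ym[of n] Jm[of n] by (intro measure_Un_le) auto
      also have "\<dots> \<le> e" using Yt Jt[of n] E(2) unfolding v_def by linarith
      finally show ?thesis using prob_compl[OF Am[of n]] by simp
    qed
    note G = prob_limsup_ge[of A, OF Am pA]
    show "\<exists>G\<in>events. 1 - e \<le> prob G \<and> (\<forall>\<omega>\<in>G. continuous_on pos_orthant (W \<omega>) \<longrightarrow> hausdorff_measure s (sheet_zero_set W \<omega>) \<noteq> 0)"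
    proof (intro bexI[OF _ G(1)] conjI G(2) ballI impI)
      fix \<omega> assume w: "\<omega> \<in> (\<Inter>m. \<Union>n\<in>{m..}. A n)" and cont: "continuous_on pos_orthant (W \<omega>)"
      \<comment> \<open>One compact box containing all blocks at every level n, bounded away from
        the coordinate hyperplanes.\<close>
      define K :: "(real^'n) set" where "K = cbox (\<chi> k. 1) (\<chi> k. 2 * L ^ b)"
      have "compact K" unfolding K_def by (rule compact_cbox)
      moreover have "K \<subseteq> pos_orthant"
        by (auto simp: K_def mem_box_cart pos_orthant_def intro: less_le_trans[OF zero_less_one])
      moreover have "\<exists>\<^sub>F n in sequentially. 1 / 2 \<le> Y n \<omega> \<and> J n \<omega> \<le> E"
        unfolding frequently_sequentially using w by (fastforce simp: A_def)
      moreover have "scaled_grid L n i \<in> K" if "i \<in> I n" for n i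
        using that scaled_grid_bounds(4,5)[OF L1, of i b n] by (auto simp: I_def K_def mem_box_cart)
      ultimately show "hausdorff_measure s (sheet_zero_set W \<omega>) \<noteq> 0"
        unfolding sheet_zero_set_def Y_def J_def
        using grid_weight_nonneg[OF L1] grid_mass_off_zero_set[OF L1 b(1), of _ \<omega>]
        by (intro hausdorff_measure_zero_set_nonzero[of K _ _ s E I "scaled_grid L" "\<lambda>n i. grid_weight L b n i \<omega>"] cont s(1) E(1))
           (auto simp: I_def finite_grid_index)
    qed
  qed
  with continuous_AE show ?thesis by eventually_elim auto
qed

end

section \<open>Modulus of continuity on dyadic grids\<close>

text \<open>Markov's inequality for the moment of order 2 p. A polynomial tail of arbitrary order is
  enough, as it only has to outweigh a number of grid points that is a fixed power of the inverse
  mesh.\<close>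

lemma (in prob_space) centered_normal_tail:
  assumes X: "centered_normal M X v" and v: "0 \<le> v" and l: "0 < l" and p: "0 < p"
  shows "prob {\<omega>\<in>space M. l \<le> \<bar>X \<omega>\<bar>} \<le> fact (2 * p) / (2 ^ p * fact p) * v ^ p / l ^ (2 * p)"
proof (cases "v = 0")
  case True
  then have "AE \<omega> in M. X \<omega> = 0" using X by (simp add: centered_normal_def)
  moreover have m: "X \<in> borel_measurable M" using X by (simp add: centered_normal_def)
  ultimately have "prob {\<omega>\<in>space M. l \<le> \<bar>X \<omega>\<bar>} = prob {}"
    using l by (intro finite_measure_eq_AE) (auto elim: eventually_mono)
  then show ?thesis using True p by simp
next
  case False
  then have v0: "0 < v" using v by simp
  then have D: "distributed M lborel X (normal_density 0 (sqrt v))" and m: "X \<in> borel_measurable M"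
    using X by (auto simp: centered_normal_def)
  have hb: "has_bochner_integral lborel (\<lambda>x. normal_density 0 (sqrt v) x * (x - 0) ^ (2 * p)) (fact (2 * p) / ((2 / (sqrt v)\<^sup>2) ^ p * fact p))"
    using v0 by (intro normal_moment_even) auto
  have int: "integrable M (\<lambda>\<omega>. X \<omega> ^ (2 * p))"
    using hb distributed_integrable[OF D, of "\<lambda>x. x ^ (2 * p)"] by (simp add: has_bochner_integral_iff)
  have "expectation (\<lambda>\<omega>. X \<omega> ^ (2 * p)) = fact (2 * p) / ((2 / (sqrt v)\<^sup>2) ^ p * fact p)"
    using hb distributed_integral[OF D, of "\<lambda>x. x ^ (2 * p)"] by (simp add: has_bochner_integral_iff)
  also have "\<dots> = fact (2 * p) / (2 ^ p * fact p) * v ^ p"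
    using v0 by (simp add: power_divide)
  finally have E: "expectation (\<lambda>\<omega>. X \<omega> ^ (2 * p)) = fact (2 * p) / (2 ^ p * fact p) * v ^ p" .
  have "l ^ (2 * p) \<le> X \<omega> ^ (2 * p)" if "l \<le> \<bar>X \<omega>\<bar>" for \<omega>
    using power_mono[OF that, of "2 * p"] l by (simp add: power_even_abs)
  then have "prob {\<omega>\<in>space M. l \<le> \<bar>X \<omega>\<bar>} \<le> prob {\<omega>\<in>space M. l ^ (2 * p) \<le> X \<omega> ^ (2 * p)}"
    using m by (intro finite_measure_mono) auto
  also have "\<dots> \<le> expectation (\<lambda>\<omega>. X \<omega> ^ (2 * p)) / l ^ (2 * p)"
    using int l by (intro integral_Markov_inequality_measure[where A = "space M"]) (auto simp: zero_le_even_power)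
  finally show ?thesis by (simp add: E)
qed

text \<open>After division by B all factors have norm at most 1, and the difference of two products
  is at most the sum of the differences of the factors.\<close>

lemma prod_diff_le:
  fixes s t :: "'n::finite \<Rightarrow> real"
  assumes st: "\<And>k. 0 \<le> s k" "\<And>k. s k \<le> t k" "\<And>k. t k \<le> s k + h" and B: "1 \<le> B" "\<And>k. t k \<le> B"
  shows "(\<Prod>k\<in>UNIV. t k) - (\<Prod>k\<in>UNIV. s k) \<le> real CARD('n) * B ^ CARD('n) * h"
proof -
  have "0 \<le> t k" "s k \<le> B" for k using st(1,2)[of k] B(2)[of k] by linarith+
  then have "norm ((\<Prod>k\<in>UNIV. t k / B) - (\<Prod>k\<in>UNIV. s k / B)) \<le> (\<Sum>k\<in>UNIV. norm (t k / B - s k / B))"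
    using st(1) B by (intro norm_prod_diff) simp_all
  also have "\<dots> \<le> (\<Sum>k\<in>(UNIV::'n set). h)"
  proof (rule sum_mono)
    fix k
    have "norm (t k / B - s k / B) = (t k - s k) / B"
      using st(2)[of k] B(1) by (simp add: diff_divide_distrib[symmetric])
    also have "\<dots> \<le> (t k - s k) / 1" using st(2)[of k] B(1) by (intro divide_left_mono) auto
    finally show "norm (t k / B - s k / B) \<le> h" using st(3)[of k] by simp
  qed
  finally have "(\<Prod>k\<in>UNIV. t k / B) - (\<Prod>k\<in>UNIV. s k / B) \<le> real CARD('n) * h" by simp
  then have "((\<Prod>k\<in>UNIV. t k) - (\<Prod>k\<in>UNIV. s k)) / B ^ CARD('n) \<le> real CARD('n) * h"
    by (simp add: prod_dividef diff_divide_distrib)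
  then show ?thesis using B(1) by (simp add: divide_le_eq ac_simps)
qed

definition dyadic_point :: "nat \<Rightarrow> ('n::finite \<Rightarrow> nat) \<Rightarrow> real^'n" where
  "dyadic_point q a = (\<chi> k. real (a k) / 2 ^ q)"

text \<open>The indices of the grid points in \<open>dyadic_box m\<close>. For q < m the subtraction
  on nat truncates and the lower end is no longer 2^(-m), which explains the recurring assumption m
  \<le> q.\<close>

definition dyadic_index :: "nat \<Rightarrow> nat \<Rightarrow> ('n::finite \<Rightarrow> nat) set" where
  "dyadic_index m q = PiE UNIV (\<lambda>_. {2 ^ (q - m)..2 ^ (q + m)})"

definition dyadic_floor :: "nat \<Rightarrow> real^'n::finite \<Rightarrow> 'n \<Rightarrow> nat" where
  "dyadic_floor q z k = nat \<lfloor>2 ^ q * z $ k\<rfloor>"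

definition dyadic_box :: "nat \<Rightarrow> (real^'n::finite) set" where
  "dyadic_box m = cbox (\<chi> k. 1 / 2 ^ m) (\<chi> k. 2 ^ m)"

lemma finite_dyadic_index: "finite (dyadic_index m q)"
  unfolding dyadic_index_def by (intro finite_PiE) auto

lemma card_dyadic_index_le: "real (card (dyadic_index m q :: ('n::finite \<Rightarrow> nat) set)) \<le> (2 ^ Suc (q + m)) ^ CARD('n)"
proof -
  have "card (dyadic_index m q :: ('n \<Rightarrow> nat) set) = (card {2 ^ (q - m)..2 ^ (q + m)::nat}) ^ CARD('n)"
    unfolding dyadic_index_def by (simp add: card_PiE)
  moreover have "card {2 ^ (q - m)..2 ^ (q + m)::nat} \<le> 2 ^ Suc (q + m)"
  proof -
    have "(1::nat) \<le> 2 ^ (q - m)" by simp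
    then have "card {2 ^ (q - m)..2 ^ (q + m)::nat} \<le> 2 ^ (q + m)"
      unfolding card_atLeastAtMost by arith
    then show ?thesis by simp
  qed
  ultimately have "card (dyadic_index m q :: ('n \<Rightarrow> nat) set) \<le> (2 ^ Suc (q + m)) ^ CARD('n)"
    by (metis power_mono zero_le)
  then show ?thesis by (metis of_nat_le_iff of_nat_numeral of_nat_power)
qed

lemma dyadic_point_bounds:
  assumes "a \<in> dyadic_index m q" "m \<le> q"
  shows "1 / 2 ^ m \<le> dyadic_point q a $ k" "dyadic_point q a $ k \<le> 2 ^ m"
proof -
  have "2 ^ (q - m) \<le> a k" "a k \<le> 2 ^ (q + m)"
    using assms(1) by (auto simp: dyadic_index_def PiE_def Pi_def)
  then have a: "2 ^ (q - m) \<le> real (a k)" "real (a k) \<le> 2 ^ (q + m)"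
    by (metis of_nat_le_iff of_nat_numeral of_nat_power)+
  have "(2::real) ^ (q - m) / 2 ^ q = 1 / 2 ^ m" using assms(2) by (simp add: power_diff)
  then show "1 / 2 ^ m \<le> dyadic_point q a $ k"
    using divide_right_mono[OF a(1), of "2 ^ q"] by (simp add: dyadic_point_def)
  show "dyadic_point q a $ k \<le> 2 ^ m"
    using divide_right_mono[OF a(2), of "2 ^ q"] by (simp add: dyadic_point_def power_add)
qed

lemma dyadic_point_pos: "a \<in> dyadic_index m q \<Longrightarrow> m \<le> q \<Longrightarrow> dyadic_point q a \<in> pos_orthant"
  using dyadic_point_bounds(1)[of a m q] unfolding pos_orthant_def
  by (auto intro: less_le_trans[of 0 "1 / 2 ^ m"])

lemma dyadic_box_iff: "z \<in> dyadic_box m \<longleftrightarrow> (\<forall>k. 1 / 2 ^ m \<le> z $ k \<and> z $ k \<le> 2 ^ m)"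
  by (auto simp: dyadic_box_def mem_box_cart)

lemma dyadic_box_pos: "dyadic_box m \<subseteq> pos_orthant"
  by (auto simp: dyadic_box_iff pos_orthant_def intro: less_le_trans[of 0 "1 / 2 ^ m"])

lemma dyadic_floor_index:
  assumes "z \<in> dyadic_box m" "m \<le> q"
  shows "dyadic_floor q z \<in> dyadic_index m q"
proof -
  have "2 ^ (q - m) \<le> nat \<lfloor>2 ^ q * z $ k\<rfloor> \<and> nat \<lfloor>2 ^ q * z $ k\<rfloor> \<le> 2 ^ (q + m)" for k
  proof -
    have z: "1 / 2 ^ m \<le> z $ k" "z $ k \<le> 2 ^ m" using assms(1) by (auto simp: dyadic_box_iff)
    have "2 ^ q * (1 / 2 ^ m) \<le> 2 ^ q * z $ k" using z(1) by (intro mult_left_mono) auto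
    then have 1: "2 ^ (q - m) \<le> 2 ^ q * z $ k" using assms(2) by (simp add: power_diff)
    have "2 ^ q * z $ k \<le> 2 ^ q * 2 ^ m" using z(2) by (intro mult_left_mono) auto
    then have 2: "2 ^ q * z $ k \<le> 2 ^ (q + m)" by (simp add: power_add)
    have "(2::int) ^ (q - m) \<le> \<lfloor>2 ^ q * z $ k\<rfloor>" using 1 by (simp add: le_floor_iff)
    moreover have "\<lfloor>2 ^ q * z $ k\<rfloor> \<le> (2::int) ^ (q + m)"
      using floor_mono[OF 2] by (metis floor_of_int of_int_numeral of_int_power)
    ultimately show ?thesis by (auto simp: nat_le_iff le_nat_iff)
  qed
  then show ?thesis by (auto simp: dyadic_index_def dyadic_floor_def PiE_def Pi_def)
qed

lemma dyadic_floor_close: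
  assumes "z \<in> pos_orthant"
  shows "dyadic_point q (dyadic_floor q z) $ k \<le> z $ k" "z $ k < dyadic_point q (dyadic_floor q z) $ k + 1 / 2 ^ q"
proof -
  have z: "0 < z $ k" using assms by (simp add: pos_orthant_def)
  then have r: "real (dyadic_floor q z k) = of_int \<lfloor>2 ^ q * z $ k\<rfloor>" by (simp add: dyadic_floor_def)
  have "of_int \<lfloor>2 ^ q * z $ k\<rfloor> \<le> 2 ^ q * z $ k" "2 ^ q * z $ k < of_int \<lfloor>2 ^ q * z $ k\<rfloor> + 1" by linarith+
  then show "dyadic_point q (dyadic_floor q z) $ k \<le> z $ k" "z $ k < dyadic_point q (dyadic_floor q z) $ k + 1 / 2 ^ q"
    unfolding dyadic_point_def by (simp_all add: r field_simps)
qed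

text \<open>Consecutive dyadic approximations of a point are parent and child. The second claim is
  what gives the first its meaning, since subtraction on nat truncates.\<close>

lemma dyadic_floor_Suc:
  assumes "z \<in> pos_orthant"
  shows "dyadic_floor (Suc q) z k - 2 * dyadic_floor q z k \<in> {0, 1}" "2 * dyadic_floor q z k \<le> dyadic_floor (Suc q) z k"
proof -
  have z: "0 < z $ k" using assms by (simp add: pos_orthant_def)
  define y where "y = 2 ^ q * z $ k"
  have y: "0 < y" using z by (simp add: y_def)
  have "dyadic_floor (Suc q) z k = nat \<lfloor>2 * y\<rfloor>" "dyadic_floor q z k = nat \<lfloor>y\<rfloor>"
    by (simp_all add: dyadic_floor_def y_def mult.assoc)
  moreover have "0 \<le> \<lfloor>y\<rfloor>" "2 * \<lfloor>y\<rfloor> \<le> \<lfloor>2 * y\<rfloor>" "\<lfloor>2 * y\<rfloor> \<le> 2 * \<lfloor>y\<rfloor> + 1"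
    using y by linarith+
  ultimately show "dyadic_floor (Suc q) z k - 2 * dyadic_floor q z k \<in> {0, 1}" "2 * dyadic_floor q z k \<le> dyadic_floor (Suc q) z k"
    by auto
qed

lemma dyadic_floor_tendsto:
  assumes "z \<in> pos_orthant"
  shows "(\<lambda>q. dyadic_point q (dyadic_floor q z)) \<longlonglongrightarrow> z"
proof (rule vec_tendstoI)
  fix k
  have l: "(\<lambda>q. z $ k - 1 / 2 ^ q) \<longlonglongrightarrow> z $ k" by real_asymp
  show "(\<lambda>q. dyadic_point q (dyadic_floor q z) $ k) \<longlonglongrightarrow> z $ k"
  proof (rule tendsto_sandwich[OF _ _ l tendsto_const])
    show "\<forall>\<^sub>F q in sequentially. z $ k - 1 / 2 ^ q \<le> dyadic_point q (dyadic_floor q z) $ k"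
      using dyadic_floor_close(2)[OF assms, of k] by (intro always_eventually allI) (smt (verit))
  qed (use dyadic_floor_close(1)[OF assms] in auto)
qed

section \<open>Dyadic chaining for the sheet\<close>

context brownian
begin

text \<open>For coordinatewise comparable points the covariance equals the variance at the smaller
  one, so the increment has the difference of the box volumes as its variance. A child lies above
  its parent, so all increments of the chaining are of this kind.\<close>

lemma increment_normal:
  assumes "s \<in> pos_orthant" "t \<in> pos_orthant" "\<And>k. s $ k \<le> t $ k"
  shows "centered_normal M (\<lambda>\<omega>. W \<omega> t $ j - W \<omega> s $ j) ((\<Prod>k\<in>UNIV. t $ k) - (\<Prod>k\<in>UNIV. s $ k))"
proof -
  define u where "u = (\<lambda>i::nat. if i = 0 then t else s)"
  define c where "c = (\<lambda>i::nat. if i = 0 then 1 else - 1 :: real)"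
  have "centered_normal M (\<lambda>\<omega>. \<Sum>i<2. c i * (sqrt 1 * W \<omega> (u i) $ j)) (qform {..<2} (\<lambda>p q. 1 * sheet_cov (u p) (u q)) c)"
    using assms by (intro centered_normal_scaled) (auto simp: u_def)
  moreover have "sheet_cov s t = (\<Prod>k\<in>UNIV. s $ k)" "sheet_cov t s = (\<Prod>k\<in>UNIV. s $ k)"
    using assms(3) by (auto simp: sheet_cov_def min_absorb1 min_absorb2)
  ultimately show ?thesis
    using sheet_cov_bounds(1)[OF assms(1)] sheet_cov_bounds(1)[OF assms(2)]
    by (simp add: numeral_2_eq_2 u_def c_def qform_def)
qed

text \<open>The vector \<open>d\<close> is the step from a grid point to one of its 2^N children. A
  child may stick out of the box, hence the bound 2^(m + 1) for its coordinates.\<close>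

lemma dyadic_increment_tail:
  assumes a: "a \<in> dyadic_index m q" and mq: "m \<le> q" and d: "d \<in> PiE UNIV (\<lambda>_. {0, 1::nat})" and p: "0 < p" and l: "0 < l"
  defines "t \<equiv> dyadic_point (Suc q) (\<lambda>k. 2 * a k + d k) :: real^'n" and "s \<equiv> dyadic_point q a"
  shows "t \<in> pos_orthant" "s \<in> pos_orthant"
    "prob {\<omega>\<in>space M. l \<le> \<bar>W \<omega> t $ j - W \<omega> s $ j\<bar>}
      \<le> fact (2 * p) / (2 ^ p * fact p) * (real CARD('n) * (2 ^ Suc m) ^ CARD('n) / 2 ^ q) ^ p / l ^ (2 * p)"
proof -
  have dk: "d k \<le> 1" for k
  proof -
    have "d k \<in> {0, 1}" using d by (auto simp: PiE_iff)
    then show ?thesis by auto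
  qed
  have tk: "t $ k = s $ k + real (d k) / 2 ^ Suc q" for k
    by (simp add: t_def s_def dyadic_point_def field_simps)
  have d01: "0 \<le> real (d k) / 2 ^ Suc q" "real (d k) / 2 ^ Suc q \<le> 1 / 2 ^ q" for k
  proof -
    have "real (d k) / 2 ^ Suc q \<le> 1 / 2 ^ Suc q" using dk[of k] by (intro divide_right_mono) auto
    also have "\<dots> \<le> 1 / 2 ^ q" by (intro divide_left_mono) auto
    finally show "real (d k) / 2 ^ Suc q \<le> 1 / 2 ^ q" .
  qed simp
  have st: "s $ k \<le> t $ k" "t $ k \<le> s $ k + 1 / 2 ^ q" for k unfolding tk using d01[of k] by auto
  show sp: "s \<in> pos_orthant" unfolding s_def using a mq by (rule dyadic_point_pos)
  then have s0: "0 < s $ k" for k by (simp add: pos_orthant_def)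
  then show tp: "t \<in> pos_orthant" unfolding pos_orthant_def using st(1) by (auto intro: less_le_trans)
  let ?v = "(\<Prod>k\<in>UNIV. t $ k) - (\<Prod>k\<in>UNIV. s $ k)"
  have v0: "0 \<le> ?v" using s0 st(1) by (simp add: prod_mono less_imp_le)
  have "?v \<le> real CARD('n) * (2 ^ Suc m) ^ CARD('n) * (1 / 2 ^ q)"
  proof (rule prod_diff_le)
    fix k
    have "s $ k \<le> 2 ^ m" unfolding s_def using dyadic_point_bounds(2)[OF a mq] .
    moreover have "1 / 2 ^ q \<le> (1::real)" by simp
    moreover have "1 \<le> (2::real) ^ m" by simp
    ultimately show "t $ k \<le> 2 ^ Suc m" using st(2)[of k] unfolding power_Suc by linarith
    show "(1::real) \<le> 2 ^ Suc m" by (rule one_le_power) simp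
  qed (use st s0 in \<open>auto intro: less_imp_le\<close>)
  then have v: "?v \<le> real CARD('n) * (2 ^ Suc m) ^ CARD('n) / 2 ^ q" by simp
  have "prob {\<omega>\<in>space M. l \<le> \<bar>W \<omega> t $ j - W \<omega> s $ j\<bar>} \<le> fact (2 * p) / (2 ^ p * fact p) * ?v ^ p / l ^ (2 * p)"
    using increment_normal[OF sp tp st(1)] v0 l p by (rule centered_normal_tail)
  also have "\<dots> \<le> fact (2 * p) / (2 ^ p * fact p) * (real CARD('n) * (2 ^ Suc m) ^ CARD('n) / 2 ^ q) ^ p / l ^ (2 * p)"
    using v v0 l by (intro divide_right_mono mult_left_mono power_mono) auto
  finally show "prob {\<omega>\<in>space M. l \<le> \<bar>W \<omega> t $ j - W \<omega> s $ j\<bar>}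
      \<le> fact (2 * p) / (2 ^ p * fact p) * (real CARD('n) * (2 ^ Suc m) ^ CARD('n) / 2 ^ q) ^ p / l ^ (2 * p)" .
qed

lemma dyadic_increments_AE:
  fixes m :: nat and \<kappa> :: real
  assumes \<kappa>: "0 < \<kappa>" "\<kappa> < 1 / 2"
  shows "AE \<omega> in M. \<forall>\<^sub>F q in sequentially. \<forall>a\<in>dyadic_index m q. \<forall>d\<in>PiE UNIV (\<lambda>_. {0, 1::nat}). \<forall>j.
     \<bar>W \<omega> (dyadic_point (Suc q) (\<lambda>k. 2 * a k + d k)) $ j - W \<omega> (dyadic_point q a) $ j\<bar> < 2 powr (- (real q * \<kappa>))"
proof -
  \<comment> \<open>With this moment the exponent N - p (1 - 2 \<kappa>) is at most -1, so that
    level q contributes at most a multiple of 2^(-q) and Borel-Cantelli applies.\<close>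
  define p where "p = nat \<lceil>(real CARD('n) + 1) / (1 - 2 * \<kappa>)\<rceil>"
  have p: "0 < p" "real CARD('n) + 1 \<le> real p * (1 - 2 * \<kappa>)"
  proof -
    have "0 < (real CARD('n) + 1) / (1 - 2 * \<kappa>)" using \<kappa> by (intro divide_pos_pos) auto
    then show "0 < p" by (simp add: p_def)
    have "(real CARD('n) + 1) / (1 - 2 * \<kappa>) \<le> real p" unfolding p_def by (rule real_nat_ceiling_ge)
    then show "real CARD('n) + 1 \<le> real p * (1 - 2 * \<kappa>)" using \<kappa> by (simp add: divide_le_eq)
  qed
  define l where "l = (\<lambda>q. 2 powr (- (real q * \<kappa>)))"
  define C where "C = fact (2 * p) / (2 ^ p * fact p) * (real CARD('n) * (2 ^ Suc m) ^ CARD('n)) ^ p"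
  define Dd where "Dd = (PiE UNIV (\<lambda>_. {0, 1::nat}) :: ('n \<Rightarrow> nat) set)"
  have finD: "finite Dd" unfolding Dd_def by (intro finite_PiE) auto
  define ev where "ev = (\<lambda>q a d j. {\<omega>\<in>space M. l q \<le> \<bar>W \<omega> (dyadic_point (Suc q) (\<lambda>k. 2 * a k + d k)) $ j - W \<omega> (dyadic_point q a) $ j\<bar>})"
  define A where "A = (\<lambda>q. if m \<le> q then \<Union>(a, d, j)\<in>dyadic_index m q \<times> Dd \<times> UNIV. ev q a d j else {})"
  have evm: "ev q a d j \<in> events" if "a \<in> dyadic_index m q" "m \<le> q" "d \<in> Dd" for q a d j
    unfolding ev_def using dyadic_increment_tail(1,2)[OF that(1,2), of d 1 1] that(3) measurable_coord by (auto simp: Dd_def)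
  have Am: "A q \<in> events" for q
    unfolding A_def using evm finite_dyadic_index[of m q] finD by (auto intro!: sets.finite_UN)
  define K where "K = (2 ^ Suc m) ^ CARD('n) * real (card Dd) * real CARD('d) * C"
  have C0: "0 \<le> C" by (simp add: C_def)
  have bound: "prob (A q) \<le> K * (1 / 2) ^ q" for q
  proof (cases "m \<le> q")
    case False
    then show ?thesis using C0 by (simp add: A_def K_def)
  next
    case True
    let ?I = "(dyadic_index m q :: ('n \<Rightarrow> nat) set) \<times> Dd \<times> (UNIV::'d set)"
    have lq: "0 < l q" by (simp add: l_def)
    have "prob (A q) \<le> (\<Sum>x\<in>?I. prob (case x of (a, d, j) \<Rightarrow> ev q a d j))"
      unfolding A_def using True evm finite_dyadic_index[of m q] finD
      by (simp, intro finite_measure_subadditive_finite) auto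
    also have "\<dots> \<le> (\<Sum>x\<in>?I. C * (1 / 2 ^ q) ^ p / l q ^ (2 * p))"
    proof (rule sum_mono)
      fix x assume x: "x \<in> ?I"
      obtain a d j where [simp]: "x = (a, d, j)" by (cases x) auto
      have "prob (ev q a d j) \<le> fact (2 * p) / (2 ^ p * fact p) * (real CARD('n) * (2 ^ Suc m) ^ CARD('n) / 2 ^ q) ^ p / l q ^ (2 * p)"
        unfolding ev_def using x by (intro dyadic_increment_tail True p lq) (auto simp: Dd_def)
      also have "(real CARD('n) * (2 ^ Suc m) ^ CARD('n) / 2 ^ q) ^ p = (real CARD('n) * (2 ^ Suc m) ^ CARD('n)) ^ p * (1 / 2 ^ q) ^ p"
        by (subst power_mult_distrib[symmetric]) simp
      finally show "prob (case x of (a, d, j) \<Rightarrow> ev q a d j) \<le> C * (1 / 2 ^ q) ^ p / l q ^ (2 * p)"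
        by (simp add: C_def mult.assoc)
    qed
    also have "\<dots> = real (card ?I) * (C * (1 / 2 ^ q) ^ p / l q ^ (2 * p))" by simp
    also have "\<dots> \<le> (2 ^ Suc (q + m)) ^ CARD('n) * (real (card Dd) * real CARD('d)) * (C * (1 / 2 ^ q) ^ p / l q ^ (2 * p))"
    proof (rule mult_right_mono)
      show "real (card ?I) \<le> (2 ^ Suc (q + m)) ^ CARD('n) * (real (card Dd) * real CARD('d))"
        using mult_right_mono[OF card_dyadic_index_le[of m q, where ?'n = 'n], of "real (card Dd) * real CARD('d)"]
        by (simp add: card_cartesian_product)
      show "0 \<le> C * (1 / 2 ^ q) ^ p / l q ^ (2 * p)" using C0 lq by simp
    qed
    also have "(2 ^ Suc (q + m)) ^ CARD('n) * (real (card Dd) * real CARD('d)) * (C * (1 / 2 ^ q) ^ p / l q ^ (2 * p))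
        = K * ((2 ^ q) ^ CARD('n) * (1 / 2 ^ q) ^ p / l q ^ (2 * p))"
      by (simp add: K_def power_add power_mult_distrib)
    also have "(2 ^ q) ^ CARD('n) * (1 / 2 ^ q) ^ p / l q ^ (2 * p) = 2 powr (real q * (real CARD('n) - real p * (1 - 2 * \<kappa>)))"
    proof -
      have "(2 ^ q) ^ CARD('n) = 2 powr (real q * real CARD('n))" "(1 / 2 ^ q) ^ p = 2 powr (- (real q * real p))"
        by (simp_all add: powr_realpow[symmetric] powr_powr powr_minus_divide power_divide)
      moreover have "l q ^ (2 * p) = 2 powr (- (real q * \<kappa>) * (2 * real p))"
        unfolding l_def by (subst powr_realpow[symmetric]) (auto simp: powr_powr)
      ultimately have "(2 ^ q) ^ CARD('n) * (1 / 2 ^ q) ^ p / l q ^ (2 * p)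
         = 2 powr (real q * real CARD('n) + - (real q * real p) - - (real q * \<kappa>) * (2 * real p))"
        by (simp only: powr_add powr_diff)
      then show ?thesis by (simp add: algebra_simps)
    qed
    also have "K * \<dots> \<le> K * 2 powr (real q * (- 1))"
      using p(2) C0 by (intro mult_left_mono powr_mono) (auto simp: K_def)
    also have "2 powr (real q * (- 1)) = (1 / 2) ^ q"
      by (simp add: powr_minus_divide powr_realpow power_divide)
    finally show ?thesis .
  qed
  have "summable (\<lambda>q. prob (A q))"
  proof (rule summable_comparison_test')
    show "summable (\<lambda>q. K * (1 / 2) ^ q)" by (intro summable_mult summable_geometric) simp
    show "norm (prob (A q)) \<le> K * (1 / 2) ^ q" for q using bound[of q] by simp
  qed
  then have "AE \<omega> in M. \<forall>\<^sub>F q in sequentially. \<omega> \<in> space M - A q"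
    using Am by (intro borel_cantelli_AE1) (auto simp: emeasure_eq_measure)
  then show ?thesis
  proof eventually_elim
    case (elim \<omega>)
    then show ?case
      using eventually_ge_at_top[of m]
    proof eventually_elim
      case (elim q)
      then show ?case by (auto simp: A_def ev_def l_def Dd_def not_le)
    qed
  qed
qed

text \<open>The increments telescope along the dyadic approximations up to the zero z, where
  continuity identifies the limit as 0. The geometric series gives 1 / (1 - 2^(-\<kappa>)), and
  passing from coordinates to the norm gives the factor d.\<close>

lemma zeros_near_grid_AE:
  fixes m :: nat and \<kappa> :: real
  assumes \<kappa>: "0 < \<kappa>" "\<kappa> < 1 / 2"
  shows "AE \<omega> in M. \<forall>\<^sub>F q in sequentially. \<forall>z\<in>dyadic_box m \<inter> sheet_zero_set W \<omega>.
     norm (W \<omega> (dyadic_point q (dyadic_floor q z))) \<le> real CARD('d) / (1 - 2 powr (- \<kappa>)) * 2 powr (- (real q * \<kappa>))"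
  using dyadic_increments_AE[OF \<kappa>, of m] continuous_AE
proof eventually_elim
  case (elim \<omega>)
  then obtain q0 where q0: "\<And>q a d j. q0 \<le> q \<Longrightarrow> a \<in> dyadic_index m q \<Longrightarrow> d \<in> PiE UNIV (\<lambda>_. {0, 1::nat}) \<Longrightarrow>
     \<bar>W \<omega> (dyadic_point (Suc q) (\<lambda>k. 2 * a k + d k)) $ j - W \<omega> (dyadic_point q a) $ j\<bar> < 2 powr (- (real q * \<kappa>))"
    unfolding eventually_sequentially by blast
  define x where "x = 2 powr (- \<kappa>)"
  have x: "0 < x" "x < 1" using \<kappa> by (auto simp: x_def powr_less_one)
  have xq: "2 powr (- (real q * \<kappa>)) = x ^ q" for q
    unfolding x_def by (subst powr_realpow[symmetric]) (auto simp: powr_powr mult.commute)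
  show ?case
    using eventually_ge_at_top[of "max m q0"]
  proof eventually_elim
    case (elim q)
    show ?case
    proof
      fix z assume z: "z \<in> dyadic_box m \<inter> sheet_zero_set W \<omega>"
      then have zp: "z \<in> pos_orthant" and Wz: "W \<omega> z = 0" by (auto simp: sheet_zero_set_def)
      let ?z = "\<lambda>q. dyadic_point q (dyadic_floor q z)"
      have step: "\<bar>W \<omega> (?z (Suc i)) $ j - W \<omega> (?z i) $ j\<bar> \<le> x ^ i" if "q \<le> i" for i j
      proof -
        define d where "d = (\<lambda>k. dyadic_floor (Suc i) z k - 2 * dyadic_floor i z k)"
        have "(\<lambda>k. 2 * dyadic_floor i z k + d k) = dyadic_floor (Suc i) z"
          using dyadic_floor_Suc(2)[OF zp] by (auto simp: d_def)
        moreover have "d k \<in> {0, 1}" for k unfolding d_def by (rule dyadic_floor_Suc(1)[OF zp])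
        then have "d \<in> PiE UNIV (\<lambda>_. {0, 1})" by (simp add: PiE_iff)
        moreover have "dyadic_floor i z \<in> dyadic_index m i" using z that elim by (intro dyadic_floor_index) auto
        ultimately show ?thesis using q0[of i "dyadic_floor i z" d j] that elim by (simp add: xq)
      qed
      have tele: "\<bar>W \<omega> (?z (q + i)) $ j - W \<omega> (?z q) $ j\<bar> \<le> (\<Sum>r<i. x ^ (q + r))" for i j
      proof (induction i)
        case (Suc i)
        then show ?case using step[of "q + i" j] by simp
      qed simp
      have geo: "(\<Sum>r<i. x ^ (q + r)) \<le> x ^ q / (1 - x)" for i
      proof -
        have "(\<Sum>r<i. x ^ (q + r)) = x ^ q * (\<Sum>r<i. x ^ r)" by (simp add: power_add sum_distrib_left)
        also have "(\<Sum>r<i. x ^ r) = (1 - x ^ i) / (1 - x)" using x by (simp add: sum_gp_strict)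
        also have "x ^ q * \<dots> \<le> x ^ q * (1 / (1 - x))" using x by (intro mult_left_mono divide_right_mono) auto
        finally show ?thesis by simp
      qed
      have coord: "\<bar>W \<omega> (?z q) $ j\<bar> \<le> x ^ q / (1 - x)" for j
      proof -
        have "(\<lambda>i. ?z (i + q)) \<longlonglongrightarrow> z" using dyadic_floor_tendsto[OF zp] by (rule LIMSEQ_ignore_initial_segment)
        then have "(\<lambda>i. W \<omega> (?z (i + q))) \<longlonglongrightarrow> W \<omega> z"
        proof (rule continuous_on_tendsto_compose[OF \<open>continuous_on pos_orthant (W \<omega>)\<close> _ zp])
          show "\<forall>\<^sub>F i in sequentially. ?z (i + q) \<in> pos_orthant"
            using z elim by (intro always_eventually allI dyadic_point_pos[of _ m] dyadic_floor_index) auto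
        qed
        then have "(\<lambda>i. W \<omega> (?z (i + q)) $ j) \<longlonglongrightarrow> W \<omega> z $ j" by (rule tendsto_vec_nth)
        then have "(\<lambda>i. \<bar>W \<omega> (?z (i + q)) $ j - W \<omega> (?z q) $ j\<bar>) \<longlonglongrightarrow> \<bar>W \<omega> z $ j - W \<omega> (?z q) $ j\<bar>"
          by (intro tendsto_rabs tendsto_diff tendsto_const)
        then have "\<bar>W \<omega> z $ j - W \<omega> (?z q) $ j\<bar> \<le> x ^ q / (1 - x)"
        proof (rule LIMSEQ_le_const2)
          have "\<bar>W \<omega> (?z (i + q)) $ j - W \<omega> (?z q) $ j\<bar> \<le> x ^ q / (1 - x)" for i
            using order_trans[OF tele[of i j] geo[of i]] by (simp add: add.commute)
          then show "\<exists>N. \<forall>i\<ge>N. \<bar>W \<omega> (?z (i + q)) $ j - W \<omega> (?z q) $ j\<bar> \<le> x ^ q / (1 - x)" by blast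
        qed
        then show ?thesis by (simp add: Wz)
      qed
      have "norm (W \<omega> (?z q)) \<le> (\<Sum>j\<in>UNIV. \<bar>W \<omega> (?z q) $ j\<bar>)" by (rule norm_le_l1_cart)
      also have "\<dots> \<le> (\<Sum>j\<in>(UNIV::'d set). x ^ q / (1 - x))" by (intro sum_mono coord)
      finally show "norm (W \<omega> (?z q)) \<le> real CARD('d) / (1 - 2 powr (- \<kappa>)) * 2 powr (- (real q * \<kappa>))"
        by (simp add: xq x_def[symmetric])
    qed
  qed
qed

end

section \<open>Lattice points in slabs\<close>

lemma orth_projD:
  assumes "orth_proj P"
  shows "linear P" "P (P x) = P x" "P x \<bullet> y = x \<bullet> P y" "norm (P x) \<le> norm x"
proof -
  show "linear P" "P (P x) = P x" and adj: "P x \<bullet> y = x \<bullet> P y" for x y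
    using assms by (auto simp: orth_proj_def fun_eq_iff)
  have "(norm (P x))\<^sup>2 = x \<bullet> P x"
    using \<open>P (P x) = P x\<close> adj[of x "P x"] by (simp add: power2_norm_eq_inner)
  also have "\<dots> \<le> norm x * norm (P x)" by (rule norm_cauchy_schwarz)
  finally show "norm (P x) \<le> norm x"
    by (cases "norm (P x) = 0") (auto simp: power2_eq_square)
qed

lemma card_le_fibers:
  assumes "finite A" "f ` A \<subseteq> B" "finite B" "\<And>y. y \<in> B \<Longrightarrow> card {x\<in>A. f x = y} \<le> k"
  shows "card A \<le> card B * k"
proof -
  have "card A = (\<Sum>y\<in>f ` A. card {x\<in>A. f x = y})"
    using sum.image_gen[OF assms(1), of "\<lambda>_. 1::nat" f] by simp
  also have "\<dots> \<le> (\<Sum>y\<in>f ` A. k)" using assms by (intro sum_mono) auto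
  also have "\<dots> \<le> (\<Sum>y\<in>B. k)" using assms by (intro sum_mono2) auto
  finally show ?thesis by simp
qed

definition lattice_vec :: "('n::finite \<Rightarrow> nat) \<Rightarrow> real^'n" where
  "lattice_vec a = (\<chi> k. real (a k))"

lemma lattice_ball:
  fixes A :: "('n::finite \<Rightarrow> nat) set" and E :: nat
  assumes "\<And>a. a \<in> A \<Longrightarrow> norm (lattice_vec a - lattice_vec a0) \<le> real E"
  shows "finite A" "card A \<le> (2 * E + 1) ^ CARD('n)"
proof -
  let ?B = "PiE (UNIV::'n set) (\<lambda>k. {a0 k - E..a0 k + E})"
  have sub: "A \<subseteq> ?B"
  proof
    fix a assume "a \<in> A"
    then have dk: "\<bar>real (a k) - real (a0 k)\<bar> \<le> real E" for k
      using assms component_le_norm_cart[of "lattice_vec a - lattice_vec a0" k]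
      by (fastforce simp: lattice_vec_def)
    have ab: "real (a0 k) \<le> real (a k + E)" "real (a k) \<le> real (a0 k + E)" for k
      using dk[of k] by (simp_all add: abs_le_iff)
    have "a0 k - E \<le> a k \<and> a k \<le> a0 k + E" for k
      using ab[of k] unfolding of_nat_le_iff by arith
    then show "a \<in> ?B" by (auto simp: PiE_iff)
  qed
  have fB: "finite ?B" by (intro finite_PiE) auto
  show "finite A" using sub fB by (rule finite_subset)
  have "card A \<le> card ?B" using sub fB by (intro card_mono)
  also have "\<dots> = (\<Prod>k\<in>(UNIV::'n set). Suc (a0 k + E) - (a0 k - E))" by (simp add: card_PiE)
  also have "\<dots> \<le> (\<Prod>k\<in>(UNIV::'n set). 2 * E + 1)" by (intro prod_mono) auto
  finally show "card A \<le> (2 * E + 1) ^ CARD('n)" by simp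
qed

lemma finite_lattice_ball: "finite {a. norm (lattice_vec a - y) \<le> \<rho>}"
proof (cases "{a. norm (lattice_vec a - y) \<le> \<rho>} = {}")
  case False
  then obtain a0 where a0: "norm (lattice_vec a0 - y) \<le> \<rho>" by auto
  have "norm (lattice_vec a - lattice_vec a0) \<le> real (nat \<lceil>2 * \<rho>\<rceil>)" if "norm (lattice_vec a - y) \<le> \<rho>" for a
  proof -
    have "norm (lattice_vec a - lattice_vec a0) \<le> norm (lattice_vec a - y) + norm (lattice_vec a0 - y)"
      using norm_triangle_ineq4[of "lattice_vec a - y" "lattice_vec a0 - y"] by simp
    also have "\<dots> \<le> real (nat \<lceil>2 * \<rho>\<rceil>)" using that a0 real_nat_ceiling_ge[of "2 * \<rho>"] by linarith
    finally show ?thesis .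
  qed
  then show ?thesis by (intro lattice_ball(1)[of _ a0]) auto
qed simp

definition kernel_dim :: "(real^'n \<Rightarrow> real^'n) \<Rightarrow> nat" where
  "kernel_dim P = dim {x. P x = 0}"

text \<open>Points of the slab are coded by the integer parts of their coordinates in an orthonormal basis of
  the kernel; the code has fibres of bounded size.\<close>
lemma lattice_slab_count:
  fixes P :: "real^'n \<Rightarrow> real^'n" and C0 :: nat and \<rho> :: real and x0 y :: "real^'n"
  assumes P: "orth_proj P" and rho: "1 \<le> \<rho>"
  defines "A \<equiv> {a. norm (P (lattice_vec a) - x0) \<le> real C0 \<and> norm (lattice_vec a - y) \<le> \<rho>}"
  shows "real (card A) \<le> (2 * (2 * C0 + CARD('n)) + 1) ^ CARD('n) * 4 ^ CARD('n) * \<rho> ^ kernel_dim P"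
proof -
  let ?K = "{x. P x = 0}"
  \<comment> \<open>A bound for the difference of two lattice points with the same code:
    \<open>2 * C0\<close> across the slab, and at most 1 for each of the at most N basis vectors of
    the kernel.\<close>
  let ?E = "2 * C0 + CARD('n)"
  note lin = orth_projD(1)[OF P]
  have sub: "subspace ?K" by (rule linear_subspace_kernel[OF lin])
  obtain B where B: "B \<subseteq> ?K" "pairwise orthogonal B" "\<And>x. x \<in> B \<Longrightarrow> norm x = 1" "independent B" "card B = dim ?K" "span B = ?K"
    using orthonormal_basis_subspace[OF sub] by metis
  have finB: "finite B" using B(4) by (rule independent_imp_finite)
  have cB: "card B = kernel_dim P" "card B \<le> CARD('n)"
    using B(5) dim_subset_UNIV_cart[of ?K] by (auto simp: kernel_dim_def)
  have finA: "finite A" unfolding A_def using finite_lattice_ball[of y \<rho>] by (rule rev_finite_subset) auto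
  define F where "F = (\<lambda>a. restrict (\<lambda>b. \<lfloor>lattice_vec a \<bullet> b\<rfloor>) B)"
  define T where "T = PiE B (\<lambda>b. {\<lfloor>y \<bullet> b - \<rho>\<rfloor>..\<lfloor>y \<bullet> b + \<rho>\<rfloor>})"
  have finT: "finite T" unfolding T_def using finB by (intro finite_PiE) auto
  have FT: "F ` A \<subseteq> T"
  proof
    fix g assume "g \<in> F ` A"
    then obtain a where a: "a \<in> A" "g = F a" by auto
    have "\<bar>(lattice_vec a - y) \<bullet> b\<bar> \<le> \<rho>" if "b \<in> B" for b
      using Cauchy_Schwarz_ineq2[of "lattice_vec a - y" b] a(1) B(3)[OF that] by (simp add: A_def)
    then have "y \<bullet> b - \<rho> \<le> lattice_vec a \<bullet> b \<and> lattice_vec a \<bullet> b \<le> y \<bullet> b + \<rho>" if "b \<in> B" for b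
      using that by (fastforce simp: inner_diff_left)
    then show "g \<in> T" unfolding a(2) F_def T_def by (auto intro!: floor_mono)
  qed
  have fib: "card {a\<in>A. F a = g} \<le> (2 * ?E + 1) ^ CARD('n)" for g
  proof (cases "{a\<in>A. F a = g} = {}")
    case True
    show ?thesis unfolding True by simp
  next
    case False
    then obtain a0 where a0: "a0 \<in> A" "F a0 = g" by auto
    show ?thesis
    proof (rule lattice_ball(2)[of _ a0])
      fix a assume a: "a \<in> {a\<in>A. F a = g}"
      define w where "w = lattice_vec a - lattice_vec a0"
      define v where "v = w - P w"
      have Pv: "v \<in> ?K" by (simp add: v_def linear_diff[OF lin] orth_projD(2)[OF P])
      have vb: "\<bar>v \<bullet> b\<bar> \<le> 1" if "b \<in> B" for b
      proof -
        have "P b = 0" using B(1) that by auto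
        then have "v \<bullet> b = w \<bullet> b" by (simp add: v_def inner_diff_left orth_projD(3)[OF P])
        moreover have "\<lfloor>lattice_vec a \<bullet> b\<rfloor> = \<lfloor>lattice_vec a0 \<bullet> b\<rfloor>"
          using a a0(2) that unfolding F_def by (metis (mono_tags, lifting) mem_Collect_eq restrict_apply')
        then have "\<bar>lattice_vec a \<bullet> b - lattice_vec a0 \<bullet> b\<bar> \<le> 1" by linarith
        ultimately show ?thesis by (simp add: w_def inner_diff_left)
      qed
      have "v = (\<Sum>b\<in>B. (v \<bullet> b) *\<^sub>R b)"
        using orthonormal_basis_expand[OF B(2,3) _ finB, of v] Pv B(6) by simp
      then have "norm v \<le> (\<Sum>b\<in>B. norm ((v \<bullet> b) *\<^sub>R b))" by (metis norm_sum)
      also have "\<dots> \<le> (\<Sum>b\<in>B. 1)" using vb B(3) by (intro sum_mono) simp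
      also have "\<dots> \<le> real CARD('n)" using cB(2) by simp
      finally have nv: "norm v \<le> real CARD('n)" .
      have "P w = (P (lattice_vec a) - x0) - (P (lattice_vec a0) - x0)"
        by (simp add: w_def linear_diff[OF lin])
      then have "norm (P w) \<le> norm (P (lattice_vec a) - x0) + norm (P (lattice_vec a0) - x0)"
        by (metis norm_triangle_ineq4)
      also have "\<dots> \<le> 2 * real C0" using a a0 by (simp add: A_def)
      finally have "norm (P w) \<le> 2 * real C0" .
      then have "norm w \<le> 2 * real C0 + real CARD('n)"
        using nv norm_triangle_ineq[of v "P w"] by (simp add: v_def)
      then show "norm (lattice_vec a - lattice_vec a0) \<le> real ?E" by (simp add: w_def)
    qed
  qed
  have "card A \<le> card T * (2 * ?E + 1) ^ CARD('n)"
    by (rule card_le_fibers[OF finA FT finT fib])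
  then have "real (card A) \<le> real (card T) * real ((2 * ?E + 1) ^ CARD('n))"
    by (metis of_nat_le_iff of_nat_mult)
  also have "real (card T) \<le> (4 * \<rho>) ^ card B"
  proof -
    have "real (card T) = (\<Prod>b\<in>B. real (card {\<lfloor>y \<bullet> b - \<rho>\<rfloor>..\<lfloor>y \<bullet> b + \<rho>\<rfloor>}))"
      unfolding T_def using finB by (simp add: card_PiE)
    also have "\<dots> \<le> (\<Prod>b\<in>B. 4 * \<rho>)"
    proof (intro prod_mono conjI)
      fix b
      have "\<lfloor>y \<bullet> b - \<rho>\<rfloor> \<le> \<lfloor>y \<bullet> b + \<rho>\<rfloor>" using rho by (intro floor_mono) auto
      then have "real (card {\<lfloor>y \<bullet> b - \<rho>\<rfloor>..\<lfloor>y \<bullet> b + \<rho>\<rfloor>}) = of_int (\<lfloor>y \<bullet> b + \<rho>\<rfloor> - \<lfloor>y \<bullet> b - \<rho>\<rfloor> + 1)" by simp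
      also have "\<dots> \<le> 4 * \<rho>" using rho by simp linarith
      finally show "real (card {\<lfloor>y \<bullet> b - \<rho>\<rfloor>..\<lfloor>y \<bullet> b + \<rho>\<rfloor>}) \<le> 4 * \<rho>" .
    qed auto
    finally show ?thesis by simp
  qed
  also have "(4 * \<rho>) ^ card B \<le> 4 ^ CARD('n) * \<rho> ^ kernel_dim P"
    using rho cB(2) unfolding power_mult_distrib cB(1)[symmetric]
    by (intro mult_right_mono power_increasing) auto
  finally have "real (card A) \<le> 4 ^ CARD('n) * \<rho> ^ kernel_dim P * real ((2 * ?E + 1) ^ CARD('n))"
    by (simp add: mult_right_mono)
  then show ?thesis by (simp add: ac_simps)
qed

text \<open>Each point is charged to the least dyadic radius containing it. If the count grows like
  radius^r, radius 2^j contributes about 2^(j (r - \<gamma>)). Bounding all J + 1 radii by the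
  largest contribution includes the critical case r = \<gamma>, at the price of the factor J +
  1.\<close>

lemma sum_max_powr_le:
  fixes \<rho> :: "'a \<Rightarrow> real" and \<gamma> :: real
  assumes fin: "finite S" and g: "0 \<le> \<gamma>" and C: "0 \<le> C"
    and count: "\<And>j. j \<le> J \<Longrightarrow> real (card {a\<in>S. \<rho> a \<le> 2 ^ j}) \<le> C * (2 ^ j) ^ r"
    and top: "\<And>a. a \<in> S \<Longrightarrow> \<rho> a \<le> 2 ^ J"
  shows "(\<Sum>a\<in>S. (max 1 (\<rho> a)) powr (- \<gamma>)) \<le> 2 powr \<gamma> * C * real (J + 1) * 2 powr (real J * max 0 (real r - \<gamma>))"
proof -
  have "(\<Sum>a\<in>S. (max 1 (\<rho> a)) powr (- \<gamma>)) \<le> (\<Sum>a\<in>S. \<Sum>j\<le>J. if \<rho> a \<le> 2 ^ j then 2 powr \<gamma> * 2 powr (- (real j * \<gamma>)) else 0)"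
  proof (rule sum_mono)
    fix a assume a: "a \<in> S"
    define j where "j = (LEAST j. \<rho> a \<le> 2 ^ j)"
    have j1: "\<rho> a \<le> 2 ^ j" unfolding j_def using top[OF a] by (rule LeastI)
    have j2: "j \<le> J" unfolding j_def using top[OF a] by (rule Least_le)
    have "2 ^ j / 2 \<le> max 1 (\<rho> a)"
    proof (cases j)
      case (Suc i)
      then have "\<not> \<rho> a \<le> 2 ^ i" unfolding j_def by (metis lessI not_less_Least)
      then show ?thesis using Suc by simp
    qed simp
    then have "(max 1 (\<rho> a)) powr (- \<gamma>) \<le> (2 ^ j / 2) powr (- \<gamma>)" using g by (intro powr_mono2') auto
    also have "(2 ^ j / 2 :: real) = 2 powr (real j - 1)" by (simp add: powr_diff powr_realpow)
    also have "\<dots> powr (- \<gamma>) = 2 powr \<gamma> * 2 powr (- (real j * \<gamma>))"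
      by (simp add: powr_powr powr_add[symmetric] algebra_simps)
    also have "\<dots> = (\<Sum>i\<in>{j}. if \<rho> a \<le> 2 ^ i then 2 powr \<gamma> * 2 powr (- (real i * \<gamma>)) else 0)" using j1 by simp
    also have "\<dots> \<le> (\<Sum>i\<le>J. if \<rho> a \<le> 2 ^ i then 2 powr \<gamma> * 2 powr (- (real i * \<gamma>)) else 0)"
      using j2 by (intro sum_mono2) auto
    finally show "(max 1 (\<rho> a)) powr (- \<gamma>) \<le> (\<Sum>i\<le>J. if \<rho> a \<le> 2 ^ i then 2 powr \<gamma> * 2 powr (- (real i * \<gamma>)) else 0)" .
  qed
  also have "\<dots> = (\<Sum>j\<le>J. \<Sum>a\<in>S. if \<rho> a \<le> 2 ^ j then 2 powr \<gamma> * 2 powr (- (real j * \<gamma>)) else 0)" by (rule sum.swap)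
  also have "\<dots> \<le> (\<Sum>j\<le>J. 2 powr \<gamma> * C * 2 powr (real J * max 0 (real r - \<gamma>)))"
  proof (rule sum_mono)
    fix j assume "j \<in> {..J}"
    then have j: "j \<le> J" by simp
    have "(\<Sum>a\<in>S. if \<rho> a \<le> 2 ^ j then 2 powr \<gamma> * 2 powr (- (real j * \<gamma>)) else 0) = real (card {a\<in>S. \<rho> a \<le> 2 ^ j}) * (2 powr \<gamma> * 2 powr (- (real j * \<gamma>)))"
      using fin by (simp add: sum.inter_filter[symmetric])
    also have "\<dots> \<le> C * (2 ^ j) ^ r * (2 powr \<gamma> * 2 powr (- (real j * \<gamma>)))"
      using count[OF j] by (intro mult_right_mono) auto
    also have "(2 ^ j) ^ r = (2::real) powr (real j * real r)" by (simp add: powr_realpow[symmetric] powr_powr)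
    also have "C * 2 powr (real j * real r) * (2 powr \<gamma> * 2 powr (- (real j * \<gamma>))) = 2 powr \<gamma> * C * 2 powr (real j * (real r - \<gamma>))"
    proof -
      have "real j * (real r - \<gamma>) = real j * real r + - (real j * \<gamma>)" by (simp add: right_diff_distrib)
      then show ?thesis by (simp only: powr_add ac_simps)
    qed
    also have "\<dots> \<le> 2 powr \<gamma> * C * 2 powr (real J * max 0 (real r - \<gamma>))"
    proof (intro mult_left_mono powr_mono)
      have "real j * (real r - \<gamma>) \<le> real j * max 0 (real r - \<gamma>)" by (intro mult_left_mono) auto
      also have "\<dots> \<le> real J * max 0 (real r - \<gamma>)" using j by (intro mult_right_mono) auto
      finally show "real j * (real r - \<gamma>) \<le> real J * max 0 (real r - \<gamma>)" .
    qed (use C in auto)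
    finally show "(\<Sum>a\<in>S. if \<rho> a \<le> 2 ^ j then 2 powr \<gamma> * 2 powr (- (real j * \<gamma>)) else 0) \<le> 2 powr \<gamma> * C * 2 powr (real J * max 0 (real r - \<gamma>))" .
  qed
  also have "\<dots> = 2 powr \<gamma> * C * real (J + 1) * 2 powr (real J * max 0 (real r - \<gamma>))" by simp
  finally show ?thesis .
qed

text \<open>Factor i depends on the earlier entries and on its own argument only, so the entries of
  a tuple can be summed out from the last one backwards.\<close>

lemma sum_PiE_prod_le:
  fixes \<Phi> :: "nat \<Rightarrow> (nat \<Rightarrow> 'a) \<Rightarrow> 'a \<Rightarrow> real"
  assumes fin: "finite S" and nonneg: "\<And>i f a. 0 \<le> \<Phi> i f a"
    and cong: "\<And>i f g a. (\<And>p. p < i \<Longrightarrow> f p = g p) \<Longrightarrow> \<Phi> i f a = \<Phi> i g a"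
    and le: "\<And>i f. i < k \<Longrightarrow> f \<in> PiE {..<i} (\<lambda>_. S) \<Longrightarrow> (\<Sum>a\<in>S. \<Phi> i f a) \<le> L"
  shows "(\<Sum>f\<in>PiE {..<k} (\<lambda>_. S). \<Prod>i<k. \<Phi> i f (f i)) \<le> L ^ k"
  using le
proof (induction k)
  case (Suc k)
  have finP: "finite (PiE {..<k} (\<lambda>_. S))" using fin by (intro finite_PiE) auto
  have inj: "inj_on (\<lambda>(y, g). g(k := y)) (S \<times> PiE {..<k} (\<lambda>_. S))"
    using inj_combinator[of k "{..<k}" "\<lambda>_. S"] by simp
  have "(\<Sum>f\<in>PiE {..<Suc k} (\<lambda>_. S). \<Prod>i<Suc k. \<Phi> i f (f i))
      = (\<Sum>(y, g)\<in>S \<times> PiE {..<k} (\<lambda>_. S). \<Prod>i<Suc k. \<Phi> i (g(k := y)) ((g(k := y)) i))"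
    unfolding lessThan_Suc PiE_insert_eq using inj by (subst sum.reindex) (auto simp: split_beta' o_def)
  also have "\<dots> = (\<Sum>(y, g)\<in>S \<times> PiE {..<k} (\<lambda>_. S). (\<Prod>i<k. \<Phi> i g (g i)) * \<Phi> k g y)"
  proof (intro sum.cong refl, clarify)
    fix y g
    have "(\<Prod>i<k. \<Phi> i (g(k := y)) ((g(k := y)) i)) = (\<Prod>i<k. \<Phi> i g (g i))"
    proof (intro prod.cong refl)
      fix i assume "i \<in> {..<k}"
      then show "\<Phi> i (g(k := y)) ((g(k := y)) i) = \<Phi> i g (g i)" using cong[of i "g(k := y)" g] by auto
    qed
    moreover have "\<Phi> k (g(k := y)) y = \<Phi> k g y" by (rule cong) auto
    ultimately show "(\<Prod>i<Suc k. \<Phi> i (g(k := y)) ((g(k := y)) i)) = (\<Prod>i<k. \<Phi> i g (g i)) * \<Phi> k g y" by simp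
  qed
  also have "\<dots> = (\<Sum>g\<in>PiE {..<k} (\<lambda>_. S). (\<Prod>i<k. \<Phi> i g (g i)) * (\<Sum>y\<in>S. \<Phi> k g y))"
    unfolding sum.cartesian_product[symmetric] by (subst sum.swap) (simp add: sum_distrib_left)
  also have "\<dots> \<le> (\<Sum>g\<in>PiE {..<k} (\<lambda>_. S). (\<Prod>i<k. \<Phi> i g (g i)) * L)"
    using Suc.prems nonneg by (intro sum_mono mult_left_mono) (auto intro!: prod_nonneg)
  also have "\<dots> = (\<Sum>g\<in>PiE {..<k} (\<lambda>_. S). \<Prod>i<k. \<Phi> i g (g i)) * L" by (simp add: sum_distrib_right)
  also have "\<dots> \<le> L ^ k * L"
  proof (cases "PiE {..<k} (\<lambda>_. S) = {}")
    case True
    then have "k \<noteq> 0" "S = {}" by (auto simp: PiE_eq_empty_iff)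
    \<comment> \<open>For empty S the hypothesis at the empty prefix reads 0 \<le> L.\<close>
    then have "0 \<le> L" using Suc.prems[of 0 "\<lambda>_. undefined"] by simp
    then show ?thesis using True by simp
  next
    case False
    then obtain g where "g \<in> PiE {..<k} (\<lambda>_. S)" by auto
    then have "0 \<le> L" using Suc.prems[of k g] nonneg by (meson lessI order_trans sum_nonneg)
    then show ?thesis using Suc by (intro mult_right_mono) auto
  qed
  finally show ?case by (simp add: mult.commute)
qed simp

section \<open>Moments of the number of hits in a slab\<close>

text \<open>The distance to the mixed points is normalised so that it bounds the smallest coordinatewise gap
  from below in some direction.\<close>
definition mixed_point :: "(nat \<Rightarrow> real^'n) \<Rightarrow> ('n::finite \<Rightarrow> nat) \<Rightarrow> real^'n" where
  "mixed_point u g = (\<chi> j. u (g j) $ j)"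

definition mixed_dist :: "(nat \<Rightarrow> real^'n) \<Rightarrow> nat \<Rightarrow> real^'n::finite \<Rightarrow> real" where
  "mixed_dist u i t = Min ((\<lambda>g. norm (t - mixed_point u g) / real CARD('n)) ` PiE UNIV (\<lambda>_. {..i}))"

lemma finite_mixed: "finite (PiE (UNIV::'n::finite set) (\<lambda>_. {..i::nat}))"
  by (intro finite_PiE) auto

lemma mixed_nonempty: "PiE (UNIV::'n::finite set) (\<lambda>_. {..i::nat}) \<noteq> {}"
  by (auto simp: PiE_eq_empty_iff)

lemma mixed_dist_nonneg: "0 \<le> mixed_dist u i t"
  unfolding mixed_dist_def using mixed_nonempty finite_mixed by (subst Min_ge_iff) auto

text \<open>Take in each coordinate the nearest of the given points; these choices define one mixed
  point y. Since the norm is at most the sum of the absolute coordinates, some coordinate of t - y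
  is at least norm (t - y) / N, and in that direction all given points are at least as far
  away.\<close>

lemma mixed_dist_gap:
  fixes t :: "real^'n"
  shows "\<exists>j. \<forall>p\<le>i. mixed_dist u i t \<le> \<bar>t $ j - u p $ j\<bar>"
proof -
  have "\<exists>p\<le>i. \<forall>p'\<le>i. \<bar>t $ j - u p $ j\<bar> \<le> \<bar>t $ j - u p' $ j\<bar>" for j
  proof -
    have "Min ((\<lambda>p. \<bar>t $ j - u p $ j\<bar>) ` {..i}) \<in> (\<lambda>p. \<bar>t $ j - u p $ j\<bar>) ` {..i}" by (intro Min_in) auto
    then obtain p where "p \<le> i" "\<bar>t $ j - u p $ j\<bar> = Min ((\<lambda>p. \<bar>t $ j - u p $ j\<bar>) ` {..i})" by fastforce
    then show ?thesis by (intro exI[of _ p]) auto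
  qed
  then obtain g where g: "\<And>j. g j \<le> i" "\<And>j p'. p' \<le> i \<Longrightarrow> \<bar>t $ j - u (g j) $ j\<bar> \<le> \<bar>t $ j - u p' $ j\<bar>" by metis
  have gP: "g \<in> PiE UNIV (\<lambda>_. {..i})" using g(1) by (simp add: PiE_iff)
  let ?y = "mixed_point u g"
  have le: "mixed_dist u i t \<le> norm (t - ?y) / real CARD('n)"
    unfolding mixed_dist_def using gP finite_mixed by (intro Min_le) auto
  have "\<exists>j. norm (t - ?y) / real CARD('n) \<le> \<bar>(t - ?y) $ j\<bar>"
  proof (rule ccontr)
    assume "\<not> ?thesis"
    then have "(\<Sum>j\<in>UNIV. \<bar>(t - ?y) $ j\<bar>) < (\<Sum>j\<in>(UNIV::'n set). norm (t - ?y) / real CARD('n))"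
      by (intro sum_strict_mono) (auto simp: not_le)
    then have "(\<Sum>j\<in>UNIV. \<bar>(t - ?y) $ j\<bar>) < norm (t - ?y)" by simp
    then show False using norm_le_l1_cart[of "t - ?y"] by simp
  qed
  then obtain j where "norm (t - ?y) / real CARD('n) \<le> \<bar>t $ j - u (g j) $ j\<bar>" by (auto simp: mixed_point_def)
  then have "mixed_dist u i t \<le> \<bar>t $ j - u p $ j\<bar>" if "p \<le> i" for p using le g(2)[OF that, of j] by linarith
  then show ?thesis by blast
qed

text \<open>The nearest mixed point varies with t. Summing over all (i + 1)^N mixed points leaves
  sums with a fixed centre, to which the lattice count applies.\<close>

lemma mixed_dist_sum_bound:
  fixes t :: "real^'n" and \<phi> :: "real \<Rightarrow> real"
  assumes "\<And>x. 0 \<le> \<phi> x"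
  shows "\<phi> (mixed_dist u i t) \<le> (\<Sum>g\<in>PiE UNIV (\<lambda>_. {..i}). \<phi> (norm (t - mixed_point u g) / real CARD('n)))"
proof -
  have "mixed_dist u i t \<in> (\<lambda>g. norm (t - mixed_point u g) / real CARD('n)) ` PiE UNIV (\<lambda>_. {..i})"
    unfolding mixed_dist_def using mixed_nonempty finite_mixed by (intro Min_in) auto
  then obtain g where g: "g \<in> PiE UNIV (\<lambda>_. {..i})" "mixed_dist u i t = norm (t - mixed_point u g) / real CARD('n)" by auto
  show ?thesis unfolding g(2)
    using g(1) finite_mixed assms by (intro member_le_sum) auto
qed

text \<open>With the origin in front, \<open>mixed_dist\<close> also bounds the coordinate of t
  itself, as the condition \<open>\<rho> i \<le> t i $ j\<close> of the small-value estimate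
  requires, and the first point of a tuple needs no separate treatment.\<close>

definition with_origin :: "(nat \<Rightarrow> real^'n) \<Rightarrow> nat \<Rightarrow> real^'n" where
  "with_origin t p = (if p = 0 then 0 else t (p - 1))"

lemma mixed_dist_cong:
  assumes "\<And>p. p \<le> i \<Longrightarrow> u p = v p"
  shows "mixed_dist u i t = mixed_dist v i t"
proof -
  have "mixed_point u g = mixed_point v g" if "g \<in> PiE UNIV (\<lambda>_. {..i})" for g
    using that assms by (auto simp: mixed_point_def vec_eq_iff PiE_iff)
  then show ?thesis unfolding mixed_dist_def by (intro arg_cong[where f = Min] image_cong) auto
qed

lemma dyadic_point_lattice: "dyadic_point q a = (1 / 2 ^ q) *\<^sub>R lattice_vec a"
  by (simp add: dyadic_point_def lattice_vec_def vec_eq_iff)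

text \<open>One factor of the small-value estimate as a function of the gap x. In use,
  \<open>\<gamma>\<close> is d/2 and \<open>c\<close> contains the inverse square of the threshold
  for the norm of W.\<close>

definition hit_factor :: "real \<Rightarrow> real \<Rightarrow> real \<Rightarrow> real" where
  "hit_factor \<gamma> c x = exp (1/2) * (max 1 (c * x)) powr (- \<gamma>)"

lemma hit_factor_nonneg: "0 \<le> hit_factor \<gamma> c x"
  by (simp add: hit_factor_def)

text \<open>Separates scale from geometry: the enlargement of the threshold beyond its natural size
  is collected in \<open>w\<close>, and what remains is a function on the integer lattice.\<close>

lemma hit_factor_le:
  assumes "0 < c" "0 \<le> \<gamma>" "0 < w" "1 \<le> w" "0 \<le> \<rho>"
  shows "hit_factor \<gamma> (c / w) \<rho> \<le> exp (1/2) * (w / min 1 c) powr \<gamma> * (max 1 \<rho>) powr (- \<gamma>)"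
proof -
  have c3: "0 < min 1 c" using assms by simp
  have "min 1 c / w * max 1 \<rho> \<le> max 1 (c / w * \<rho>)"
  proof (cases "1 \<le> \<rho>")
    case True
    have "min 1 c / w * \<rho> \<le> c / w * \<rho>" using assms by (intro mult_right_mono divide_right_mono) auto
    then show ?thesis using True by simp
  next
    case False
    have "min 1 c / w \<le> 1 / 1" using assms by (intro frac_le) auto
    then show ?thesis using False by simp
  qed
  moreover have "0 < min 1 c / w * max 1 \<rho>" using c3 assms by (intro mult_pos_pos divide_pos_pos) auto
  ultimately have "(max 1 (c / w * \<rho>)) powr (- \<gamma>) \<le> (min 1 c / w * max 1 \<rho>) powr (- \<gamma>)"
    using assms by (intro powr_mono2') auto
  also have "\<dots> = (min 1 c / w) powr (- \<gamma>) * (max 1 \<rho>) powr (- \<gamma>)" by (rule powr_mult)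
  also have "(min 1 c / w) powr (- \<gamma>) = (w / min 1 c) powr \<gamma>"
    using c3 assms by (simp add: powr_minus powr_divide)
  finally show ?thesis by (simp add: hit_factor_def mult.assoc)
qed

lemma dyadic_slab_sum_le:
  fixes P :: "real^'n \<Rightarrow> real^'n" and C0 m q :: nat and y x0 :: "real^'n" and \<gamma> c w :: real
  defines "S \<equiv> {a \<in> dyadic_index m q. norm (P (dyadic_point q a) - x0) \<le> real C0 / 2 ^ q}"
  defines "C1 \<equiv> (2 * (2 * real C0 + real CARD('n)) + 1) ^ CARD('n) * 4 ^ CARD('n)"
  assumes P: "orth_proj P" and mq: "m \<le> q" and g: "0 \<le> \<gamma>" and c: "0 < c" and w: "1 \<le> w"
    and y: "\<And>j. 0 \<le> y $ j" "\<And>j. y $ j \<le> 2 ^ m"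
  shows "(\<Sum>a\<in>S. hit_factor \<gamma> (c / w * 2 ^ q) (norm (dyadic_point q a - y)))
    \<le> exp (1/2) * (w / min 1 c) powr \<gamma> * (2 powr \<gamma> * C1 * real (q + m + CARD('n) + 1) * 2 powr (real (q + m + CARD('n)) * max 0 (real (kernel_dim P) - \<gamma>)))"
proof -
  note lin = orth_projD(1)[OF P]
  define \<rho> where "\<rho> = (\<lambda>a. norm (lattice_vec a - 2 ^ q *\<^sub>R y))"
  have rho: "\<rho> a = 2 ^ q * norm (dyadic_point q a - y)" for a
  proof -
    have "lattice_vec a - 2 ^ q *\<^sub>R y = 2 ^ q *\<^sub>R (dyadic_point q a - y)"
      by (simp add: dyadic_point_lattice algebra_simps)
    then show ?thesis by (simp add: \<rho>_def)
  qed
  have fin: "finite S" unfolding S_def by (rule finite_subset[OF _ finite_dyadic_index[of m q]]) auto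
  \<comment> \<open>Grid points and centres have coordinates in [0, 2^m], so after scaling by 2^q
    distances are at most 2^q N 2^m, and N < 2^N.\<close>
  let ?J = "q + m + CARD('n)"
  have "(\<Sum>a\<in>S. hit_factor \<gamma> (c / w * 2 ^ q) (norm (dyadic_point q a - y))) = (\<Sum>a\<in>S. hit_factor \<gamma> (c / w) (\<rho> a))"
    by (intro sum.cong refl) (simp add: hit_factor_def rho mult.assoc)
  also have "\<dots> \<le> (\<Sum>a\<in>S. exp (1/2) * (w / min 1 c) powr \<gamma> * (max 1 (\<rho> a)) powr (- \<gamma>))"
    using c g w by (intro sum_mono hit_factor_le) (auto simp: \<rho>_def)
  also have "\<dots> = exp (1/2) * (w / min 1 c) powr \<gamma> * (\<Sum>a\<in>S. (max 1 (\<rho> a)) powr (- \<gamma>))"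
    by (simp add: sum_distrib_left)
  also have "\<dots> \<le> exp (1/2) * (w / min 1 c) powr \<gamma> * (2 powr \<gamma> * C1 * real (?J + 1) * 2 powr (real ?J * max 0 (real (kernel_dim P) - \<gamma>)))"
  proof (intro mult_left_mono sum_max_powr_le fin g)
    show "0 \<le> C1" by (simp add: C1_def)
    fix j :: nat
    have lp: "norm (P (lattice_vec a) - 2 ^ q *\<^sub>R x0) \<le> real C0" if "a \<in> S" for a
    proof -
      have "P (lattice_vec a) - 2 ^ q *\<^sub>R x0 = 2 ^ q *\<^sub>R (P (dyadic_point q a) - x0)"
        by (simp add: dyadic_point_lattice linear_cmul[OF lin] algebra_simps)
      then have "norm (P (lattice_vec a) - 2 ^ q *\<^sub>R x0) = 2 ^ q * norm (P (dyadic_point q a) - x0)" by simp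
      also have "\<dots> \<le> 2 ^ q * (real C0 / 2 ^ q)" using that by (intro mult_left_mono) (auto simp: S_def)
      finally show ?thesis by simp
    qed
    let ?A = "{a. norm (P (lattice_vec a) - 2 ^ q *\<^sub>R x0) \<le> real C0 \<and> norm (lattice_vec a - 2 ^ q *\<^sub>R y) \<le> 2 ^ j}"
    have "finite ?A" using finite_lattice_ball[of "2 ^ q *\<^sub>R y" "2 ^ j"] by (rule rev_finite_subset) auto
    then have "card {a\<in>S. \<rho> a \<le> 2 ^ j} \<le> card ?A" using lp by (intro card_mono) (auto simp: \<rho>_def)
    then have "real (card {a\<in>S. \<rho> a \<le> 2 ^ j}) \<le> real (card ?A)" by simp
    also have "\<dots> \<le> C1 * (2 ^ j) ^ kernel_dim P"
      using lattice_slab_count[OF P, of "2 ^ j" "2 ^ q *\<^sub>R x0" C0 "2 ^ q *\<^sub>R y"]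
      by (simp add: C1_def add.commute add.left_commute)
    finally show "real (card {a\<in>S. \<rho> a \<le> 2 ^ j}) \<le> C1 * (2 ^ j) ^ kernel_dim P" .
  next
    fix a assume a: "a \<in> S"
    have "norm (dyadic_point q a - y) \<le> (\<Sum>j\<in>UNIV. \<bar>(dyadic_point q a - y) $ j\<bar>)" by (rule norm_le_l1_cart)
    also have "\<dots> \<le> (\<Sum>j\<in>(UNIV::'n set). 2 ^ m)"
    proof (rule sum_mono)
      fix j
      have "1 / 2 ^ m \<le> dyadic_point q a $ j" "dyadic_point q a $ j \<le> 2 ^ m"
        using a mq by (auto simp: S_def intro: dyadic_point_bounds)
      moreover from this(1) have "0 \<le> dyadic_point q a $ j" by (rule order_trans[rotated]) simp
      ultimately show "\<bar>(dyadic_point q a - y) $ j\<bar> \<le> 2 ^ m" using y[of j] by (simp add: abs_le_iff)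
    qed
    also have "\<dots> = real CARD('n) * 2 ^ m" by simp
    also have "\<dots> \<le> 2 ^ CARD('n) * 2 ^ m"
      by (intro mult_right_mono) (auto simp: less_imp_le of_nat_less_two_power)
    finally have "2 ^ q * norm (dyadic_point q a - y) \<le> 2 ^ q * (2 ^ CARD('n) * 2 ^ m)" by (intro mult_left_mono) auto
    then show "\<rho> a \<le> 2 ^ ?J" by (simp add: rho power_add ac_simps)
  qed auto
  finally show ?thesis .
qed

context brownian
begin

text \<open>The k-th power of the number of hits counts k-tuples of hits, so its mean is a sum of
  joint small-value probabilities. Each entry, summed with the earlier ones fixed, costs at most
  \<Lambda>, and Markov's inequality is applied to the k-th power.\<close>

lemma hits_tail:
  fixes S :: "('n \<Rightarrow> nat) set" and \<eta> h \<Lambda> :: real and k m q :: nat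
  defines "\<gamma> \<equiv> real CARD('d) / 2"
  defines "c \<equiv> (1 / 2 ^ m) ^ (CARD('n) - 1) / (2 * \<eta>\<^sup>2)"
  assumes S: "S \<subseteq> dyadic_index m q" "m \<le> q" and eta: "0 < \<eta>" and l: "0 < h"
    and sum_le: "\<And>i f. i < k \<Longrightarrow> f \<in> PiE {..<i} (\<lambda>_. S) \<Longrightarrow>
      (\<Sum>a\<in>S. hit_factor \<gamma> c (mixed_dist (with_origin (\<lambda>p. dyadic_point q (f p))) i (dyadic_point q a))) \<le> \<Lambda>"
  shows "{\<omega>\<in>space M. h \<le> real (card {a\<in>S. norm (W \<omega> (dyadic_point q a)) \<le> \<eta>})} \<in> events"
    "prob {\<omega>\<in>space M. h \<le> real (card {a\<in>S. norm (W \<omega> (dyadic_point q a)) \<le> \<eta>})} \<le> (\<Lambda> / h) ^ k"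
proof -
  define H where "H = (\<lambda>\<omega>. card {a\<in>S. norm (W \<omega> (dyadic_point q a)) \<le> \<eta>})"
  have finS: "finite S" using S(1) finite_dyadic_index by (rule finite_subset)
  have pos: "dyadic_point q a \<in> pos_orthant" if "a \<in> S" for a
    using that S by (intro dyadic_point_pos[of a m]) auto
  define B where "B = (\<lambda>a. {\<omega>\<in>space M. norm (W \<omega> (dyadic_point q a)) \<le> \<eta>})"
  have Bm: "B a \<in> events" if "a \<in> S" for a
    unfolding B_def using measurable_W[OF pos[OF that]] by measurable
  have H_sum: "real (H \<omega>) = (\<Sum>a\<in>S. indicator (B a) \<omega>)" if "\<omega> \<in> space M" for \<omega>
  proof -
    have "(\<Sum>a\<in>S. indicator (B a) \<omega> :: real) = (\<Sum>a\<in>S. if norm (W \<omega> (dyadic_point q a)) \<le> \<eta> then 1 else 0)"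
      using that by (intro sum.cong) (auto simp: B_def indicator_def)
    also have "\<dots> = real (H \<omega>)" using finS by (simp add: H_def sum.inter_filter[symmetric])
    finally show ?thesis by simp
  qed
  have Hm: "(\<lambda>\<omega>. real (H \<omega>)) \<in> borel_measurable M"
  proof -
    have "(\<lambda>\<omega>. \<Sum>a\<in>S. indicator (B a) \<omega> :: real) \<in> borel_measurable M"
      using Bm by (intro borel_measurable_sum borel_measurable_indicator) auto
    then show ?thesis using H_sum by (subst measurable_cong[of M _ "\<lambda>\<omega>. \<Sum>a\<in>S. indicator (B a) \<omega>"]) auto
  qed
  then show "{\<omega>\<in>space M. h \<le> real (card {a\<in>S. norm (W \<omega> (dyadic_point q a)) \<le> \<eta>})} \<in> events"
    using borel_measurable_le[OF borel_measurable_const Hm, of h] by (simp only: H_def)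
  define Q where "Q = (\<lambda>f. {\<omega>\<in>space M. \<forall>i<k. norm (W \<omega> (dyadic_point q (f i))) \<le> \<eta>})"
  let ?F = "PiE {..<k} (\<lambda>_. S)"
  have finF: "finite ?F" using finS by (intro finite_PiE) auto
  have Qm: "Q f \<in> events" if "f \<in> ?F" for f
  proof -
    have "space M - (\<Union>i\<in>{..<k}. space M - B (f i)) \<in> events"
      using Bm that by (intro sets.compl_sets sets.finite_UN) (auto simp: PiE_iff)
    also have "space M - (\<Union>i\<in>{..<k}. space M - B (f i)) = Q f" by (auto simp: Q_def B_def)
    finally show ?thesis .
  qed
  have Hk: "real (H \<omega>) ^ k = (\<Sum>f\<in>?F. indicator (Q f) \<omega>)" if w: "\<omega> \<in> space M" for \<omega>
  proof -
    let ?S' = "{a\<in>S. norm (W \<omega> (dyadic_point q a)) \<le> \<eta>}"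
    have "(\<Sum>f\<in>?F. indicator (Q f) \<omega> :: real) = (\<Sum>f\<in>?F. if \<forall>i<k. norm (W \<omega> (dyadic_point q (f i))) \<le> \<eta> then 1 else 0)"
      using w by (intro sum.cong) (auto simp: Q_def indicator_def)
    also have "\<dots> = real (card {f\<in>?F. \<forall>i<k. norm (W \<omega> (dyadic_point q (f i))) \<le> \<eta>})"
      using finF by (simp add: sum.inter_filter[symmetric])
    also have "{f\<in>?F. \<forall>i<k. norm (W \<omega> (dyadic_point q (f i))) \<le> \<eta>} = PiE {..<k} (\<lambda>_. ?S')"
      unfolding set_eq_iff mem_Collect_eq PiE_iff by blast
    also have "card \<dots> = H \<omega> ^ k" by (simp add: card_PiE H_def)
    finally show ?thesis by simp
  qed
  have intk: "integrable M (\<lambda>\<omega>. \<Sum>f\<in>?F. indicator (Q f) \<omega> :: real)"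
    using Qm by (intro Bochner_Integration.integrable_sum integrable_const_bound[where B = 1] AE_I2 borel_measurable_indicator) auto
  have "expectation (\<lambda>\<omega>. real (H \<omega>) ^ k) = expectation (\<lambda>\<omega>. \<Sum>f\<in>?F. indicator (Q f) \<omega>)"
    using Hk by (intro Bochner_Integration.integral_cong) auto
  also have "\<dots> = (\<Sum>f\<in>?F. prob (Q f))"
  proof -
    have "expectation (\<lambda>\<omega>. \<Sum>f\<in>?F. indicator (Q f) \<omega> :: real) = (\<Sum>f\<in>?F. expectation (indicator (Q f)))"
      using Qm by (intro Bochner_Integration.integral_sum integrable_const_bound[where B = 1] AE_I2 borel_measurable_indicator) auto
    also have "\<dots> = (\<Sum>f\<in>?F. prob (Q f))"
      using Qm by (intro sum.cong) auto
    finally show ?thesis .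
  qed
  also have "\<dots> \<le> (\<Sum>f\<in>?F. \<Prod>i<k. hit_factor \<gamma> c (mixed_dist (with_origin (\<lambda>p. dyadic_point q (f p))) i (dyadic_point q (f i))))"
  proof (rule sum_mono)
    fix f assume f: "f \<in> ?F"
    define t where "t = (\<lambda>p. dyadic_point q (f p))"
    have Qt: "Q f = {\<omega>\<in>space M. \<forall>i<k. norm (W \<omega> (t i)) \<le> \<eta>}" by (simp add: Q_def t_def)
    define \<rho> where "\<rho> = (\<lambda>i. mixed_dist (with_origin t) i (t i))"
    have tS: "f i \<in> dyadic_index m q" if "i < k" for i using f S(1) that by (auto simp: PiE_iff)
    have "prob (Q f) \<le> (\<Prod>i<k. exp (1/2) * (max 1 ((1 / 2 ^ m) ^ (CARD('n) - 1) * \<rho> i / (2 * \<eta>\<^sup>2))) powr (- real CARD('d) / 2))"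
      unfolding Qt
    proof (rule prob_small_values_le[where a = "1 / 2 ^ m" and \<rho> = \<rho> and t = t])
      show "1 / 2 ^ m \<le> t i $ j" if "i < k" for i j
        unfolding t_def using tS[OF that] S(2) by (rule dyadic_point_bounds)
      fix i assume i: "i < k"
      obtain j where j: "\<And>p. p \<le> i \<Longrightarrow> \<rho> i \<le> \<bar>t i $ j - with_origin t p $ j\<bar>"
        unfolding \<rho>_def using mixed_dist_gap[of i "with_origin t" "t i"] by blast
      have "0 < t i $ j" using dyadic_point_pos[OF tS[OF i] S(2)] by (simp add: pos_orthant_def t_def)
      then have "\<rho> i \<le> t i $ j" using j[of 0] by (simp add: with_origin_def)
      moreover have "\<rho> i \<le> \<bar>t i $ j - t p $ j\<bar>" if "p < i" for p
        using j[of "Suc p"] that by (simp add: with_origin_def)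
      ultimately show "0 \<le> \<rho> i \<and> (\<exists>j. \<rho> i \<le> t i $ j \<and> (\<forall>p<i. \<rho> i \<le> \<bar>t i $ j - t p $ j\<bar>))"
        using mixed_dist_nonneg[of "with_origin t" i "t i"] unfolding \<rho>_def by blast
    qed (use eta in auto)
    then show "prob (Q f) \<le> (\<Prod>i<k. hit_factor \<gamma> c (mixed_dist (with_origin (\<lambda>p. dyadic_point q (f p))) i (dyadic_point q (f i))))"
      by (simp add: hit_factor_def c_def \<gamma>_def \<rho>_def t_def)
  qed
  also have "\<dots> \<le> \<Lambda> ^ k"
  proof (rule sum_PiE_prod_le[OF finS])
    fix i a and f g :: "nat \<Rightarrow> 'n \<Rightarrow> nat" assume "\<And>p. p < i \<Longrightarrow> f p = g p"
    then have "mixed_dist (with_origin (\<lambda>p. dyadic_point q (f p))) i (dyadic_point q a)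
       = mixed_dist (with_origin (\<lambda>p. dyadic_point q (g p))) i (dyadic_point q a)"
      by (intro mixed_dist_cong) (auto simp: with_origin_def)
    then show "hit_factor \<gamma> c (mixed_dist (with_origin (\<lambda>p. dyadic_point q (f p))) i (dyadic_point q a))
       = hit_factor \<gamma> c (mixed_dist (with_origin (\<lambda>p. dyadic_point q (g p))) i (dyadic_point q a))" by simp
  qed (use sum_le hit_factor_nonneg in auto)
  finally have E: "expectation (\<lambda>\<omega>. real (H \<omega>) ^ k) \<le> \<Lambda> ^ k" .
  have int: "integrable M (\<lambda>\<omega>. real (H \<omega>) ^ k)"
    using intk Hk by (subst Bochner_Integration.integrable_cong[of M M _ "\<lambda>\<omega>. \<Sum>f\<in>?F. indicator (Q f) \<omega>"]) auto
  have "prob {\<omega>\<in>space M. h \<le> real (H \<omega>)} \<le> prob {\<omega>\<in>space M. h ^ k \<le> real (H \<omega>) ^ k}"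
    using Hm l by (intro finite_measure_mono) (auto intro: power_mono)
  also have "\<dots> \<le> expectation (\<lambda>\<omega>. real (H \<omega>) ^ k) / h ^ k"
    using int l by (intro integral_Markov_inequality_measure[where A = "space M"]) auto
  also have "\<dots> \<le> \<Lambda> ^ k / h ^ k" using E l by (intro divide_right_mono) auto
  finally show "prob {\<omega>\<in>space M. h \<le> real (card {a\<in>S. norm (W \<omega> (dyadic_point q a)) \<le> \<eta>})} \<le> (\<Lambda> / h) ^ k"
    by (simp add: H_def power_divide)
qed

end

text \<open>The growth exponent of the number of hits in a slab parallel to ker P, used with
  \<gamma> = d/2: the dimension of the kernel reduced by the codimension of the zero set. It
  vanishes exactly when the kernel has dimension at most \<gamma>.\<close>

definition slab_excess :: "(real^'n \<Rightarrow> real^'n) \<Rightarrow> real \<Rightarrow> real" where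
  "slab_excess P \<gamma> = max 0 (real (kernel_dim P) - \<gamma>)"

lemma kernel_dim_le: "kernel_dim (P :: real^'n \<Rightarrow> real^'n) \<le> CARD('n)"
  unfolding kernel_dim_def using dim_subset_UNIV_cart[of "{x. P x = 0}"] by simp

section \<open>Finite nets of orthogonal projections and hit counts uniform in the
  projection\<close>

lemma matrix_entry_bound:
  fixes P :: "real^'n \<Rightarrow> real^'n"
  assumes "orth_proj P"
  shows "\<bar>matrix P $ i $ j\<bar> \<le> 1"
proof -
  have "\<bar>matrix P $ i $ j\<bar> \<le> norm (P (axis j 1))"
    using component_le_norm_cart[of "P (axis j 1)" i] by (simp add: matrix_def)
  also have "\<dots> \<le> norm (axis j 1 :: real^'n)" by (rule orth_projD(4)[OF assms])
  finally show ?thesis by simp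
qed

text \<open>Projections are classified by their kernel dimension and the integer parts of 2^q times
  their matrix entries, which lie in [-1, 1]. One actual projection is chosen from each class that
  occurs. Recording the kernel dimension makes \<open>slab_excess\<close> constant on
  classes.\<close>

lemma projection_net:
  fixes q :: nat
  shows "\<exists>R :: (real^'n \<Rightarrow> real^'n) set. finite R \<and> real (card R) \<le> real (CARD('n) + 1) * (4 * 2 ^ q) ^ (CARD('n) * CARD('n)) \<and>
    (\<forall>P\<in>R. orth_proj P) \<and>
    (\<forall>P. orth_proj P \<longrightarrow> (\<exists>P'\<in>R. kernel_dim P' = kernel_dim P \<and> (\<forall>i j. \<bar>matrix P $ i $ j - matrix P' $ i $ j\<bar> \<le> 1 / 2 ^ q)))"
proof -
  define key where "key = (\<lambda>P :: real^'n \<Rightarrow> real^'n. (kernel_dim P, \<lambda>ij. \<lfloor>2 ^ q * matrix P $ fst ij $ snd ij\<rfloor>))"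
  define T where "T = {..CARD('n)} \<times> PiE (UNIV :: ('n \<times> 'n) set) (\<lambda>_. {- (2 ^ q)..2 ^ q :: int})"
  define rep where "rep = (\<lambda>k. SOME P. orth_proj P \<and> key P = k)"
  define R where "R = rep ` key ` {P. orth_proj P}"
  have finT: "finite T" unfolding T_def by (intro finite_cartesian_product finite_PiE) auto
  have keyT: "key ` {P. orth_proj P} \<subseteq> T"
  proof
    fix k assume "k \<in> key ` {P. orth_proj P}"
    then obtain P where P: "orth_proj P" "k = key P" by auto
    have "- (2 ^ q) \<le> \<lfloor>2 ^ q * matrix P $ i $ j\<rfloor> \<and> \<lfloor>2 ^ q * matrix P $ i $ j\<rfloor> \<le> 2 ^ q" for i j
    proof -
      have b: "- 1 \<le> matrix P $ i $ j" "matrix P $ i $ j \<le> 1"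
        using matrix_entry_bound[OF P(1), of i j] by (auto simp: abs_le_iff)
      have "2 ^ q * - 1 \<le> 2 ^ q * matrix P $ i $ j" using b(1) by (intro mult_left_mono) auto
      moreover have "2 ^ q * matrix P $ i $ j \<le> 2 ^ q * 1" using b(2) by (intro mult_left_mono) auto
      ultimately have u: "of_int (- (2 ^ q)) \<le> 2 ^ q * matrix P $ i $ j" "2 ^ q * matrix P $ i $ j \<le> of_int (2 ^ q)" by auto
      show ?thesis using u(1) floor_mono[OF u(2)] unfolding le_floor_iff floor_of_int by blast
    qed
    then show "k \<in> T" unfolding P(2) key_def T_def using kernel_dim_le[of P] by (auto simp: PiE_iff)
  qed
  have finK: "finite (key ` {P. orth_proj P})" using keyT finT by (rule finite_subset)
  have "card R \<le> card (key ` {P. orth_proj P})" unfolding R_def using finK by (rule card_image_le)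
  also have "\<dots> \<le> card T" using finT keyT by (rule card_mono)
  finally have "real (card R) \<le> real (card T)" by simp
  also have "real (card T) = real (CARD('n) + 1) * (2 * 2 ^ q + 1) ^ (CARD('n) * CARD('n))"
    unfolding T_def by (simp add: card_cartesian_product card_PiE) (simp add: of_nat_nat add.commute distrib_right)
  also have "\<dots> \<le> real (CARD('n) + 1) * (4 * 2 ^ q) ^ (CARD('n) * CARD('n))"
  proof (intro mult_left_mono power_mono)
    have "(1::real) \<le> 2 ^ q" by simp
    then show "2 * 2 ^ q + 1 \<le> (4 * 2 ^ q :: real)" by linarith
  qed auto
  finally have card: "real (card R) \<le> real (CARD('n) + 1) * (4 * 2 ^ q) ^ (CARD('n) * CARD('n))" .
  have rep: "orth_proj (rep (key P)) \<and> key (rep (key P)) = key P" if "orth_proj P" for P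
    unfolding rep_def by (rule someI[of "\<lambda>P'. orth_proj P' \<and> key P' = key P" P]) (use that in simp)
  have close: "\<bar>matrix P $ i $ j - matrix P' $ i $ j\<bar> \<le> 1 / 2 ^ q" if "key P' = key P" for P P' i j
  proof -
    have "\<lfloor>2 ^ q * matrix P' $ i $ j\<rfloor> = \<lfloor>2 ^ q * matrix P $ i $ j\<rfloor>"
    proof -
      have "(\<lambda>ij. \<lfloor>2 ^ q * matrix P' $ fst ij $ snd ij\<rfloor>) = (\<lambda>ij. \<lfloor>2 ^ q * matrix P $ fst ij $ snd ij\<rfloor>)"
        using that by (simp add: key_def)
      from fun_cong[OF this, of "(i, j)"] show ?thesis by simp
    qed
    then have "\<bar>2 ^ q * matrix P $ i $ j - 2 ^ q * matrix P' $ i $ j\<bar> \<le> 1" by linarith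
    then have "2 ^ q * \<bar>matrix P $ i $ j - matrix P' $ i $ j\<bar> \<le> 1"
      by (simp add: right_diff_distrib[symmetric] abs_mult)
    then show ?thesis by (simp add: le_divide_eq mult.commute)
  qed
  show ?thesis
  proof (intro exI[of _ R] conjI card ballI allI impI)
    show "finite R" unfolding R_def using finK by simp
    show "orth_proj P" if "P \<in> R" for P using that rep by (auto simp: R_def)
    fix P :: "real^'n \<Rightarrow> real^'n" assume P: "orth_proj P"
    have "fst (key (rep (key P))) = fst (key P)" using rep[OF P] by simp
    then have "kernel_dim (rep (key P)) = kernel_dim P" by (simp add: key_def)
    then show "\<exists>P'\<in>R. kernel_dim P' = kernel_dim P \<and> (\<forall>i j. \<bar>matrix P $ i $ j - matrix P' $ i $ j\<bar> \<le> 1 / 2 ^ q)"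
      using close[of "rep (key P)" P] rep[OF P] P by (intro bexI[of _ "rep (key P)"]) (auto simp: R_def)
  qed
qed

lemma matrix_close_norm:
  fixes P P' :: "real^'n \<Rightarrow> real^'n"
  assumes P: "linear P" "linear P'" and close: "\<And>i j. \<bar>matrix P $ i $ j - matrix P' $ i $ j\<bar> \<le> \<delta>"
    and v: "\<And>j. \<bar>v $ j\<bar> \<le> b" and d: "0 \<le> \<delta>"
  shows "norm (P v - P' v) \<le> real CARD('n) * real CARD('n) * \<delta> * b"
proof -
  have rep: "Q v $ i = (\<Sum>j\<in>UNIV. matrix Q $ i $ j * v $ j)" if "linear Q" for Q :: "real^'n \<Rightarrow> real^'n" and i
  proof -
    have "Q v = matrix Q *v v" using fun_cong[OF matrix_vector_mul(2)[OF that], of v] by (rule sym)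
    then show ?thesis by (simp only: matrix_vector_mult_def vec_lambda_beta)
  qed
  have "norm (P v - P' v) \<le> (\<Sum>i\<in>UNIV. \<bar>(P v - P' v) $ i\<bar>)" by (rule norm_le_l1_cart)
  also have "\<dots> \<le> (\<Sum>i\<in>(UNIV::'n set). \<Sum>j\<in>(UNIV::'n set). \<delta> * b)"
  proof (rule sum_mono)
    fix i
    have "\<bar>(P v - P' v) $ i\<bar> = \<bar>\<Sum>j\<in>UNIV. (matrix P $ i $ j - matrix P' $ i $ j) * v $ j\<bar>"
      by (simp add: rep[OF P(1)] rep[OF P(2)] sum_subtractf left_diff_distrib)
    also have "\<dots> \<le> (\<Sum>j\<in>UNIV. \<bar>(matrix P $ i $ j - matrix P' $ i $ j) * v $ j\<bar>)" by (rule sum_abs)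
    also have "\<dots> \<le> (\<Sum>j\<in>(UNIV::'n set). \<delta> * b)"
      unfolding abs_mult using close v d by (intro sum_mono mult_mono) auto
    finally show "\<bar>(P v - P' v) $ i\<bar> \<le> (\<Sum>j\<in>(UNIV::'n set). \<delta> * b)" .
  qed
  also have "\<dots> = real CARD('n) * real CARD('n) * \<delta> * b" by simp
  finally show ?thesis .
qed

context brownian
begin

text \<open>The point is that A is the same for all P, q, k, x0 and h, so that a union bound over
  slabs can follow. The factor k^N counts mixed points, and the exponent (1 - 2 \<kappa>) \<gamma>
  is the price of a threshold above 2^(-q/2).\<close>

lemma slab_hits_tail:
  fixes m C0 :: nat and \<kappa> Ch :: real
  defines "\<gamma> \<equiv> real CARD('d) / 2"
  defines "hit \<equiv> \<lambda>P x0 q \<omega>. {a \<in> dyadic_index m q. norm (P (dyadic_point q a :: real^'n) - x0) \<le> real C0 / 2 ^ q \<and>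
      norm (W \<omega> (dyadic_point q a)) \<le> Ch * 2 powr (- (real q * \<kappa>))}"
  assumes Ch: "0 < Ch" and \<kappa>: "\<kappa> \<le> 1 / 2"
  shows "\<exists>A>0. \<forall>P q k x0 h. orth_proj P \<longrightarrow> m \<le> q \<longrightarrow> 0 < h \<longrightarrow>
     {\<omega>\<in>space M. h \<le> real (card (hit P x0 q \<omega>))} \<in> events \<and>
     prob {\<omega>\<in>space M. h \<le> real (card (hit P x0 q \<omega>))}
       \<le> (A * real k ^ CARD('n) * real (q + m + CARD('n) + 1) * 2 powr (real q * (slab_excess P \<gamma> + (1 - 2 * \<kappa>) * \<gamma>)) / h) ^ k"
proof -
  let ?N = "real CARD('n)"
  define c' where "c' = (1 / 2 ^ m) ^ (CARD('n) - 1) / (2 * ?N * Ch\<^sup>2)"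
  define C1 where "C1 = (2 * (2 * real C0 + ?N) + 1) ^ CARD('n) * 4 ^ CARD('n)"
  define A where "A = exp (1/2) * (1 / min 1 c') powr \<gamma> * 2 powr \<gamma> * C1 * 2 powr (real (m + CARD('n)) * ?N)"
  have c': "0 < c'" using Ch by (simp add: c'_def)
  have C1: "0 < C1" unfolding C1_def by (intro mult_pos_pos zero_less_power add_nonneg_pos) auto
  have A: "0 < A" unfolding A_def using c' C1 by (intro mult_pos_pos) auto
  have g: "0 \<le> \<gamma>" by (simp add: \<gamma>_def)
  show ?thesis
  proof (intro exI[of _ A] conjI A allI impI)
    fix P :: "real^'n \<Rightarrow> real^'n" and q k :: nat and x0 :: "real^'n" and h :: real
    assume P: "orth_proj P" and mq: "m \<le> q" and h: "0 < h"
    define S where "S = {a \<in> dyadic_index m q. norm (P (dyadic_point q a) - x0) \<le> real C0 / 2 ^ q}"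
    define \<eta> where "\<eta> = Ch * 2 powr (- (real q * \<kappa>))"
    define e where "e = slab_excess P \<gamma>"
    have e: "0 \<le> e" "e \<le> ?N" using kernel_dim_le[of P] g by (auto simp: e_def slab_excess_def)
    have eta: "0 < \<eta>" using Ch by (simp add: \<eta>_def)
    have hitS: "hit P x0 q \<omega> = {a\<in>S. norm (W \<omega> (dyadic_point q a)) \<le> \<eta>}" for \<omega>
      by (auto simp: hit_def S_def \<eta>_def)
    \<comment> \<open>Up to the factor Ch^2 this is the ratio of the squared threshold to the mesh
      2^(-q).\<close>
    define w where "w = 2 powr (real q * (1 - 2 * \<kappa>))"
    have w: "1 \<le> w" using \<kappa> by (simp add: w_def ge_one_powr_ge_zero)
    define c where "c = (1 / 2 ^ m) ^ (CARD('n) - 1) / (2 * \<eta>\<^sup>2)"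
    have cc: "c / ?N = c' / w * 2 ^ q"
    proof -
      have "\<eta>\<^sup>2 = Ch\<^sup>2 * (2 powr (- (real q * \<kappa>)) * 2 powr (- (real q * \<kappa>)))"
        by (simp add: \<eta>_def power2_eq_square ac_simps)
      also have "2 powr (- (real q * \<kappa>)) * 2 powr (- (real q * \<kappa>)) = 2 powr (real q * (1 - 2 * \<kappa>) - real q)"
        by (simp add: powr_add[symmetric] algebra_simps)
      also have "\<dots> = w / 2 ^ q" by (simp add: w_def powr_diff powr_realpow)
      finally have "\<eta>\<^sup>2 = Ch\<^sup>2 * (w / 2 ^ q)" .
      then show ?thesis using w by (simp add: c_def c'_def)
    qed
    define B where "B = exp (1/2) * (w / min 1 c') powr \<gamma> * (2 powr \<gamma> * C1 * real (q + m + CARD('n) + 1) * 2 powr (real (q + m + CARD('n)) * e))"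
    have B0: "0 \<le> B" using C1 by (simp add: B_def)
    have BA: "B \<le> A * real (q + m + CARD('n) + 1) * 2 powr (real q * (e + (1 - 2 * \<kappa>) * \<gamma>))"
    proof -
      have "(w / min 1 c') powr \<gamma> = w powr \<gamma> * (1 / min 1 c') powr \<gamma>"
        using c' w by (simp add: powr_divide)
      moreover have "w powr \<gamma> = 2 powr (real q * ((1 - 2 * \<kappa>) * \<gamma>))" by (simp add: w_def powr_powr mult.assoc)
      moreover have "2 powr (real (q + m + CARD('n)) * e) \<le> 2 powr (real q * e) * 2 powr (real (m + CARD('n)) * ?N)"
      proof -
        have "real (m + CARD('n)) * e \<le> real (m + CARD('n)) * ?N" using e by (intro mult_left_mono) auto
        then show ?thesis unfolding powr_add[symmetric] by (intro powr_mono) (auto simp: algebra_simps)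
      qed
      ultimately have "B \<le> exp (1/2) * (2 powr (real q * ((1 - 2 * \<kappa>) * \<gamma>)) * (1 / min 1 c') powr \<gamma>) * (2 powr \<gamma> * C1 * real (q + m + CARD('n) + 1) *
          (2 powr (real q * e) * 2 powr (real (m + CARD('n)) * ?N)))"
        unfolding B_def using C1 by (simp only:) (intro mult_left_mono, auto)
      also have "\<dots> = A * real (q + m + CARD('n) + 1) * (2 powr (real q * e) * 2 powr (real q * ((1 - 2 * \<kappa>) * \<gamma>)))"
        by (simp only: A_def ac_simps)
      finally show ?thesis by (simp only: powr_add[symmetric] distrib_left)
    qed
    have sum_le: "(\<Sum>a\<in>S. hit_factor \<gamma> c (mixed_dist (with_origin (\<lambda>p. dyadic_point q (f p))) i (dyadic_point q a))) \<le> real k ^ CARD('n) * B"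
      if i: "i < k" and f: "f \<in> PiE {..<i} (\<lambda>_. S)" for i f
    proof -
      let ?u = "with_origin (\<lambda>p. dyadic_point q (f p)) :: nat \<Rightarrow> real^'n"
      let ?G = "PiE (UNIV::'n set) (\<lambda>_. {..i})"
      have fin: "finite S" unfolding S_def by (rule finite_subset[OF _ finite_dyadic_index[of m q]]) auto
      have "(\<Sum>a\<in>S. hit_factor \<gamma> c (mixed_dist ?u i (dyadic_point q a)))
         \<le> (\<Sum>a\<in>S. \<Sum>g\<in>?G. hit_factor \<gamma> c (norm (dyadic_point q a - mixed_point ?u g) / ?N))"
        by (intro sum_mono mixed_dist_sum_bound hit_factor_nonneg)
      also have "\<dots> = (\<Sum>g\<in>?G. \<Sum>a\<in>S. hit_factor \<gamma> (c' / w * 2 ^ q) (norm (dyadic_point q a - mixed_point ?u g)))"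
        unfolding cc[symmetric] by (subst sum.swap) (simp add: hit_factor_def)
      also have "\<dots> \<le> (\<Sum>g\<in>?G. B)"
      proof (rule sum_mono)
        fix g assume gG: "g \<in> ?G"
        have y: "0 \<le> mixed_point ?u g $ j \<and> mixed_point ?u g $ j \<le> 2 ^ m" for j
        proof (cases "g j")
          case 0
          then show ?thesis by (simp add: mixed_point_def with_origin_def)
        next
          case (Suc p)
          have "g j \<le> i" using gG by (auto simp: PiE_iff)
          then have "f p \<in> S" using f Suc by (auto simp: PiE_iff)
          then have fp: "f p \<in> dyadic_index m q" by (simp add: S_def)
          have "1 / 2 ^ m \<le> dyadic_point q (f p) $ j" by (rule dyadic_point_bounds(1)[OF fp mq])
          then have "0 \<le> dyadic_point q (f p) $ j" by (rule order_trans[rotated]) simp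
          then show ?thesis using Suc dyadic_point_bounds(2)[OF fp mq, of j] by (simp add: mixed_point_def with_origin_def)
        qed
        show "(\<Sum>a\<in>S. hit_factor \<gamma> (c' / w * 2 ^ q) (norm (dyadic_point q a - mixed_point ?u g))) \<le> B"
          unfolding S_def B_def C1_def e_def slab_excess_def using y
          by (intro dyadic_slab_sum_le P mq g c' w) auto
      qed
      also have "\<dots> = real (Suc i) ^ CARD('n) * B" by (simp add: card_PiE)
      also have "\<dots> \<le> real k ^ CARD('n) * B" using i B0 by (intro mult_right_mono power_mono) auto
      finally show ?thesis .
    qed
    have Ssub: "S \<subseteq> dyadic_index m q" by (auto simp: S_def)
    note T = hits_tail[of S m q \<eta> h k "real k ^ CARD('n) * B", OF Ssub mq eta h sum_le[unfolded c_def \<gamma>_def]]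
    show "{\<omega>\<in>space M. h \<le> real (card (hit P x0 q \<omega>))} \<in> events"
      unfolding hitS by (rule T(1))
    have "prob {\<omega>\<in>space M. h \<le> real (card (hit P x0 q \<omega>))} \<le> (real k ^ CARD('n) * B / h) ^ k"
      unfolding hitS by (rule T(2))
    also have "\<dots> \<le> (A * real k ^ CARD('n) * real (q + m + CARD('n) + 1) * 2 powr (real q * (slab_excess P \<gamma> + (1 - 2 * \<kappa>) * \<gamma>)) / h) ^ k"
    proof (intro power_mono divide_right_mono)
      have "real k ^ CARD('n) * B \<le> real k ^ CARD('n) * (A * real (q + m + CARD('n) + 1) * 2 powr (real q * (e + (1 - 2 * \<kappa>) * \<gamma>)))"
        using BA by (intro mult_left_mono) auto
      then show "real k ^ CARD('n) * B \<le> A * real k ^ CARD('n) * real (q + m + CARD('n) + 1) * 2 powr (real q * (slab_excess P \<gamma> + (1 - 2 * \<kappa>) * \<gamma>))"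
        by (simp add: e_def ac_simps)
    qed (use h B0 in auto)
    finally show "prob {\<omega>\<in>space M. h \<le> real (card (hit P x0 q \<omega>))}
       \<le> (A * real k ^ CARD('n) * real (q + m + CARD('n) + 1) * 2 powr (real q * (slab_excess P \<gamma> + (1 - 2 * \<kappa>) * \<gamma>)) / h) ^ k" .
  qed
qed

text \<open>Slabs are centred at images of grid points, so both the directions, through the net, and
  the positions form finite families at each level. A single event from Borel-Cantelli then serves
  all P, including those depending on \<omega>.\<close>

lemma slab_hits_AE:
  fixes m C0 :: nat and \<epsilon> Ch :: real
  assumes Ch: "0 < Ch" and eps: "0 < \<epsilon>"
  shows "AE \<omega> in M. \<forall>\<^sub>F q in sequentially. \<forall>P. orth_proj P \<longrightarrow> (\<forall>a0\<in>dyadic_index m q.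
    real (card {a \<in> dyadic_index m q. norm (P (dyadic_point q a :: real^'n) - P (dyadic_point q a0)) \<le> real C0 / 2 ^ q \<and>
      norm (W \<omega> (dyadic_point q a)) \<le> Ch * 2 powr (- (real q * (1 / 2 - \<epsilon>)))})
    \<le> 2 powr (real q * (slab_excess P (real CARD('d) / 2) + \<epsilon> * (real CARD('d) + 2))))"
proof -
  let ?N = "CARD('n)"
  define \<gamma> where "\<gamma> = real CARD('d) / 2"
  define \<kappa> where "\<kappa> = 1 / 2 - \<epsilon>"
  \<comment> \<open>Replacing P by an element of the net moves a vector with coordinates up to 2^m
    by at most N^2 2^m 2^(-q); the slabs are widened by this amount.\<close>
  define C0' where "C0' = C0 + ?N * ?N * 2 ^ m"
  define hit where "hit = (\<lambda>C (P :: real^'n \<Rightarrow> real^'n) x0 q \<omega>. {a \<in> dyadic_index m q. norm (P (dyadic_point q a :: real^'n) - x0) \<le> real C / 2 ^ q \<and>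
      norm (W \<omega> (dyadic_point q a)) \<le> Ch * 2 powr (- (real q * \<kappa>))})"
  \<comment> \<open>Of the exponent \<epsilon> (d + 2), the part \<epsilon> d equals (1 - 2
    \<kappa>) \<gamma>; one further \<epsilon> absorbs the factor linear in q, and the last one
    provides the decay.\<close>
  define h where "h = (\<lambda>P :: real^'n \<Rightarrow> real^'n. \<lambda>q. 2 powr (real q * (slab_excess P \<gamma> + \<epsilon> * (real CARD('d) + 2))))"
  have h0: "0 < h P q" for P q by (simp add: h_def)
  \<comment> \<open>The summand N^2 pays for the net of matrices, N for the centres, and 1 for
    summability over q.\<close>
  define k where "k = nat \<lceil>(real (?N * ?N) + real ?N + 1) / \<epsilon>\<rceil>"
  have k: "real (?N * ?N) + real ?N + 1 \<le> \<epsilon> * real k"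
  proof -
    have "(real (?N * ?N) + real ?N + 1) / \<epsilon> \<le> real k" unfolding k_def by (rule real_nat_ceiling_ge)
    then show ?thesis using eps by (simp only: divide_le_eq if_True mult.commute split: if_splits)
  qed
  have "\<exists>A>0. \<forall>P q k x0 h. orth_proj P \<longrightarrow> m \<le> q \<longrightarrow> 0 < h \<longrightarrow>
     {\<omega>\<in>space M. h \<le> real (card (hit C0' P x0 q \<omega>))} \<in> events \<and>
     prob {\<omega>\<in>space M. h \<le> real (card (hit C0' P x0 q \<omega>))}
       \<le> (A * real k ^ ?N * real (q + m + ?N + 1) * 2 powr (real q * (slab_excess P \<gamma> + (1 - 2 * \<kappa>) * \<gamma>)) / h) ^ k" (is "\<exists>A>0. ?Q A")
    unfolding hit_def \<gamma>_def using Ch eps by (intro slab_hits_tail) (auto simp: \<kappa>_def)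
  then obtain A where A: "0 < A" and Q: "?Q A" by blast
  have hm: "{\<omega>\<in>space M. h \<le> real (card (hit C0' P x0 q \<omega>))} \<in> events"
    and hp: "prob {\<omega>\<in>space M. h \<le> real (card (hit C0' P x0 q \<omega>))}
       \<le> (A * real k ^ ?N * real (q + m + ?N + 1) * 2 powr (real q * (slab_excess P \<gamma> + (1 - 2 * \<kappa>) * \<gamma>)) / h) ^ k"
    if "orth_proj P" "m \<le> q" "0 < h" for P q x0 h
    using Q[THEN spec[of _ P], THEN spec[of _ q], THEN spec[of _ k], THEN spec[of _ x0], THEN spec[of _ h]] that by simp_all
  obtain B where B: "0 < B" "\<And>q. A * real k ^ ?N * real (q + m + ?N + 1) * 2 powr (- (real q * \<epsilon>)) \<le> B"
  proof -
    define c where "c = real (m + ?N + 1)"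
    have "(\<lambda>q. (real q + c) * 2 powr (- (real q * \<epsilon>))) \<longlonglongrightarrow> 0" using eps by real_asymp
    then have "(\<lambda>q. A * real k ^ ?N * ((real q + c) * 2 powr (- (real q * \<epsilon>)))) \<longlonglongrightarrow> 0"
      by (rule tendsto_mult_right_zero)
    then have "Bseq (\<lambda>q. A * real k ^ ?N * ((real q + c) * 2 powr (- (real q * \<epsilon>))))"
      by (intro convergent_imp_Bseq convergentI)
    then obtain B where B: "0 < B" "\<And>q. norm (A * real k ^ ?N * ((real q + c) * 2 powr (- (real q * \<epsilon>)))) \<le> B"
      by (rule BseqE) blast
    have "A * real k ^ ?N * real (q + m + ?N + 1) * 2 powr (- (real q * \<epsilon>)) \<le> B" for q
    proof -
      have "real (q + m + ?N + 1) = real q + c" by (simp add: c_def)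
      moreover have "A * real k ^ ?N * ((real q + c) * 2 powr (- (real q * \<epsilon>))) \<le> B"
        using B(2)[of q] by (simp only: real_norm_def abs_le_iff)
      ultimately show ?thesis by (simp only: mult.assoc)
    qed
    then show ?thesis using that[of B] B(1) by blast
  qed
  have ratio: "prob {\<omega>\<in>space M. h P q \<le> real (card (hit C0' P x0 q \<omega>))} \<le> (B * 2 powr (- (real q * \<epsilon>))) ^ k"
    if "orth_proj P" "m \<le> q" for P q x0
  proof -
    have "2 powr (real q * (slab_excess P \<gamma> + (1 - 2 * \<kappa>) * \<gamma>)) / h P q = 2 powr (- (real q * \<epsilon>) + - (real q * \<epsilon>))"
      unfolding h_def powr_diff[symmetric] by (rule arg_cong[where f = "(powr) 2"]) (simp add: \<kappa>_def \<gamma>_def field_simps)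
    then have "A * real k ^ ?N * real (q + m + ?N + 1) * 2 powr (real q * (slab_excess P \<gamma> + (1 - 2 * \<kappa>) * \<gamma>)) / h P q
       = A * real k ^ ?N * real (q + m + ?N + 1) * 2 powr (- (real q * \<epsilon>)) * 2 powr (- (real q * \<epsilon>))"
      by (simp only: powr_add mult.assoc times_divide_eq_right[symmetric])
    also have "\<dots> \<le> B * 2 powr (- (real q * \<epsilon>))" using B(2)[of q] by (intro mult_right_mono) auto
    finally have "(A * real k ^ ?N * real (q + m + ?N + 1) * 2 powr (real q * (slab_excess P \<gamma> + (1 - 2 * \<kappa>) * \<gamma>)) / h P q) ^ k
       \<le> (B * 2 powr (- (real q * \<epsilon>))) ^ k"
      using A h0[of P q] by (intro power_mono) (auto intro!: divide_nonneg_pos mult_nonneg_nonneg)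
    then show ?thesis using hp[OF that h0, of P q x0] by linarith
  qed
  have "\<forall>q. \<exists>R :: (real^'n \<Rightarrow> real^'n) set. finite R \<and> real (card R) \<le> real (?N + 1) * (4 * 2 ^ q) ^ (?N * ?N) \<and>
    (\<forall>P\<in>R. orth_proj P) \<and>
    (\<forall>P. orth_proj P \<longrightarrow> (\<exists>P'\<in>R. kernel_dim P' = kernel_dim P \<and> (\<forall>i j. \<bar>matrix P $ i $ j - matrix P' $ i $ j\<bar> \<le> 1 / 2 ^ q)))"
    by (intro allI projection_net)
  then obtain R :: "nat \<Rightarrow> (real^'n \<Rightarrow> real^'n) set" where finR: "\<And>q. finite (R q)"
    and cardR: "\<And>q. real (card (R q)) \<le> real (?N + 1) * (4 * 2 ^ q) ^ (?N * ?N)"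
    and projR: "\<And>q P. P \<in> R q \<Longrightarrow> orth_proj P"
    and netR: "\<And>q P. orth_proj P \<Longrightarrow> \<exists>P'\<in>R q. kernel_dim P' = kernel_dim P \<and> (\<forall>i j. \<bar>matrix P $ i $ j - matrix P' $ i $ j\<bar> \<le> 1 / 2 ^ q)"
    by metis
  define ev where "ev = (\<lambda>q (P, a0). {\<omega>\<in>space M. h P q \<le> real (card (hit C0' P (P (dyadic_point q a0)) q \<omega>))})"
  define I where "I = (\<lambda>q. R q \<times> (dyadic_index m q :: ('n \<Rightarrow> nat) set))"
  define Ev where "Ev = (\<lambda>q. if m \<le> q then \<Union>x\<in>I q. ev q x else {})"
  have finI: "finite (I q)" for q unfolding I_def using finR finite_dyadic_index by blast
  have evm: "ev q x \<in> events" if "x \<in> I q" "m \<le> q" for q x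
    using that hm[OF projR _ h0] by (auto simp: ev_def I_def)
  have Evm: "Ev q \<in> events" for q
    unfolding Ev_def using evm finI by (auto intro!: sets.finite_UN)
  define K where "K = real (?N + 1) * 4 ^ (?N * ?N) * (2 ^ Suc m) ^ ?N * B ^ k"
  have K0: "0 \<le> K" using B(1) by (simp add: K_def)
  have bound: "prob (Ev q) \<le> K * (1 / 2) ^ q" for q
  proof (cases "m \<le> q")
    case False
    then show ?thesis using K0 by (simp add: Ev_def)
  next
    case True
    have "prob (Ev q) \<le> (\<Sum>x\<in>I q. prob (ev q x))"
      unfolding Ev_def using True evm finI by (simp, intro finite_measure_subadditive_finite) auto
    also have "\<dots> \<le> (\<Sum>x\<in>I q. (B * 2 powr (- (real q * \<epsilon>))) ^ k)"
    proof (rule sum_mono)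
      fix x assume "x \<in> I q"
      then show "prob (ev q x) \<le> (B * 2 powr (- (real q * \<epsilon>))) ^ k"
        using ratio[OF projR True] by (auto simp: ev_def I_def)
    qed
    also have "\<dots> = (real (card (R q)) * real (card (dyadic_index m q :: ('n \<Rightarrow> nat) set))) * (B * 2 powr (- (real q * \<epsilon>))) ^ k"
      by (simp add: I_def card_cartesian_product)
    also have "\<dots> \<le> (real (?N + 1) * (4 * 2 ^ q) ^ (?N * ?N) * (2 ^ Suc (q + m)) ^ ?N) * (B * 2 powr (- (real q * \<epsilon>))) ^ k"
      using cardR[of q] card_dyadic_index_le[of m q, where ?'n = 'n] B(1)
      by (intro mult_right_mono mult_mono) auto
    also have "\<dots> = K * ((2 ^ q) ^ (?N * ?N) * (2 ^ q) ^ ?N * (2 powr (- (real q * \<epsilon>))) ^ k)"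
    proof -
      have "(2::real) ^ Suc (q + m) = 2 ^ Suc m * 2 ^ q" by (simp add: power_add)
      then show ?thesis unfolding K_def by (simp only: power_mult_distrib ac_simps)
    qed
    also have "(2 ^ q) ^ (?N * ?N) * (2 ^ q) ^ ?N * (2 powr (- (real q * \<epsilon>))) ^ k
       = 2 powr (real q * (real (?N * ?N) + real ?N - \<epsilon> * real k))"
    proof -
      have "(2 ^ q) ^ (?N * ?N) = 2 powr (real q * real (?N * ?N))" "(2 ^ q) ^ ?N = 2 powr (real q * real ?N)"
        by (simp_all only: powr_realpow[symmetric] powr_powr zero_less_numeral zero_less_power powr_gt_zero)
      moreover have "(2 powr (- (real q * \<epsilon>))) ^ k = 2 powr (- (real q * \<epsilon>) * real k)"
        by (subst powr_realpow[symmetric]) (auto simp: powr_powr)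
      ultimately have "(2 ^ q) ^ (?N * ?N) * (2 ^ q) ^ ?N * (2 powr (- (real q * \<epsilon>))) ^ k
         = 2 powr (real q * real (?N * ?N) + real q * real ?N + - (real q * \<epsilon>) * real k)"
        by (simp only: powr_add)
      then show ?thesis by (simp add: algebra_simps)
    qed
    also have "K * \<dots> \<le> K * 2 powr (real q * (- 1))"
      using k K0 by (intro mult_left_mono powr_mono) auto
    also have "2 powr (real q * (- 1)) = (1 / 2) ^ q"
      by (simp add: powr_minus_divide powr_realpow power_divide)
    finally show ?thesis .
  qed
  have "summable (\<lambda>q. prob (Ev q))"
  proof (rule summable_comparison_test')
    show "summable (\<lambda>q. K * (1 / 2) ^ q)" by (intro summable_mult summable_geometric) simp
    show "norm (prob (Ev q)) \<le> K * (1 / 2) ^ q" for q using bound[of q] by simp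
  qed
  then have "AE \<omega> in M. \<forall>\<^sub>F q in sequentially. \<omega> \<in> space M - Ev q"
    using Evm by (intro borel_cantelli_AE1) (auto simp: emeasure_eq_measure)
  then show ?thesis
  proof eventually_elim
    case (elim \<omega>)
    then show ?case
      using eventually_ge_at_top[of m]
    proof eventually_elim
      case (elim q)
      show ?case
      proof (intro allI impI ballI)
        fix P :: "real^'n \<Rightarrow> real^'n" and a0 :: "'n \<Rightarrow> nat"
        assume P: "orth_proj P" and a0: "a0 \<in> dyadic_index m q"
        obtain P' where P': "P' \<in> R q" "kernel_dim P' = kernel_dim P" "\<And>i j. \<bar>matrix P $ i $ j - matrix P' $ i $ j\<bar> \<le> 1 / 2 ^ q"
          using netR[OF P, of q] by blast
        note lin = orth_projD(1)[OF P] and lin' = orth_projD(1)[OF projR[OF P'(1)]]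
        have "hit C0 P (P (dyadic_point q a0)) q \<omega> \<subseteq> hit C0' P' (P' (dyadic_point q a0)) q \<omega>"
        proof
          fix a assume a: "a \<in> hit C0 P (P (dyadic_point q a0)) q \<omega>"
          define v where "v = dyadic_point q a - dyadic_point q a0"
          have ai: "a \<in> dyadic_index m q" using a by (simp add: hit_def)
          have vb: "\<bar>v $ j\<bar> \<le> 2 ^ m" for j
          proof -
            have "0 \<le> 1 / (2::real) ^ m" by simp
            then show ?thesis
              using dyadic_point_bounds[OF ai, of j] dyadic_point_bounds[OF a0, of j] elim
              unfolding v_def vector_minus_component by linarith
          qed
          have "norm (P v) \<le> real C0 / 2 ^ q" using a by (simp add: hit_def v_def linear_diff[OF lin])
          moreover have "norm (P v - P' v) \<le> real ?N * real ?N * (1 / 2 ^ q) * 2 ^ m"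
            by (rule matrix_close_norm[OF lin lin' P'(3) vb]) simp
          moreover have "norm (P' v) \<le> norm (P v) + norm (P v - P' v)"
            using norm_triangle_ineq4[of "P v" "P v - P' v"] by simp
          ultimately have "norm (P' v) \<le> real C0 / 2 ^ q + real ?N * real ?N * (1 / 2 ^ q) * 2 ^ m" by linarith
          also have "\<dots> = real C0' / 2 ^ q" by (simp add: C0'_def add_divide_distrib)
          finally show "a \<in> hit C0' P' (P' (dyadic_point q a0)) q \<omega>"
            using a by (simp add: hit_def v_def linear_diff[OF lin'])
        qed
        moreover have "finite (hit C0' P' (P' (dyadic_point q a0)) q \<omega>)"
          unfolding hit_def by (rule finite_subset[OF _ finite_dyadic_index[of m q]]) auto
        ultimately have "real (card (hit C0 P (P (dyadic_point q a0)) q \<omega>)) \<le> real (card (hit C0' P' (P' (dyadic_point q a0)) q \<omega>))"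
          by (simp add: card_mono)
        also have "\<dots> \<le> h P' q"
        proof -
          have "\<omega> \<in> space M" "\<omega> \<notin> ev q (P', a0)" using elim P'(1) a0 by (auto simp: Ev_def I_def)
          then show ?thesis by (simp add: ev_def)
        qed
        also have "\<dots> = h P q" by (simp add: h_def slab_excess_def P'(2))
        finally show "real (card {a \<in> dyadic_index m q. norm (P (dyadic_point q a :: real^'n) - P (dyadic_point q a0)) \<le> real C0 / 2 ^ q \<and>
            norm (W \<omega> (dyadic_point q a)) \<le> Ch * 2 powr (- (real q * (1 / 2 - \<epsilon>)))})
          \<le> 2 powr (real q * (slab_excess P (real CARD('d) / 2) + \<epsilon> * (real CARD('d) + 2)))"
          by (simp add: hit_def h_def \<kappa>_def \<gamma>_def)
      qed
    qed
  qed
qed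

end

section \<open>Projections of the zero set\<close>

text \<open>Since P is self-adjoint, its kernel is the orthogonal complement of its range.\<close>

lemma rank_plus_kernel_dim:
  fixes P :: "real^'n \<Rightarrow> real^'n"
  assumes "orth_proj P"
  shows "dim (range P) + kernel_dim P = CARD('n)"
proof -
  note lin = orth_projD(1)[OF assms]
  have "dim {y \<in> UNIV. \<forall>x\<in>range P. orthogonal x y} + dim (range P) = dim (UNIV :: (real^'n) set)"
    using linear_subspace_image[OF lin subspace_UNIV] by (intro dim_subspace_orthogonal_to_vectors) auto
  moreover have "{y \<in> UNIV. \<forall>x\<in>range P. orthogonal x y} = {y. P y = 0}"
  proof (intro set_eqI iffI)
    fix y assume "y \<in> {y \<in> UNIV. \<forall>x\<in>range P. orthogonal x y}"
    then have "P (P y) \<bullet> y = 0" by (auto simp: orthogonal_def)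
    then have "P y \<bullet> P y = 0" by (simp add: orth_projD(3)[OF assms])
    then show "y \<in> {y. P y = 0}" by simp
  next
    fix y assume "y \<in> {y. P y = 0}"
    then show "y \<in> {y \<in> UNIV. \<forall>x\<in>range P. orthogonal x y}"
      by (auto simp: orthogonal_def orth_projD(3)[OF assms])
  qed
  ultimately show ?thesis by (simp add: kernel_dim_def)
qed

lemma orth_proj_zero: "orth_proj (\<lambda>_. 0 :: real^'n)" "kernel_dim (\<lambda>_. 0 :: real^'n) = CARD('n)"
  by (auto simp: orth_proj_def kernel_dim_def module_hom_zero linear_iff)

context brownian
begin

text \<open>Kaufman's argument: few grid cubes over a small ball can meet the zero set, so an efficient cover of a
  projection lifts to an efficient cover of the zero set.\<close>
lemma projection_null_lift_AE:
  fixes m :: nat and \<epsilon> :: real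
  assumes eps: "0 < \<epsilon>" "\<epsilon> < 1 / 2"
  shows "AE \<omega> in M. \<forall>P s. orth_proj P \<longrightarrow> 0 < s \<longrightarrow>
     hausdorff_measure s (P ` (dyadic_box m \<inter> sheet_zero_set W \<omega>)) = 0 \<longrightarrow>
     hausdorff_measure (s + (slab_excess P (real CARD('d) / 2) + \<epsilon> * (real CARD('d) + 2))) (dyadic_box m \<inter> sheet_zero_set W \<omega>) = 0"
proof -
  let ?N = "real CARD('n)"
  define Ch where "Ch = real CARD('d) / (1 - 2 powr (- (1 / 2 - \<epsilon>)))"
  have "2 powr (- (1 / 2 - \<epsilon>)) < (1::real)" using eps by (intro powr_less_one) auto
  then have Ch: "0 < Ch" by (simp add: Ch_def)
  \<comment> \<open>Two images lie within 2^(-n) of the same point y, and rounding the two zeros to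
    the grid moves each by at most N 2^(-n).\<close>
  define C0 where "C0 = 2 * CARD('n) + 2"
  have "AE \<omega> in M. \<forall>\<^sub>F q in sequentially. \<forall>z\<in>dyadic_box m \<inter> sheet_zero_set W \<omega>.
     norm (W \<omega> (dyadic_point q (dyadic_floor q z))) \<le> Ch * 2 powr (- (real q * (1 / 2 - \<epsilon>)))"
    unfolding Ch_def using eps by (intro zeros_near_grid_AE) auto
  with slab_hits_AE[OF Ch eps(1), of m C0] show ?thesis
  proof eventually_elim
    case (elim \<omega>)
    let ?Z = "dyadic_box m \<inter> sheet_zero_set W \<omega>"
    have "\<forall>\<^sub>F q in sequentially. (\<forall>P. orth_proj P \<longrightarrow> (\<forall>a0\<in>dyadic_index m q.
      real (card {a \<in> dyadic_index m q. norm (P (dyadic_point q a :: real^'n) - P (dyadic_point q a0)) \<le> real C0 / 2 ^ q \<and>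
        norm (W \<omega> (dyadic_point q a)) \<le> Ch * 2 powr (- (real q * (1 / 2 - \<epsilon>)))})
      \<le> 2 powr (real q * (slab_excess P (real CARD('d) / 2) + \<epsilon> * (real CARD('d) + 2))))) \<and>
      (\<forall>z\<in>?Z. norm (W \<omega> (dyadic_point q (dyadic_floor q z))) \<le> Ch * 2 powr (- (real q * (1 / 2 - \<epsilon>)))) \<and> m \<le> q"
      using elim eventually_ge_at_top[of m] by (intro eventually_conj)
    then obtain n0 where n0: "\<And>q P a0. n0 \<le> q \<Longrightarrow> orth_proj P \<Longrightarrow> a0 \<in> dyadic_index m q \<Longrightarrow>
        real (card {a \<in> dyadic_index m q. norm (P (dyadic_point q a :: real^'n) - P (dyadic_point q a0)) \<le> real C0 / 2 ^ q \<and>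
        norm (W \<omega> (dyadic_point q a)) \<le> Ch * 2 powr (- (real q * (1 / 2 - \<epsilon>)))})
        \<le> 2 powr (real q * (slab_excess P (real CARD('d) / 2) + \<epsilon> * (real CARD('d) + 2)))"
      and near: "\<And>q z. n0 \<le> q \<Longrightarrow> z \<in> ?Z \<Longrightarrow> norm (W \<omega> (dyadic_point q (dyadic_floor q z))) \<le> Ch * 2 powr (- (real q * (1 / 2 - \<epsilon>)))"
      and mn: "\<And>q. n0 \<le> q \<Longrightarrow> m \<le> q"
      unfolding eventually_sequentially by blast
    show ?case
    proof (intro allI impI)
      fix P :: "real^'n \<Rightarrow> real^'n" and s :: real
      assume P: "orth_proj P" and s: "0 < s" and null: "hausdorff_measure s (P ` ?Z) = 0"
      let ?u = "slab_excess P (real CARD('d) / 2) + \<epsilon> * (real CARD('d) + 2)"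
      note lin = orth_projD(1)[OF P]
      have u0: "0 \<le> ?u" using eps by (auto simp: slab_excess_def intro!: add_nonneg_nonneg mult_nonneg_nonneg)
      show "hausdorff_measure (s + ?u) ?Z = 0"
      proof (rule hausdorff_null_preimage[OF s u0, of ?N n0 _ P])
        fix n and y :: "real^'n" assume n: "n0 \<le> n"
        let ?B = "?Z \<inter> {z. dist (P z) y \<le> 2 powr (- real n)}"
        have p2: "2 powr (- real n) = 1 / 2 ^ n" by (simp add: powr_minus_divide powr_realpow)
        have close: "norm (z - dyadic_point n (dyadic_floor n z)) \<le> ?N / 2 ^ n" if "z \<in> ?Z" for z
        proof -
          have zp: "z \<in> pos_orthant" using that by (auto simp: sheet_zero_set_def)
          have "norm (z - dyadic_point n (dyadic_floor n z)) \<le> (\<Sum>k\<in>UNIV. \<bar>(z - dyadic_point n (dyadic_floor n z)) $ k\<bar>)"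
            by (rule norm_le_l1_cart)
          also have "\<dots> \<le> (\<Sum>k\<in>(UNIV::'n set). 1 / 2 ^ n)"
          proof (rule sum_mono)
            fix k
            show "\<bar>(z - dyadic_point n (dyadic_floor n z)) $ k\<bar> \<le> 1 / 2 ^ n"
              unfolding vector_minus_component using dyadic_floor_close[OF zp, where q = n and k = k] by linarith
          qed
          finally show ?thesis by simp
        qed
        show "\<exists>T. finite T \<and> real (card T) \<le> 2 powr (real n * ?u) \<and> ?B \<subseteq> (\<Union>t\<in>T. cball t (?N * 2 powr (- real n)))"
        proof (cases "?B = {}")
          case True
          then show ?thesis by (intro exI[of _ "{}"]) auto
        next
          case False
          \<comment> \<open>The count is available for slabs centred at images of grid points, so
            the arbitrary centre y is replaced by the image of the grid point below some zero over
            the ball.\<close>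
          then obtain z0 where z0: "z0 \<in> ?Z" "dist (P z0) y \<le> 2 powr (- real n)" by auto
          let ?ref = "dyadic_floor n z0"
          let ?H = "{a \<in> dyadic_index m n. norm (P (dyadic_point n a :: real^'n) - P (dyadic_point n ?ref)) \<le> real C0 / 2 ^ n \<and>
              norm (W \<omega> (dyadic_point n a)) \<le> Ch * 2 powr (- (real n * (1 / 2 - \<epsilon>)))}"
          have finH: "finite ?H" by (rule finite_subset[OF _ finite_dyadic_index[of m n]]) auto
          have a0: "?ref \<in> dyadic_index m n" using z0 mn[OF n] by (intro dyadic_floor_index) auto
          show ?thesis
          proof (intro exI[of _ "dyadic_point n ` ?H"] conjI)
            show "finite (dyadic_point n ` ?H)" using finH by simp
            have "real (card (dyadic_point n ` ?H :: (real^'n) set)) \<le> real (card ?H)" using card_image_le[OF finH] by simp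
            also have "\<dots> \<le> 2 powr (real n * ?u)" by (rule n0[OF n P a0])
            finally show "real (card (dyadic_point n ` ?H :: (real^'n) set)) \<le> 2 powr (real n * ?u)" .
            show "?B \<subseteq> (\<Union>t\<in>dyadic_point n ` ?H. cball t (?N * 2 powr (- real n)))"
            proof
              fix z assume z: "z \<in> ?B"
              let ?a = "dyadic_floor n z"
              have ai: "?a \<in> dyadic_index m n" using z mn[OF n] by (intro dyadic_floor_index) auto
              have "P (dyadic_point n ?a) - P (dyadic_point n ?ref)
                = (P z - y) - (P z0 - y) - P (z - dyadic_point n ?a) + P (z0 - dyadic_point n ?ref)"
                by (simp add: linear_diff[OF lin])
              then have "norm (P (dyadic_point n ?a) - P (dyadic_point n ?ref))
                \<le> norm (P z - y) + norm (P z0 - y) + norm (P (z - dyadic_point n ?a)) + norm (P (z0 - dyadic_point n ?ref))"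
                by (smt (verit) norm_triangle_ineq norm_triangle_ineq4)
              also have "\<dots> \<le> 1 / 2 ^ n + 1 / 2 ^ n + ?N / 2 ^ n + ?N / 2 ^ n"
                using z z0 close[of z] close[of z0] orth_projD(4)[OF P, of "z - dyadic_point n ?a"]
                  orth_projD(4)[OF P, of "z0 - dyadic_point n (dyadic_floor n z0)"]
                by (intro add_mono) (auto simp: dist_norm p2 intro: order_trans)
              also have "\<dots> = real C0 / 2 ^ n" by (simp add: C0_def add_divide_distrib)
              finally have "?a \<in> ?H" using ai near[OF n, of z] z by auto
              moreover have "z \<in> cball (dyadic_point n ?a) (?N * 2 powr (- real n))"
                using close[of z] z by (simp add: p2 dist_norm norm_minus_commute)
              ultimately show "z \<in> (\<Union>t\<in>dyadic_point n ` ?H. cball t (?N * 2 powr (- real n)))" by blast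
            qed
          qed
        qed
      qed (use null in auto)
    qed
  qed
qed

lemma pos_orthant_UN: "(pos_orthant :: (real^'n) set) = (\<Union>m. dyadic_box m)"
proof
  show "(pos_orthant :: (real^'n) set) \<subseteq> (\<Union>m. dyadic_box m)"
  proof
    fix z :: "real^'n" assume z: "z \<in> pos_orthant"
    have "\<forall>\<^sub>F m in sequentially. 1 / 2 ^ m \<le> z $ k \<and> z $ k \<le> 2 ^ m" for k
    proof (rule eventually_conj)
      have "0 < z $ k" using z by (simp add: pos_orthant_def)
      moreover have "(\<lambda>m. 1 / 2 ^ m :: real) \<longlonglongrightarrow> 0" by real_asymp
      ultimately have "\<forall>\<^sub>F m in sequentially. 1 / 2 ^ m < z $ k" by (rule order_tendstoD(2)[rotated])
      then show "\<forall>\<^sub>F m in sequentially. 1 / 2 ^ m \<le> z $ k" by eventually_elim simp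
      have "filterlim (\<lambda>m. 2 ^ m :: real) at_top sequentially" by real_asymp
      then show "\<forall>\<^sub>F m in sequentially. z $ k \<le> 2 ^ m" by (auto simp: filterlim_at_top)
    qed
    then have "\<forall>\<^sub>F m in sequentially. \<forall>k. 1 / 2 ^ m \<le> z $ k \<and> z $ k \<le> 2 ^ m"
      by (rule eventually_all_finite)
    then obtain m where "z \<in> dyadic_box m" unfolding dyadic_box_iff eventually_sequentially by blast
    then show "z \<in> (\<Union>m. dyadic_box m)" by blast
  qed
  show "(\<Union>m. dyadic_box m) \<subseteq> (pos_orthant :: (real^'n) set)" using dyadic_box_pos by blast
qed

text \<open>Countably many boxes and countably many values of \<epsilon> give one exceptional null
  set. Afterwards the boxes are united, as null sets allow countable unions, and any loss \<delta>
  is reached by a small enough \<epsilon>.\<close>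

lemma projection_null_lift_zero_set_AE:
  "AE \<omega> in M. \<forall>P s \<delta>. orth_proj P \<longrightarrow> 0 < s \<longrightarrow> 0 < \<delta> \<longrightarrow> hausdorff_measure s (P ` sheet_zero_set W \<omega>) = 0 \<longrightarrow>
     hausdorff_measure (s + slab_excess P (real CARD('d) / 2) + \<delta>) (sheet_zero_set W \<omega>) = 0"
proof -
  \<comment> \<open>The shift by 3 keeps all values below 1/2, as the lift requires.\<close>
  define eps where "eps = (\<lambda>i::nat. 1 / (real i + 3))"
  have "AE \<omega> in M. \<forall>m i. \<forall>P s. orth_proj P \<longrightarrow> 0 < s \<longrightarrow>
     hausdorff_measure s (P ` (dyadic_box m \<inter> sheet_zero_set W \<omega>)) = 0 \<longrightarrow>
     hausdorff_measure (s + (slab_excess P (real CARD('d) / 2) + eps i * (real CARD('d) + 2))) (dyadic_box m \<inter> sheet_zero_set W \<omega>) = 0"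
    unfolding AE_all_countable by (intro allI projection_null_lift_AE) (auto simp: eps_def field_simps)
  then show ?thesis
  proof eventually_elim
    case (elim \<omega>)
    show ?case
    proof (intro allI impI)
      fix P :: "real^'n \<Rightarrow> real^'n" and s \<delta> :: real
      assume P: "orth_proj P" and s: "0 < s" and d: "0 < \<delta>" and null: "hausdorff_measure s (P ` sheet_zero_set W \<omega>) = 0"
      have "(\<lambda>i. eps i * (real CARD('d) + 2)) \<longlonglongrightarrow> 0" unfolding eps_def by real_asymp
      then have "\<forall>\<^sub>F i in sequentially. eps i * (real CARD('d) + 2) < \<delta>" using d by (rule order_tendstoD(2))
      then obtain i where i: "eps i * (real CARD('d) + 2) < \<delta>" by (auto simp: eventually_sequentially)
      have "hausdorff_measure (s + slab_excess P (real CARD('d) / 2) + \<delta>) (dyadic_box m \<inter> sheet_zero_set W \<omega>) = 0" for m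
      proof (rule hausdorff_null_mono_exponent)
        have "hausdorff_measure s (P ` (dyadic_box m \<inter> sheet_zero_set W \<omega>)) = 0"
          using null by (rule hausdorff_null_subset[rotated]) auto
        then show "hausdorff_measure (s + (slab_excess P (real CARD('d) / 2) + eps i * (real CARD('d) + 2))) (dyadic_box m \<inter> sheet_zero_set W \<omega>) = 0"
          using elim P s by blast
        show "s + (slab_excess P (real CARD('d) / 2) + eps i * (real CARD('d) + 2)) \<le> s + slab_excess P (real CARD('d) / 2) + \<delta>"
          using i by simp
      qed
      then have "hausdorff_measure (s + slab_excess P (real CARD('d) / 2) + \<delta>) (\<Union>m. dyadic_box m \<inter> sheet_zero_set W \<omega>) = 0"
        by (rule hausdorff_null_UN)
      moreover have "(\<Union>m. dyadic_box m \<inter> sheet_zero_set W \<omega>) = sheet_zero_set W \<omega>"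
        using pos_orthant_UN by (auto simp: sheet_zero_set_def)
      ultimately show "hausdorff_measure (s + slab_excess P (real CARD('d) / 2) + \<delta>) (sheet_zero_set W \<omega>) = 0" by simp
    qed
  qed
qed

end

lemma hausdorff_null_singleton:
  assumes s: "0 < s" and A: "A \<subseteq> {a :: 'a::metric_space}"
  shows "hausdorff_measure s A = 0"
  unfolding hausdorff_measure_eq_0_iff
proof (intro allI impI)
  fix \<delta> :: real assume "0 < \<delta>"
  then have "hausdorff_pre s \<delta> A \<le> ennreal (0 powr s)"
    using A s by (intro hausdorff_pre_single) auto
  then show "hausdorff_pre s \<delta> A = 0" using s by simp
qed

theorem theorem2:
  fixes M :: "'w measure" and W :: "'w \<Rightarrow> real^'n \<Rightarrow> real^'d"
  assumes "brownian_sheet M W"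
    and "real CARD('n) > real CARD('d) / 2"
  shows "AE \<omega> in M.
           hausdorff_dim (sheet_zero_set W \<omega>) = real CARD('n) - real CARD('d) / 2 \<and>
           (\<forall>P :: real^'n \<Rightarrow> real^'n. orth_proj P \<and>
               real CARD('n) - real CARD('d) / 2 \<le> real (dim (range P)) \<and>
               dim (range P) < CARD('n) \<longrightarrow>
             hausdorff_dim (P ` sheet_zero_set W \<omega>) = hausdorff_dim (sheet_zero_set W \<omega>))"
proof -
  have "prob_space M" using assms(1) by (simp add: brownian_sheet_def)
  then interpret brownian M W using assms(1) by (simp add: brownian_def brownian_axioms_def)
  define al where "al = real CARD('n) - real CARD('d) / 2"
  have al: "0 < al" using assms(2) by (simp add: al_def)
  \<comment> \<open>Countably many exponents converging to \<open>al\<close> from below, all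
    positive since the sequence starts at half of \<open>al\<close>; by monotonicity in the exponent
    they settle every s < \<open>al\<close> on one event.\<close>
  define sq where "sq = (\<lambda>i::nat. al * (1 - 1 / (real i + 2)))"
  have "AE \<omega> in M. \<forall>i. hausdorff_measure (sq i) (sheet_zero_set W \<omega>) \<noteq> 0"
    unfolding AE_all_countable
  proof
    fix i
    have "0 < sq i" using al by (simp add: sq_def)
    moreover have "sq i < al" using al by (simp add: sq_def right_diff_distrib)
    ultimately show "AE \<omega> in M. hausdorff_measure (sq i) (sheet_zero_set W \<omega>) \<noteq> 0"
      by (intro zero_set_hausdorff_measure_nonzero) (auto simp: al_def)
  qed
  with projection_null_lift_zero_set_AE show ?thesis
  proof eventually_elim
    case (elim \<omega>)
    let ?Z = "sheet_zero_set W \<omega>"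
    have low: "hausdorff_measure s ?Z \<noteq> 0" if s: "s < al" for s
    proof
      assume null: "hausdorff_measure s ?Z = 0"
      have "sq \<longlonglongrightarrow> al" unfolding sq_def using al by real_asymp
      then have "\<forall>\<^sub>F i in sequentially. s < sq i" using s by (rule order_tendstoD(1))
      then obtain i where "s < sq i" by (auto simp: eventually_sequentially)
      then have "hausdorff_measure (sq i) ?Z = 0" by (intro hausdorff_null_mono_exponent[OF null]) simp
      then show False using elim(2) by blast
    qed
    have up: "hausdorff_measure s ?Z = 0" if s: "al < s" for s
    proof -
      \<comment> \<open>Half of the margin is the exponent in which the one-point image is null, the
        other half is the loss \<delta> of the lift; the excess of the zero projection is
        \<open>al\<close> itself.\<close>
      define e where "e = (s - al) / 2"
      have e: "0 < e" "s = e + al + e" using s by (auto simp: e_def field_simps)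
      have "hausdorff_measure e ((\<lambda>_. 0) ` ?Z :: (real^'n) set) = 0"
        using e(1) by (intro hausdorff_null_singleton[of _ _ 0]) auto
      moreover have "slab_excess (\<lambda>_. 0 :: real^'n) (real CARD('d) / 2) = al"
        using al by (simp add: slab_excess_def orth_proj_zero(2) al_def)
      ultimately show ?thesis using elim(1) orth_proj_zero(1) e by metis
    qed
    have dimZ: "hausdorff_dim ?Z = al" using al up low by (intro hausdorff_dim_eqI)
    have "hausdorff_dim (P ` ?Z) = al" if P: "orth_proj P" and rk: "al \<le> real (dim (range P))" for P :: "real^'n \<Rightarrow> real^'n"
    proof (rule hausdorff_dim_eqI[OF al])
      show "hausdorff_measure s (P ` ?Z) = 0" if "al < s" for s
      proof (rule hausdorff_null_image)
        show "dist (P x) (P y) \<le> dist x y" for x y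
          using orth_projD(4)[OF P, of "x - y"] by (simp add: dist_norm linear_diff[OF orth_projD(1)[OF P]])
      qed (use that al up in auto)
      fix s assume s: "0 < s" "s < al"
      \<comment> \<open>Here the rank hypothesis enters: it makes the lift lossless up to an
        arbitrarily small \<delta>.\<close>
      have "real (kernel_dim P) \<le> real CARD('d) / 2"
        using rank_plus_kernel_dim[OF P] rk by (simp add: al_def)
      then have e0: "slab_excess P (real CARD('d) / 2) = 0" by (simp add: slab_excess_def)
      show "hausdorff_measure s (P ` ?Z) \<noteq> 0"
      proof
        assume "hausdorff_measure s (P ` ?Z) = 0"
        moreover have "0 < (al - s) / 2" using s by simp
        \<comment> \<open>The lift ends at the midpoint between s and \<open>al\<close>, an exponent
          at which the zero set is known not to be null.\<close>
        ultimately have "hausdorff_measure (s + 0 + (al - s) / 2) ?Z = 0"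
          using elim(1) P s(1) e0 by metis
        moreover have "s + 0 + (al - s) / 2 < al" using s by (simp add: field_simps)
        ultimately show False using low by blast
      qed
    qed
    then show ?case using dimZ by (simp add: al_def)
  qed
qed

end
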